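(* Let $V$ be a complex vector bundle of rank $n$ with volume form over a surface $S$ equipped with a complex structure, $L\subset V$ a line subbundle, and $U\subset S$ an open chart with complex coordinate $z$. The functions $(\hat\mu_2,\dots,\hat\mu_n,\hat t_2,\dots,\hat t_n)$ (complex-valued functions on $U$) parametrize $\mathcal{A}^*_L/\!/\mathcal{P}_L(U)$, the space of $L$-generic $L$-parabolic connections on $U$ modulo gauge transformations preserving $L$; that is, these functions are independent and the class of the connection is determined by them.
   Context: $\mathcal{A}(U)$ is the space of $\mathfrak{sl}_n(\mathbb{C})$-connections (preserving the volume form) on $V|_U$. Choose a unit-volume local frame of $V|_U$ whose first vector generates $L$; $\mathcal{P}_L(U)$ is the group of $\mathrm{SL}_n(\mathbb{C})$-valued gauge transformations on $U$ preserving $L$ (matrices whose first column is zero below the first entry). $d_A\in\mathcal{A}(U)$ is $L$-parabolic if it lies in the zero level of the moment map for $\mathcal{P}_L(U)$ (w.r.t. the Atiyah–Bott symplectic form $\int\operatorname{tr}\delta A\wedge\delta A$), which means that in such a frame the curvature matrix has entries $\xi_2,\dots,\xi_n$ in positions $(1,2),\dots,(1,n)$ and zero elsewhere. Write $d_A=d+A_1dz+A_2d\bar z$, $\nabla=\partial+A_1$, $\bar\nabla=\bar\partial+A_2$ with $\partial=\partial/\partial z$, $\bar\partial=\partial/\partial\bar z$. $d_A$ is $L$-generic on $U$ if for a nowhere vanishing section $\sigma$ of $L|_U$ one has $\det(\sigma,\nabla\sigma,\dots,\nabla^{n-1}\sigma)\ne0$ everywhere on $U$ (independent of $\sigma$).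 Then there is a section $s$ of $L|_U$, unique up to multiplication by an $n$-th root of unity, such that $B=(s,\nabla s,\dots,\nabla^{n-1}s)$ is a basis of unit volume. The functions are defined by $$\nabla^ns=\hat t_ns+\hat t_{n-1}\nabla s+\dots+\hat t_2\nabla^{n-2}s,\qquad\bar\nabla s=\hat\mu_1s+\hat\mu_2\nabla s+\dots+\hat\mu_n\nabla^{n-1}s ,$$ and do not depend on the choice of $s$. $\mathcal{A}^*_L/\!/\mathcal{P}_L(U)$ is the set of $L$-generic $L$-parabolic connections on $U$ modulo $\mathcal{P}_L(U)$.
   Formalization: The open chart U is assumed simply connected: on an annulus an L-generic L-parabolic connection may have no unit-volume section s, and connections with the same functions can be inequivalent. The unit-volume frame of V over U adapted to L is taken to exist, as in the setting. *)

theory Defs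
  imports "HOL-Analysis.Analysis"
begin

section \<open>Smooth functions on open subsets of the complex plane\<close>

text \<open>Real differentiability of order \<open>k\<close>; it is only used on open sets \<open>W\<close>.\<close>

primrec Ck_on :: "nat \<Rightarrow> complex set \<Rightarrow> (complex \<Rightarrow> complex) \<Rightarrow> bool" where
  "Ck_on 0 W f \<longleftrightarrow> continuous_on W f"
| "Ck_on (Suc k) W f \<longleftrightarrow> (\<forall>w\<in>W. f differentiable (at w)) \<and>
     (\<forall>v. Ck_on k W (\<lambda>w. frechet_derivative f (at w) v))"

definition Csmooth_on :: "complex set \<Rightarrow> (complex \<Rightarrow> complex) \<Rightarrow> bool" where
  "Csmooth_on W f \<longleftrightarrow> (\<forall>k. Ck_on k W f)"

definition wirt :: "(complex \<Rightarrow> complex) \<Rightarrow> complex \<Rightarrow> complex" where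
  "wirt f w = (frechet_derivative f (at w) 1 - \<i> * frechet_derivative f (at w) \<i>) / 2"

definition wirt_bar :: "(complex \<Rightarrow> complex) \<Rightarrow> complex \<Rightarrow> complex" where
  "wirt_bar f w = (frechet_derivative f (at w) 1 + \<i> * frechet_derivative f (at w) \<i>) / 2"


section \<open>The surface, the bundle, the volume form and the line subbundle\<close>

text \<open>The surface is the type \<open>'s\<close>. The fibres of the bundle are linear subspaces of an arbitrary
  complex vector space \<open>'v\<close> with scalar multiplication \<open>smul\<close>; this is no restriction, since
  one may take \<open>'v\<close> to be the algebraic direct sum of all the fibres. The smooth structure of the
  bundle is given by an atlas of local frames. Frames, and the arguments of the volume form,
  are indexed from \<open>0\<close> to \<open>n - 1\<close>.\<close>

record ('s, 'v) vbundle =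
  charts :: "('s set \<times> ('s \<Rightarrow> complex)) set"
  smul :: "complex \<Rightarrow> 'v \<Rightarrow> 'v"
  fibre :: "'s \<Rightarrow> 'v set"
  frames :: "('s set \<times> (nat \<Rightarrow> 's \<Rightarrow> 'v)) set"
  vol :: "'s \<Rightarrow> (nat \<Rightarrow> 'v) \<Rightarrow> complex"
  line :: "'s \<Rightarrow> 'v set"

definition complex_structure ::
    "('s::topological_space, 'v::ab_group_add) vbundle \<Rightarrow> bool" where
  "complex_structure X \<longleftrightarrow>
     (\<Union>(U, z)\<in>charts X. U) = UNIV \<and>
     (\<forall>(U, z)\<in>charts X. open U \<and> open (z ` U) \<and> homeomorphism U (z ` U) z (inv_into U z)) \<and>
     (\<forall>(U, z)\<in>charts X. \<forall>(W, w)\<in>charts X. (w \<circ> inv_into U z) holomorphic_on (z ` (U \<inter> W)))"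

definition smooth_fun ::
    "('s, 'v) vbundle \<Rightarrow> 's set \<Rightarrow> ('s \<Rightarrow> complex) \<Rightarrow> bool" where
  "smooth_fun X W f \<longleftrightarrow>
     (\<forall>(U, z)\<in>charts X. Csmooth_on (z ` (U \<inter> W)) (f \<circ> inv_into U z))"

text \<open>Functions and sections over \<open>W\<close> are represented by total functions vanishing outside \<open>W\<close>.\<close>

definition smooth_funs :: "('s, 'v) vbundle \<Rightarrow> 's set \<Rightarrow> ('s \<Rightarrow> complex) set" where
  "smooth_funs X W = {f. smooth_fun X W f \<and> (\<forall>p. p \<notin> W \<longrightarrow> f p = 0)}"

definition smooth_comb ::
    "('s, 'v::ab_group_add) vbundle \<Rightarrow> nat \<Rightarrow> 's set \<Rightarrow> (nat \<Rightarrow> 's \<Rightarrow> 'v) \<Rightarrow> ('s \<Rightarrow> 'v) \<Rightarrow> bool" where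
  "smooth_comb X n W e \<sigma> \<longleftrightarrow>
     (\<exists>c. (\<forall>i<n. smooth_fun X W (c i)) \<and> (\<forall>p\<in>W. \<sigma> p = (\<Sum>i<n. smul X (c i p) (e i p))))"

definition basis_at ::
    "('s, 'v::ab_group_add) vbundle \<Rightarrow> nat \<Rightarrow> 's \<Rightarrow> (nat \<Rightarrow> 'v) \<Rightarrow> bool" where
  "basis_at X n p b \<longleftrightarrow>
     bij_betw (\<lambda>c. \<Sum>i<n. smul X (c i) (b i)) ({..<n} \<rightarrow>\<^sub>E UNIV) (fibre X p)"

definition vector_bundle ::
    "nat \<Rightarrow> ('s::topological_space, 'v::ab_group_add) vbundle \<Rightarrow> bool" where
  "vector_bundle n X \<longleftrightarrow>
     vector_space (smul X) \<and>
     (\<Union>(W, e)\<in>frames X. W) = UNIV \<and>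
     (\<forall>(W, e)\<in>frames X. open W \<and> (\<forall>p\<in>W. basis_at X n p (\<lambda>i. e i p))) \<and>
     (\<forall>(W, e)\<in>frames X. \<forall>(W', e')\<in>frames X. \<forall>j<n. smooth_comb X n (W \<inter> W') e (e' j))"

definition sections ::
    "('s, 'v::ab_group_add) vbundle \<Rightarrow> nat \<Rightarrow> 's set \<Rightarrow> ('s \<Rightarrow> 'v) set" where
  "sections X n W = {\<sigma>.
     (\<forall>p\<in>W. \<sigma> p \<in> fibre X p) \<and> (\<forall>p. p \<notin> W \<longrightarrow> \<sigma> p = 0) \<and>
     (\<forall>(W', e)\<in>frames X. smooth_comb X n (W \<inter> W') e \<sigma>)}"

definition volume_form ::
    "nat \<Rightarrow> ('s, 'v::ab_group_add) vbundle \<Rightarrow> bool" where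
  "volume_form n X \<longleftrightarrow>
     (\<forall>p v v'. (\<forall>i<n. v i = v' i) \<longrightarrow> vol X p v = vol X p v') \<and>
     (\<forall>p v. (\<forall>i<n. v i \<in> fibre X p) \<longrightarrow>
        (\<forall>j<n. \<forall>x\<in>fibre X p. \<forall>y\<in>fibre X p. \<forall>a.
           vol X p (v(j := smul X a x + y)) = a * vol X p (v(j := x)) + vol X p (v(j := y))) \<and>
        (\<forall>i<n. \<forall>j<n. i \<noteq> j \<and> v i = v j \<longrightarrow> vol X p v = 0)) \<and>
     (\<forall>(W, e)\<in>frames X. smooth_fun X W (\<lambda>p. vol X p (\<lambda>i. e i p)) \<and>
        (\<forall>p\<in>W. vol X p (\<lambda>i. e i p) \<noteq> 0))"

definition generates_line ::
    "('s, 'v::ab_group_add) vbundle \<Rightarrow> 's set \<Rightarrow> ('s \<Rightarrow> 'v) \<Rightarrow> bool" where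
  "generates_line X W \<sigma> \<longleftrightarrow> (\<forall>p\<in>W. \<sigma> p \<noteq> 0 \<and> line X p = range (\<lambda>a. smul X a (\<sigma> p)))"

definition line_subbundle ::
    "nat \<Rightarrow> ('s::topological_space, 'v::ab_group_add) vbundle \<Rightarrow> bool" where
  "line_subbundle n X \<longleftrightarrow>
     (\<forall>p. \<exists>W \<sigma>. open W \<and> p \<in> W \<and> \<sigma> \<in> sections X n W \<and> generates_line X W \<sigma>)"

definition line_sections ::
    "('s, 'v::ab_group_add) vbundle \<Rightarrow> nat \<Rightarrow> 's set \<Rightarrow> ('s \<Rightarrow> 'v) set" where
  "line_sections X n W = {\<sigma>\<in>sections X n W. \<forall>p\<in>W. \<sigma> p \<in> line X p}"

definition adapted_frame ::
    "('s, 'v::ab_group_add) vbundle \<Rightarrow> nat \<Rightarrow> 's set \<Rightarrow> (nat \<Rightarrow> 's \<Rightarrow> 'v) \<Rightarrow> bool" where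
  "adapted_frame X n U e \<longleftrightarrow>
     (\<forall>i<n. e i \<in> sections X n U) \<and>
     (\<forall>p\<in>U. basis_at X n p (\<lambda>i. e i p) \<and> vol X p (\<lambda>i. e i p) = 1) \<and>
     generates_line X U (e 0)"


section \<open>Connections over a chart \<open>(U, z)\<close>\<close>

definition dz :: "'s set \<Rightarrow> ('s \<Rightarrow> complex) \<Rightarrow> ('s \<Rightarrow> complex) \<Rightarrow> 's \<Rightarrow> complex" where
  "dz U z f p = (if p \<in> U then wirt (f \<circ> inv_into U z) (z p) else 0)"

definition dz_bar :: "'s set \<Rightarrow> ('s \<Rightarrow> complex) \<Rightarrow> ('s \<Rightarrow> complex) \<Rightarrow> 's \<Rightarrow> complex" where
  "dz_bar U z f p = (if p \<in> U then wirt_bar (f \<circ> inv_into U z) (z p) else 0)"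

definition smult_sec ::
    "('s, 'v) vbundle \<Rightarrow> ('s \<Rightarrow> complex) \<Rightarrow> ('s \<Rightarrow> 'v) \<Rightarrow> 's \<Rightarrow> 'v" where
  "smult_sec X f \<sigma> p = smul X (f p) (\<sigma> p)"

text \<open>A covariant derivative over the derivation \<open>\<delta>\<close> (\<open>dz\<close> or \<open>dz_bar\<close>), acting on sections over
  \<open>U\<close> and preserving the volume form. Complex linearity is the Leibniz rule for constants.\<close>

definition covariant_derivative ::
    "('s, 'v::ab_group_add) vbundle \<Rightarrow> nat \<Rightarrow> 's set \<Rightarrow> (('s \<Rightarrow> complex) \<Rightarrow> 's \<Rightarrow> complex)
      \<Rightarrow> (('s \<Rightarrow> 'v) \<Rightarrow> 's \<Rightarrow> 'v) \<Rightarrow> bool" where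
  "covariant_derivative X n U \<delta> D \<longleftrightarrow>
     (\<forall>\<sigma>\<in>sections X n U. D \<sigma> \<in> sections X n U) \<and>
     (\<forall>\<sigma>\<in>sections X n U. \<forall>\<tau>\<in>sections X n U.
        D (\<lambda>p. \<sigma> p + \<tau> p) = (\<lambda>p. D \<sigma> p + D \<tau> p)) \<and>
     (\<forall>f\<in>smooth_funs X U. \<forall>\<sigma>\<in>sections X n U.
        D (smult_sec X f \<sigma>) = (\<lambda>p. smul X (\<delta> f p) (\<sigma> p) + smul X (f p) (D \<sigma> p))) \<and>
     (\<forall>\<tau>. (\<forall>i<n. \<tau> i \<in> sections X n U) \<longrightarrow>
        (\<forall>p\<in>U. \<delta> (\<lambda>q. vol X q (\<lambda>i. \<tau> i q)) p =
           (\<Sum>j<n. vol X p ((\<lambda>i. \<tau> i p)(j := D (\<tau> j) p)))))"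

text \<open>The connection \<open>\<nabla> dz + \<nabla>' dw\<close>, \<open>w = cnj z\<close>, is the pair \<open>(\<nabla>, \<nabla>')\<close>. Only the action on sections over \<open>U\<close>
  is relevant; pairs with the same action are identified by \<open>gauge_rel\<close> below.\<close>

type_synonym ('s, 'v) conn = "(('s \<Rightarrow> 'v) \<Rightarrow> 's \<Rightarrow> 'v) \<times> (('s \<Rightarrow> 'v) \<Rightarrow> 's \<Rightarrow> 'v)"

definition connections ::
    "('s, 'v::ab_group_add) vbundle \<Rightarrow> nat \<Rightarrow> 's set \<Rightarrow> ('s \<Rightarrow> complex) \<Rightarrow> ('s, 'v) conn set" where
  "connections X n U z = {(D, D').
     covariant_derivative X n U (dz U z) D \<and> covariant_derivative X n U (dz_bar U z) D'}"

text \<open>The curvature is \<open>curv (\<nabla>, \<nabla>') dz \<and> dw\<close>.\<close>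

definition curv :: "('s, 'v::ab_group_add) conn \<Rightarrow> ('s \<Rightarrow> 'v) \<Rightarrow> 's \<Rightarrow> 'v" where
  "curv A \<sigma> p = fst A (snd A \<sigma>) p - snd A (fst A \<sigma>) p"

text \<open>With respect to the trace pairing, the annihilator of the Lie algebra of the gauge group below
  (trace-free matrices whose first column is zero below the diagonal) consists of the matrices that are
  zero except in the first row to the right of the diagonal.\<close>

definition parabolic ::
    "('s, 'v::ab_group_add) vbundle \<Rightarrow> nat \<Rightarrow> 's set \<Rightarrow> ('s, 'v) conn \<Rightarrow> bool" where
  "parabolic X n U A \<longleftrightarrow>
     (\<exists>e. adapted_frame X n U e \<and> (\<forall>p\<in>U. curv A (e 0) p = 0) \<and>
        (\<forall>j\<in>{1..<n}. \<exists>\<xi>\<in>smooth_funs X U. \<forall>p\<in>U. curv A (e j) p = smul X (\<xi> p) (e 0 p)))"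

definition generic ::
    "('s, 'v::ab_group_add) vbundle \<Rightarrow> nat \<Rightarrow> 's set \<Rightarrow> ('s, 'v) conn \<Rightarrow> bool" where
  "generic X n U A \<longleftrightarrow>
     (\<exists>\<sigma>\<in>line_sections X n U. (\<forall>p\<in>U. \<sigma> p \<noteq> 0) \<and>
        (\<forall>p\<in>U. vol X p (\<lambda>k. (fst A ^^ k) \<sigma> p) \<noteq> 0))"

definition generic_parabolic ::
    "('s, 'v::ab_group_add) vbundle \<Rightarrow> nat \<Rightarrow> 's set \<Rightarrow> ('s \<Rightarrow> complex) \<Rightarrow> ('s, 'v) conn set" where
  "generic_parabolic X n U z = {A\<in>connections X n U z. generic X n U A \<and> parabolic X n U A}"


section \<open>Gauge transformations preserving the line subbundle\<close>

definition gauge_act ::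
    "'s set \<Rightarrow> ('s \<Rightarrow> 'v \<Rightarrow> 'v) \<Rightarrow> ('s \<Rightarrow> 'v::ab_group_add) \<Rightarrow> 's \<Rightarrow> 'v" where
  "gauge_act U g \<sigma> p = (if p \<in> U then g p (\<sigma> p) else 0)"

text \<open>The last condition says that \<open>g\<close> and its inverse are smooth.\<close>

definition line_gauge_group ::
    "('s, 'v::ab_group_add) vbundle \<Rightarrow> nat \<Rightarrow> 's set \<Rightarrow> ('s \<Rightarrow> 'v \<Rightarrow> 'v) set" where
  "line_gauge_group X n U = {g.
     (\<forall>p\<in>U. bij_betw (g p) (fibre X p) (fibre X p) \<and>
        (\<forall>x\<in>fibre X p. \<forall>y\<in>fibre X p. \<forall>a. g p (smul X a x + y) = smul X a (g p x) + g p y) \<and>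
        (\<forall>v. (\<forall>i<n. v i \<in> fibre X p) \<longrightarrow> vol X p (\<lambda>i. g p (v i)) = vol X p v) \<and>
        g p ` line X p = line X p) \<and>
     gauge_act U g ` sections X n U = sections X n U}"

text \<open>\<open>B = g A g\<^sup>-\<^sup>1\<close>, written without the inverse.\<close>

definition gauge_rel ::
    "('s, 'v::ab_group_add) vbundle \<Rightarrow> nat \<Rightarrow> 's set \<Rightarrow> ('s \<Rightarrow> complex)
      \<Rightarrow> (('s, 'v) conn \<times> ('s, 'v) conn) set" where
  "gauge_rel X n U z = {(A, B).
     A \<in> generic_parabolic X n U z \<and> B \<in> generic_parabolic X n U z \<and>
     (\<exists>g\<in>line_gauge_group X n U. \<forall>\<sigma>\<in>sections X n U.
        fst B (gauge_act U g \<sigma>) = gauge_act U g (fst A \<sigma>) \<and>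
        snd B (gauge_act U g \<sigma>) = gauge_act U g (snd A \<sigma>))}"

definition moduli ::
    "('s, 'v::ab_group_add) vbundle \<Rightarrow> nat \<Rightarrow> 's set \<Rightarrow> ('s \<Rightarrow> complex) \<Rightarrow> ('s, 'v) conn set set" where
  "moduli X n U z = generic_parabolic X n U z // gauge_rel X n U z"


section \<open>The functions \<open>\<mu>\<^sub>1, \<dots>, \<mu>\<^sub>n\<close> and \<open>t\<^sub>2, \<dots>, t\<^sub>n\<close>\<close>

definition unit_section ::
    "('s, 'v::ab_group_add) vbundle \<Rightarrow> nat \<Rightarrow> 's set \<Rightarrow> ('s, 'v) conn \<Rightarrow> ('s \<Rightarrow> 'v) \<Rightarrow> bool" where
  "unit_section X n U A s \<longleftrightarrow>
     s \<in> line_sections X n U \<and> (\<forall>p\<in>U. vol X p (\<lambda>k. (fst A ^^ k) s p) = 1)"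

text \<open>The pair \<open>(\<mu>, t)\<close>; it does not depend on the unit section \<open>s\<close>, whence the definite description.\<close>

definition hat_functions ::
    "('s, 'v::ab_group_add) vbundle \<Rightarrow> nat \<Rightarrow> 's set \<Rightarrow> ('s, 'v) conn
      \<Rightarrow> (nat \<Rightarrow> 's \<Rightarrow> complex) \<times> (nat \<Rightarrow> 's \<Rightarrow> complex)" where
  "hat_functions X n U A = (THE (\<mu>, t).
     \<mu> \<in> {1..n} \<rightarrow>\<^sub>E smooth_funs X U \<and> t \<in> {2..n} \<rightarrow>\<^sub>E smooth_funs X U \<and>
     (\<exists>s. unit_section X n U A s \<and>
        (\<forall>p\<in>U. (fst A ^^ n) s p = (\<Sum>k=2..n. smul X (t k p) ((fst A ^^ (n - k)) s p))) \<and>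
        (\<forall>p\<in>U. snd A s p = (\<Sum>k=1..n. smul X (\<mu> k p) ((fst A ^^ (k - 1)) s p)))))"

definition hat_mu ::
    "('s, 'v::ab_group_add) vbundle \<Rightarrow> nat \<Rightarrow> 's set \<Rightarrow> ('s, 'v) conn \<Rightarrow> nat \<Rightarrow> 's \<Rightarrow> complex" where
  "hat_mu X n U A = fst (hat_functions X n U A)"

definition hat_t ::
    "('s, 'v::ab_group_add) vbundle \<Rightarrow> nat \<Rightarrow> 's set \<Rightarrow> ('s, 'v) conn \<Rightarrow> nat \<Rightarrow> 's \<Rightarrow> complex" where
  "hat_t X n U A = snd (hat_functions X n U A)"

definition hat_params ::
    "('s, 'v::ab_group_add) vbundle \<Rightarrow> nat \<Rightarrow> 's set \<Rightarrow> ('s, 'v) conn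
      \<Rightarrow> (nat \<Rightarrow> 's \<Rightarrow> complex) \<times> (nat \<Rightarrow> 's \<Rightarrow> complex)" where
  "hat_params X n U A = (restrict (hat_mu X n U A) {2..n}, restrict (hat_t X n U A) {2..n})"

end

theory Submission
  imports Defs "HOL-Combinatorics.Permutations" "HOL-Complex_Analysis.Cauchy_Integral_Formula"
    "HOL-Library.Function_Algebras"
begin

text \<open>
  The connection is recovered from its functions because parabolicity turns the vanishing of almost all
  entries of the curvature into a triangular algebraic system.

  Let \<open>s\<close> be the unit section and \<open>b\<^sub>i = \<nabla>\<^sup>i s\<close> for \<open>0 \<le> i < n\<close>. In this frame \<open>\<nabla>\<close> is the companion
  matrix of \<open>t\<close>, so \<open>t\<close> determines \<open>\<nabla>\<close>. Let \<open>a\<close> be the matrix of the other half of the connection, \<open>\<nabla>'\<close>, with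
  rows \<open>\<nabla>' b\<^sub>i\<close>. The curvature \<open>F\<close> kills \<open>s\<close> and maps the bundle to the line, say \<open>F b\<^sub>i = \<xi>\<^sub>i s\<close>. Therefore
  \<open>\<nabla>' b\<^sub>i\<^sub>+\<^sub>1 = \<nabla> \<nabla>' b\<^sub>i - \<xi>\<^sub>i s\<close>, and the whole matrix is known once \<open>\<mu>\<^sub>1\<close> and \<open>\<xi>\<^sub>1, \<dots>, \<xi>\<^bsub>n-2\<^esub>\<close> are. They are
  the unknowns of a system of equal size: the trace of \<open>a\<close> vanishes, and so do the entries of \<open>F b\<^bsub>n-1\<^esub>\<close> at
  \<open>b\<^bsub>n-2\<^esub>, \<dots>, b\<^sub>1\<close>. (The entry at \<open>b\<^bsub>n-1\<^esub>\<close> is the trace of \<open>F\<close>, which vanishes anyway.) A change of \<open>\<mu>\<^sub>1\<close> or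
  \<open>\<xi>\<^sub>j\<close> travels down the recursion like a subdiagonal, so the system is triangular with diagonal
  entries \<open>n, -1, \<dots>, -1\<close>; it has exactly one solution, a differential polynomial in the given functions
  (\<open>normalized_exists\<close>, \<open>normalized_unique\<close>). No differential equation has to be solved.

  Injectivity follows: if two connections have the same functions, the transformation taking \<open>\<nabla>\<^sup>i s\<close>
  to the corresponding frame of the other connection intertwines both halves of the connections
  (\<open>hat_coefficients_determine_connection\<close>), and it is a gauge transformation preserving the line and
  the volume form. Surjectivity follows by prescribing the two matrices in an adapted frame
  (\<open>hat_coefficients_realized\<close>).

  All of this is algebra over a ring with two commuting derivations, and it is carried out in that
  generality. Facts about determinants come from one principle, that an alternating form is determined by its
  value on a frame. It gives Cramer's rule, shows that a trace-free matrix preserves the volume form, and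
  yields the smoothness of the volume of smooth sections.

  Analysis enters in three places. The second derivatives are symmetric, so that the curvature is linear over functions.
  Changes of chart are holomorphic, so that smoothness can be checked in the given chart. A
  smooth function without zeros on a simply connected chart has a smooth \<open>n\<close>-th root, and this
  normalizes a generator of the line to a unit section.
\<close>

section \<open>Modules of functions and alternating forms\<close>

text \<open>Rings of functions on an open set, and the sections over it, are represented by total functions that
  vanish outside. They form a subset \<open>R\<close> of a ring and a subset \<open>M\<close> of an abelian group, and the identity
  of \<open>R\<close> is an indicator function \<open>u\<close>, in general different from \<open>1\<close>. The same setting, with \<open>R\<close> the complex
  numbers, covers a single fibre.\<close>

locale restricted_module =
  fixes R :: "'r::comm_ring_1 set" and M :: "'m::ab_group_add set"
    and sm :: "'r \<Rightarrow> 'm \<Rightarrow> 'm" (infixr "\<star>" 75) and u :: 'r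
  assumes R_u [simp, intro]: "u \<in> R"
    and R_add [intro]: "a \<in> R \<Longrightarrow> b \<in> R \<Longrightarrow> a + b \<in> R"
    and R_mult [intro]: "a \<in> R \<Longrightarrow> b \<in> R \<Longrightarrow> a * b \<in> R"
    and R_uminus [intro]: "a \<in> R \<Longrightarrow> - a \<in> R"
    and u_mult [simp]: "a \<in> R \<Longrightarrow> u * a = a"
    and M_0 [simp, intro]: "0 \<in> M"
    and M_add [intro]: "x \<in> M \<Longrightarrow> y \<in> M \<Longrightarrow> x + y \<in> M"
    and M_sm [intro]: "a \<in> R \<Longrightarrow> x \<in> M \<Longrightarrow> a \<star> x \<in> M"
    and sm_u [simp]: "x \<in> M \<Longrightarrow> u \<star> x = x"
    and sm_add: "a \<star> (x + y) = a \<star> x + a \<star> y"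
    and add_sm: "(a + b) \<star> x = a \<star> x + b \<star> x"
    and mult_sm: "(a * b) \<star> x = a \<star> b \<star> x"
begin

lemma mult_u [simp]: "a \<in> R \<Longrightarrow> a * u = a"
  by (metis u_mult mult.commute)

lemma R_0 [simp, intro]: "0 \<in> R"
  using R_add[OF R_u R_uminus[OF R_u]] by simp

lemma R_diff [intro]: "a \<in> R \<Longrightarrow> b \<in> R \<Longrightarrow> a - b \<in> R"
  using R_add[of a "- b"] by auto

lemma R_sum [intro]: "(\<And>i. i \<in> I \<Longrightarrow> f i \<in> R) \<Longrightarrow> sum f I \<in> R"
  by (induction I rule: infinite_finite_induct) auto

lemma R_pow: "a \<in> R \<Longrightarrow> u * a ^ k \<in> R"
proof (induction k)
  case (Suc k)
  have "u * a ^ Suc k = a * (u * a ^ k)" by (simp add: mult.left_commute)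
  then show ?case using Suc by (metis R_mult)
qed auto

lemma zero_sm [simp]: "0 \<star> x = 0"
  using add_sm[of 0 0 x] by simp

lemma sm_0 [simp]: "a \<star> 0 = 0"
  using sm_add[of a 0 0] by simp

lemma uminus_sm: "(- a) \<star> x = - (a \<star> x)"
  using add_sm[of a "- a" x] by (simp add: eq_neg_iff_add_eq_0 add.commute)

lemma sm_uminus: "a \<star> (- x) = - (a \<star> x)"
  using sm_add[of a x "- x"] by (simp add: eq_neg_iff_add_eq_0 add.commute)

lemma diff_sm: "(a - b) \<star> x = a \<star> x - b \<star> x"
  using add_sm[of a "- b" x] by (simp add: uminus_sm)

lemma sm_diff: "a \<star> (x - y) = a \<star> x - a \<star> y"
  using sm_add[of a x "- y"] by (simp add: sm_uminus)

lemma M_uminus [intro]: "x \<in> M \<Longrightarrow> - x \<in> M"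
  by (metis M_sm R_u R_uminus sm_u uminus_sm)

lemma M_diff [intro]: "x \<in> M \<Longrightarrow> y \<in> M \<Longrightarrow> x - y \<in> M"
  using M_add[of x "- y"] by auto

lemma M_sum [intro]: "(\<And>i. i \<in> I \<Longrightarrow> f i \<in> M) \<Longrightarrow> sum f I \<in> M"
  by (induction I rule: infinite_finite_induct) auto

lemma sm_sum: "a \<star> sum f I = (\<Sum>i\<in>I. a \<star> f i)"
  by (induction I rule: infinite_finite_induct) (auto simp: sm_add)

lemma sum_sm: "sum f I \<star> x = (\<Sum>i\<in>I. f i \<star> x)"
  by (induction I rule: infinite_finite_induct) (auto simp: add_sm)

definition alternating :: "nat \<Rightarrow> ((nat \<Rightarrow> 'm) \<Rightarrow> 'r) \<Rightarrow> bool" where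
  "alternating n G \<longleftrightarrow>
     (\<forall>v v'. (\<forall>i<n. v i = v' i) \<longrightarrow> G v = G v') \<and>
     (\<forall>v. (\<forall>i<n. v i \<in> M) \<longrightarrow>
       (\<forall>j<n. \<forall>x\<in>M. \<forall>y\<in>M. G (v(j := x + y)) = G (v(j := x)) + G (v(j := y))) \<and>
       (\<forall>j<n. \<forall>c\<in>R. \<forall>x\<in>M. G (v(j := c \<star> x)) = c * G (v(j := x))) \<and>
       (\<forall>i<n. \<forall>j<n. i \<noteq> j \<and> v i = v j \<longrightarrow> G v = 0))"

lemma alternatingI:
  assumes "\<And>v v'. (\<And>i. i < n \<Longrightarrow> v i = v' i) \<Longrightarrow> G v = G v'"
    and "\<And>v j x y. \<lbrakk>\<And>i. i < n \<Longrightarrow> v i \<in> M; j < n; x \<in> M; y \<in> M\<rbrakk>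
           \<Longrightarrow> G (v(j := x + y)) = G (v(j := x)) + G (v(j := y))"
    and "\<And>v j c x. \<lbrakk>\<And>i. i < n \<Longrightarrow> v i \<in> M; j < n; c \<in> R; x \<in> M\<rbrakk>
           \<Longrightarrow> G (v(j := c \<star> x)) = c * G (v(j := x))"
    and "\<And>v i j. \<lbrakk>\<And>i. i < n \<Longrightarrow> v i \<in> M; i < n; j < n; i \<noteq> j; v i = v j\<rbrakk> \<Longrightarrow> G v = 0"
  shows "alternating n G"
  unfolding alternating_def
proof (intro conjI allI impI ballI)
  fix v i j assume "\<forall>i<n. v i \<in> M" "i < n" "j < n" "i \<noteq> j \<and> v i = v j"
  then show "G v = 0" by (intro assms(4)[of v i j]) auto
next
  fix v v' :: "nat \<Rightarrow> 'm" assume "\<forall>i<n. v i = v' i"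
  then show "G v = G v'" by (intro assms(1)) simp
next
  fix v j x y assume "\<forall>i<n. v i \<in> M" "j < n" "x \<in> M" "y \<in> M"
  then show "G (v(j := x + y)) = G (v(j := x)) + G (v(j := y))" by (intro assms(2)) auto
next
  fix v j c x assume "\<forall>i<n. v i \<in> M" "j < n" "c \<in> R" "x \<in> M"
  then show "G (v(j := c \<star> x)) = c * G (v(j := x))" by (intro assms(3)) auto
qed

context
  fixes n G assumes alt: "alternating n G"
begin

lemma alt_cong: "(\<And>i. i < n \<Longrightarrow> v i = v' i) \<Longrightarrow> G v = G v'"
  using alt unfolding alternating_def by simp

lemma alt_add: "\<lbrakk>\<And>i. i < n \<Longrightarrow> v i \<in> M; j < n; x \<in> M; y \<in> M\<rbrakk>
    \<Longrightarrow> G (v(j := x + y)) = G (v(j := x)) + G (v(j := y))"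
  using alt unfolding alternating_def by simp

lemma alt_sm: "\<lbrakk>\<And>i. i < n \<Longrightarrow> v i \<in> M; j < n; c \<in> R; x \<in> M\<rbrakk>
    \<Longrightarrow> G (v(j := c \<star> x)) = c * G (v(j := x))"
  using alt unfolding alternating_def by simp

lemma alt_eq: "\<lbrakk>\<And>i. i < n \<Longrightarrow> v i \<in> M; i < n; j < n; i \<noteq> j; v i = v j\<rbrakk> \<Longrightarrow> G v = 0"
  using alt unfolding alternating_def by blast

lemma alt_0: "\<lbrakk>\<And>i. i < n \<Longrightarrow> v i \<in> M; j < n\<rbrakk> \<Longrightarrow> G (v(j := 0)) = 0"
  using alt_sm[of v j 0 0] by simp

lemma alt_sum:
  assumes "\<And>i. i < n \<Longrightarrow> v i \<in> M" "j < n" "\<And>i. i \<in> I \<Longrightarrow> c i \<in> R" "\<And>i. i \<in> I \<Longrightarrow> x i \<in> M"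
  shows "G (v(j := \<Sum>i\<in>I. c i \<star> x i)) = (\<Sum>i\<in>I. c i * G (v(j := x i)))"
  using assms(3,4)
proof (induction I rule: infinite_finite_induct)
  case (insert i I)
  have "G (v(j := c i \<star> x i + (\<Sum>i\<in>I. c i \<star> x i)))
      = G (v(j := c i \<star> x i)) + G (v(j := \<Sum>i\<in>I. c i \<star> x i))"
    using insert.prems assms(1,2) by (intro alt_add) auto
  also have "G (v(j := c i \<star> x i)) = c i * G (v(j := x i))"
    using insert.prems assms(1,2) by (intro alt_sm) auto
  also have "G (v(j := \<Sum>i\<in>I. c i \<star> x i)) = (\<Sum>i\<in>I. c i * G (v(j := x i)))"
    by (rule insert.IH) (use insert.prems in blast)+
  finally show ?case by (simp only: sum.insert[OF insert.hyps])
qed (use assms(1,2) alt_0 in auto)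

lemma alt_swap:
  assumes v: "\<And>i. i < n \<Longrightarrow> v i \<in> M" and ij: "i < n" "j < n" "i \<noteq> j" and xy: "x \<in> M" "y \<in> M"
  shows "G (v(i := x, j := y)) = - G (v(i := y, j := x))"
proof -
  have e: "G (v(i := a, j := a)) = 0" if "a \<in> M" for a
    using ij v that by (intro alt_eq[of _ i j]) auto
  have s2: "G (v(i := a, j := x + y)) = G (v(i := a, j := x)) + G (v(i := a, j := y))" if "a \<in> M" for a
    using ij v that xy by (intro alt_add) auto
  have s1: "G (v(i := x + y, j := a)) = G (v(i := x, j := a)) + G (v(i := y, j := a))" if "a \<in> M" for a
    using alt_add[of "v(j := a)" i x y] ij v that xy by (auto simp: fun_upd_twist)
  have "G (v(i := x + y, j := x + y)) = 0" using xy by (intro e) auto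
  then have "(G (v(i := x, j := x)) + G (v(i := y, j := x))) + (G (v(i := x, j := y)) + G (v(i := y, j := y))) = 0"
    using s2[of "x + y"] s1[of x] s1[of y] xy by (simp only: M_add)
  then have "G (v(i := y, j := x)) + G (v(i := x, j := y)) = 0"
    using e[of x] e[of y] xy by (simp only: add_0_left add_0_right)
  then show ?thesis by (simp only: eq_neg_iff_add_eq_0 add.commute)
qed

lemma alt_transpose:
  assumes v: "\<And>i. i < n \<Longrightarrow> v i \<in> M" and ij: "i < n" "j < n" "i \<noteq> j"
  shows "G (v \<circ> Transposition.transpose i j) = - G v"
proof -
  have "v \<circ> Transposition.transpose i j = v(i := v j, j := v i)"
    using ij by (auto simp: fun_eq_iff Transposition.transpose_def)
  moreover have "v = v(i := v i, j := v j)" by auto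
  ultimately show ?thesis using alt_swap[of v i j "v j" "v i"] v ij by metis
qed

text \<open>Expanding every argument in \<open>e\<close> leaves values at \<open>e \<circ> p\<close> for maps \<open>p\<close> of the index set; they vanish unless
  \<open>p\<close> is a permutation, and then they are \<open>\<plusminus>G e\<close>. With \<open>Z = {0}\<close> this is uniqueness of alternating forms, with
  \<open>Z\<close> the smooth functions it is smoothness of their values.\<close>

lemma alternating_in_submodule:
  assumes e: "\<And>i. i < n \<Longrightarrow> e i \<in> M"
    and span: "\<And>x. x \<in> M \<Longrightarrow> \<exists>c. (\<forall>i<n. c i \<in> R) \<and> x = (\<Sum>i<n. c i \<star> e i)"
    and Z: "0 \<in> Z" "\<And>a b. a \<in> Z \<Longrightarrow> b \<in> Z \<Longrightarrow> a + b \<in> Z" "\<And>a. a \<in> Z \<Longrightarrow> - a \<in> Z"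
      "\<And>c a. c \<in> R \<Longrightarrow> a \<in> Z \<Longrightarrow> c * a \<in> Z"
    and Ge: "G e \<in> Z" and v: "\<And>i. i < n \<Longrightarrow> v i \<in> M"
  shows "G v \<in> Z"
proof -
  have perm: "G (e \<circ> p) \<in> Z" if "p permutes {..<n}" for p
    using finite_lessThan that
  proof (induction p rule: permutes_rev_induct)
    case id
    then show ?case using Ge by simp
  next
    case (swap a b p)
    have "G (e \<circ> p \<circ> Transposition.transpose a b) = - G (e \<circ> p)" if "a \<noteq> b"
      using swap that by (intro alt_transpose) (auto intro!: e dest: permutes_in_image)
    moreover have "p \<circ> Transposition.transpose a b = p" if "a = b"
      using that by simp
    ultimately show ?case
      using swap Z(3) by (metis o_assoc)
  qed
  have main: "G v \<in> Z" if "m \<le> n" "\<forall>i<n. v i \<in> M" "\<forall>i. m \<le> i \<and> i < n \<longrightarrow> v i \<in> e ` {..<n}" for m v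
    using that
  proof (induction m arbitrary: v)
    case (0 v)
    then have "\<forall>i. \<exists>k. i < n \<longrightarrow> k < n \<and> v i = e k" by blast
    then obtain f where f: "\<And>i. i < n \<Longrightarrow> f i < n \<and> v i = e (f i)" by metis
    show "G v \<in> Z"
    proof (cases "inj_on f {..<n}")
      case True
      define p where "p = (\<lambda>i. if i < n then f i else i)"
      have "p permutes {..<n}"
      proof (rule bij_imp_permutes)
        have "inj_on p {..<n}" using True by (auto simp: inj_on_def p_def)
        moreover have "p ` {..<n} \<subseteq> {..<n}" using f by (auto simp: p_def)
        ultimately show "bij_betw p {..<n} {..<n}"
          by (simp add: bij_betw_def endo_inj_surj)
      qed (simp add: p_def)
      then have "G (e \<circ> p) \<in> Z" by (rule perm)
      moreover have "G v = G (e \<circ> p)" by (rule alt_cong) (use f in \<open>simp add: p_def\<close>)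
      ultimately show ?thesis by simp
    next
      case False
      then obtain i j where "i < n" "j < n" "i \<noteq> j" "f i = f j" by (auto simp: inj_on_def)
      then have "G v = 0" using 0 f by (intro alt_eq[of v i j]) auto
      then show ?thesis using Z by simp
    qed
  next
    case (Suc m v)
    have m: "m < n" using Suc.prems by simp
    from span[of "v m"] Suc.prems(2) m obtain c where c: "\<forall>i<n. c i \<in> R" "v m = (\<Sum>i<n. c i \<star> e i)"
      by blast
    have "G v = G (v(m := \<Sum>i<n. c i \<star> e i))" using c(2) by (metis fun_upd_triv)
    also have "\<dots> = (\<Sum>i<n. c i * G (v(m := e i)))"
      using Suc.prems(2) m c e by (intro alt_sum) auto
    also have "\<dots> \<in> Z"
    proof -
      have *: "c i * G (v(m := e i)) \<in> Z" if i: "i \<in> {..<n}" for i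
      proof -
        have "G (v(m := e i)) \<in> Z"
        proof (rule Suc.IH)
          show "m \<le> n" using m by simp
          show "\<forall>k<n. (v(m := e i)) k \<in> M" using Suc.prems(2) e i by simp
          show "\<forall>k. m \<le> k \<and> k < n \<longrightarrow> (v(m := e i)) k \<in> e ` {..<n}"
            using Suc.prems(3) i by (simp add: Suc_le_eq)
        qed
        then show ?thesis using c i Z(4) by simp
      qed
      have "sum g I \<in> Z" if "\<And>i. i \<in> I \<Longrightarrow> g i \<in> Z" for g :: "nat \<Rightarrow> 'r" and I
        using that Z(1,2) by (induction I rule: infinite_finite_induct) auto
      from this[OF *] show ?thesis .
    qed
    finally show "G v \<in> Z" .
  qed
  show ?thesis by (rule main[of n]) (use v in auto)
qed

end

lemma alternating_diff:
  assumes G: "alternating n G" and H: "alternating n H"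
  shows "alternating n (\<lambda>v. G v - H v)"
proof (rule alternatingI)
  show "G v - H v = G v' - H v'" if "\<And>i. i < n \<Longrightarrow> v i = v' i" for v v'
    using alt_cong[OF G that] alt_cong[OF H that] by simp
  show "G v - H v = 0" if "\<And>i. i < n \<Longrightarrow> v i \<in> M" "i < n" "j < n" "i \<noteq> j" "v i = v j" for v i j
    using alt_eq[OF G that] alt_eq[OF H that] by simp
qed (simp_all only: alt_add[OF G] alt_add[OF H] alt_sm[OF G] alt_sm[OF H], simp_all add: algebra_simps)

lemma alternating_mult:
  assumes G: "alternating n G"
  shows "alternating n (\<lambda>v. c * G v)"
proof (rule alternatingI)
  show "c * G v = c * G v'" if "\<And>i. i < n \<Longrightarrow> v i = v' i" for v v'
    using alt_cong[OF G that] by simp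
  show "c * G v = 0" if "\<And>i. i < n \<Longrightarrow> v i \<in> M" "i < n" "j < n" "i \<noteq> j" "v i = v j" for v i j
    using alt_eq[OF G that] by simp
qed (simp_all only: alt_add[OF G] alt_sm[OF G], simp_all add: algebra_simps)

definition derivation :: "('r \<Rightarrow> 'r) \<Rightarrow> bool" where
  "derivation d \<longleftrightarrow> (\<forall>a\<in>R. d a \<in> R) \<and> (\<forall>a\<in>R. \<forall>b\<in>R. d (a + b) = d a + d b) \<and>
     (\<forall>a\<in>R. \<forall>b\<in>R. d (a * b) = d a * b + a * d b)"

text \<open>For \<open>d = (\<lambda>_. 0)\<close> these are the \<open>R\<close>-linear endomorphisms, which lets gauge transformations,
  curvatures and connections share their lemmas.\<close>

definition leibniz :: "('r \<Rightarrow> 'r) \<Rightarrow> ('m \<Rightarrow> 'm) \<Rightarrow> bool" where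
  "leibniz d D \<longleftrightarrow> (\<forall>x\<in>M. D x \<in> M) \<and> (\<forall>x\<in>M. \<forall>y\<in>M. D (x + y) = D x + D y) \<and>
     (\<forall>a\<in>R. \<forall>x\<in>M. D (a \<star> x) = d a \<star> x + a \<star> D x)"

context
  fixes d assumes der: "derivation d"
begin

lemma der_R [intro]: "a \<in> R \<Longrightarrow> d a \<in> R"
  and der_add: "a \<in> R \<Longrightarrow> b \<in> R \<Longrightarrow> d (a + b) = d a + d b"
  and der_mult: "a \<in> R \<Longrightarrow> b \<in> R \<Longrightarrow> d (a * b) = d a * b + a * d b"
  using der unfolding derivation_def by auto

lemma der_0: "d 0 = 0"
  using der_add[of 0 0] by simp

lemma der_u: "d u = 0"
  using der_mult[of u u] der_R[of u] by simp

lemma der_uminus: "a \<in> R \<Longrightarrow> d (- a) = - d a"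
  using der_add[of a "- a"] by (simp add: R_uminus der_0 eq_neg_iff_add_eq_0 add.commute)

lemma der_diff: "a \<in> R \<Longrightarrow> b \<in> R \<Longrightarrow> d (a - b) = d a - d b"
  using der_add[of a "- b"] der_uminus[of b] by (simp add: R_uminus)

lemma der_sum: "(\<And>i. i \<in> I \<Longrightarrow> f i \<in> R) \<Longrightarrow> d (sum f I) = (\<Sum>i\<in>I. d (f i))"
proof (induction I rule: infinite_finite_induct)
  case (insert i I)
  then have "d (f i + sum f I) = d (f i) + d (sum f I)" by (intro der_add R_sum) auto
  then show ?case using insert by simp
qed (auto simp: der_0)

lemma der_pow:
  assumes "f \<in> R"
  shows "d (u * f ^ Suc k) = of_nat (Suc k) * (f ^ k * d f)"
proof (induction k)
  case 0
  then show ?case using assms der_R[of f] by simp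
next
  case (Suc k)
  have "u * f ^ Suc (Suc k) = f * (u * f ^ Suc k)" by (simp add: ac_simps)
  then have "d (u * f ^ Suc (Suc k)) = d f * (u * f ^ Suc k) + f * d (u * f ^ Suc k)"
    using assms R_pow[OF assms] by (metis der_mult)
  also have "d f * (u * f ^ Suc k) = d f * f ^ Suc k"
    using assms der_R[of f] by (metis mult.assoc mult_u)
  finally show ?case using Suc by (simp add: algebra_simps)
qed

end

context
  fixes d D assumes lei: "leibniz d D"
begin

lemma lei_M [intro]: "x \<in> M \<Longrightarrow> D x \<in> M"
  and lei_add: "x \<in> M \<Longrightarrow> y \<in> M \<Longrightarrow> D (x + y) = D x + D y"
  and lei_sm: "a \<in> R \<Longrightarrow> x \<in> M \<Longrightarrow> D (a \<star> x) = d a \<star> x + a \<star> D x"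
  using lei unfolding leibniz_def by auto

lemma lei_0: "D 0 = 0"
  using lei_add[of 0 0] by simp

lemma lei_sum: "(\<And>i. i \<in> I \<Longrightarrow> f i \<in> M) \<Longrightarrow> D (sum f I) = (\<Sum>i\<in>I. D (f i))"
proof (induction I rule: infinite_finite_induct)
  case (insert i I)
  then have "D (f i + sum f I) = D (f i) + D (sum f I)" by (intro lei_add M_sum) auto
  then show ?case using insert by simp
qed (auto simp: lei_0)

lemma lei_comb:
  assumes "\<And>i. i \<in> I \<Longrightarrow> c i \<in> R" "\<And>i. i \<in> I \<Longrightarrow> x i \<in> M"
  shows "D (\<Sum>i\<in>I. c i \<star> x i) = (\<Sum>i\<in>I. d (c i) \<star> x i + c i \<star> D (x i))"
  using assms by (subst lei_sum) (auto intro!: sum.cong simp: lei_sm)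

lemma lei_iter [intro]: "x \<in> M \<Longrightarrow> (D ^^ k) x \<in> M"
  by (induction k) auto

text \<open>The defect of preserving the volume form is itself an alternating form: the two derivative terms
  in the Leibniz rule cancel, and when two arguments agree the two surviving summands are opposite. It
  therefore suffices to test it on one frame.\<close>

lemma leibniz_alternating:
  assumes der: "derivation d" and alt: "alternating n \<omega>"
    and vol_R: "\<And>v. (\<And>i. i < n \<Longrightarrow> v i \<in> M) \<Longrightarrow> \<omega> v \<in> R"
  shows "alternating n (\<lambda>v. d (\<omega> v) - (\<Sum>j<n. \<omega> (v(j := D (v j)))))"
proof -
  define S where "S = (\<lambda>v. \<Sum>j<n. \<omega> (v(j := D (v j))))"
  have S_upd: "S (v(i := y)) = \<omega> (v(i := D y)) + (\<Sum>j\<in>{..<n}-{i}. \<omega> (v(j := D (v j), i := y)))"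
    if "i < n" for v i y
  proof -
    have "S (v(i := y)) = \<omega> (v(i := D y))
        + (\<Sum>j\<in>{..<n}-{i}. \<omega> (v(i := y, j := D ((v(i := y)) j))))"
      unfolding S_def using that by (subst sum.remove[of _ i]) auto
    also have "(\<Sum>j\<in>{..<n}-{i}. \<omega> (v(i := y, j := D ((v(i := y)) j))))
        = (\<Sum>j\<in>{..<n}-{i}. \<omega> (v(j := D (v j), i := y)))"
      by (rule sum.cong) (auto simp: fun_upd_twist)
    finally show ?thesis .
  qed
  have "alternating n (\<lambda>v. d (\<omega> v) - S v)"
  proof (rule alternatingI)
    fix v v' :: "nat \<Rightarrow> 'm" assume "\<And>i. i < n \<Longrightarrow> v i = v' i"
    then have "\<omega> v = \<omega> v'" "S v = S v'"
      unfolding S_def by (auto intro!: alt_cong[OF alt] sum.cong)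
    then show "d (\<omega> v) - S v = d (\<omega> v') - S v'" by simp
  next
    fix v i x y assume v: "\<And>i. i < n \<Longrightarrow> v i \<in> M" and i: "i < n" and xy: "x \<in> M" "y \<in> M"
    have "S (v(i := x + y)) = S (v(i := x)) + S (v(i := y))"
    proof -
      have 1: "\<omega> (v(i := D (x + y))) = \<omega> (v(i := D x)) + \<omega> (v(i := D y))"
        using xy by (simp only: lei_add) (intro alt_add[OF alt] v i lei_M)
      have 2: "\<omega> (v(j := D (v j), i := x + y)) = \<omega> (v(j := D (v j), i := x)) + \<omega> (v(j := D (v j), i := y))"
        if "j \<in> {..<n}-{i}" for j
        using that v i xy by (intro alt_add[OF alt]) auto
      show ?thesis unfolding S_upd[OF i] 1
        by (simp only: sum.cong[OF refl 2] sum.distrib) (simp add: algebra_simps)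
    qed
    moreover have "d (\<omega> (v(i := x + y))) = d (\<omega> (v(i := x))) + d (\<omega> (v(i := y)))"
      using v i xy by (subst alt_add[OF alt], simp_all, subst der_add[OF der]) (auto intro!: vol_R)
    ultimately show "d (\<omega> (v(i := x + y))) - S (v(i := x + y))
        = d (\<omega> (v(i := x))) - S (v(i := x)) + (d (\<omega> (v(i := y))) - S (v(i := y)))"
      by (simp add: algebra_simps)
  next
    fix v i c x assume v: "\<And>i. i < n \<Longrightarrow> v i \<in> M" and i: "i < n" and c: "c \<in> R" and x: "x \<in> M"
    have "S (v(i := c \<star> x)) = d c * \<omega> (v(i := x)) + c * S (v(i := x))"
    proof -
      have 1: "\<omega> (v(i := D (c \<star> x))) = d c * \<omega> (v(i := x)) + c * \<omega> (v(i := D x))"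
      proof -
        have "\<omega> (v(i := D (c \<star> x))) = \<omega> (v(i := d c \<star> x)) + \<omega> (v(i := c \<star> D x))"
          unfolding lei_sm[OF c x] by (intro alt_add[OF alt] v i M_sm der_R[OF der] c x lei_M)
        moreover have "\<omega> (v(i := d c \<star> x)) = d c * \<omega> (v(i := x))"
          by (intro alt_sm[OF alt] v i der_R[OF der] c x)
        moreover have "\<omega> (v(i := c \<star> D x)) = c * \<omega> (v(i := D x))"
          by (intro alt_sm[OF alt] v i c x lei_M)
        ultimately show ?thesis by simp
      qed
      have 2: "\<omega> (v(j := D (v j), i := c \<star> x)) = c * \<omega> (v(j := D (v j), i := x))"
        if "j \<in> {..<n}-{i}" for j
        using that v i c x by (intro alt_sm[OF alt]) auto
      show ?thesis unfolding S_upd[OF i] 1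
        by (simp only: sum.cong[OF refl 2] sum_distrib_left[symmetric]) (simp add: algebra_simps)
    qed
    moreover have "d (\<omega> (v(i := c \<star> x))) = d c * \<omega> (v(i := x)) + c * d (\<omega> (v(i := x)))"
      using v i c x by (subst alt_sm[OF alt], simp_all, subst der_mult[OF der]) (auto intro!: vol_R)
    ultimately show "d (\<omega> (v(i := c \<star> x))) - S (v(i := c \<star> x))
        = c * (d (\<omega> (v(i := x))) - S (v(i := x)))"
      by (simp add: algebra_simps)
  next
    fix v i j assume v: "\<And>i. i < n \<Longrightarrow> v i \<in> M" and ij: "i < n" "j < n" "i \<noteq> j" and eq: "v i = v j"
    have "\<omega> v = 0" using alt_eq[OF alt v ij eq] .
    moreover have "S v = 0"
    proof -
      have "S v = \<omega> (v(i := D (v i))) + (\<omega> (v(j := D (v j)))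
          + (\<Sum>k\<in>{..<n}-{i}-{j}. \<omega> (v(k := D (v k)))))"
        unfolding S_def using ij by (simp add: sum.remove[of _ i] sum.remove[of _ j])
      moreover have "(\<Sum>k\<in>{..<n}-{i}-{j}. \<omega> (v(k := D (v k)))) = 0"
      proof (rule sum.neutral, rule ballI)
        fix k assume "k \<in> {..<n}-{i}-{j}"
        then show "\<omega> (v(k := D (v k))) = 0"
          using v ij eq by (intro alt_eq[OF alt, of _ i j]) auto
      qed
      moreover have "\<omega> (v(i := D (v i))) = - \<omega> (v(j := D (v j)))"
      proof -
        have "v(i := D (v i)) = v(i := D (v i), j := v i)" "v(j := D (v j)) = v(i := v i, j := D (v i))"
          using ij eq by (auto simp: fun_eq_iff)
        then show ?thesis
          using alt_swap[OF alt, of v i j "D (v i)" "v i"] v ij by (metis lei_M)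
      qed
      ultimately show ?thesis by simp
    qed
    ultimately show "d (\<omega> v) - S v = 0" by (simp add: der_0[OF der])
  qed
  then show ?thesis unfolding S_def .
qed

end

end


section \<open>Frames, Cramer's rule and connection matrices\<close>

locale volume_module = restricted_module R M sm u
  for R :: "'r::comm_ring_1 set" and M :: "'m::ab_group_add set"
    and sm :: "'r \<Rightarrow> 'm \<Rightarrow> 'm" (infixr "\<star>" 75) and u :: 'r +
  fixes n :: nat and \<omega> :: "(nat \<Rightarrow> 'm) \<Rightarrow> 'r" and e :: "nat \<Rightarrow> 'm"
  assumes n_pos: "0 < n"
    and vol_alt: "alternating n \<omega>"
    and vol_R: "(\<And>i. i < n \<Longrightarrow> v i \<in> M) \<Longrightarrow> \<omega> v \<in> R"
    and e_M: "i < n \<Longrightarrow> e i \<in> M"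
    and vol_e: "\<omega> e = u"
    and e_span: "x \<in> M \<Longrightarrow> \<exists>c. (\<forall>i<n. c i \<in> R) \<and> x = (\<Sum>i<n. c i \<star> e i)"
begin

definition frame :: "(nat \<Rightarrow> 'm) \<Rightarrow> bool" where
  "frame b \<longleftrightarrow> (\<forall>i<n. b i \<in> M) \<and> \<omega> b = u"

definition coord :: "(nat \<Rightarrow> 'm) \<Rightarrow> nat \<Rightarrow> 'm \<Rightarrow> 'r" where
  "coord b k x = \<omega> (b(k := x))"

lemma frame_e: "frame e"
  by (simp add: frame_def e_M vol_e)

lemma frame_M: "frame b \<Longrightarrow> i < n \<Longrightarrow> b i \<in> M"
  by (simp add: frame_def)

lemma coord_R: "frame b \<Longrightarrow> k < n \<Longrightarrow> x \<in> M \<Longrightarrow> coord b k x \<in> R"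
  unfolding coord_def by (rule vol_R) (simp add: frame_M)

lemma coord_frame: "frame b \<Longrightarrow> k < n \<Longrightarrow> i < n \<Longrightarrow> coord b k (b i) = (if i = k then u else 0)"
  using alt_eq[OF vol_alt, of "b(k := b i)" i k] by (auto simp: coord_def frame_def)

lemma coord_add: "frame b \<Longrightarrow> k < n \<Longrightarrow> x \<in> M \<Longrightarrow> y \<in> M \<Longrightarrow> coord b k (x + y) = coord b k x + coord b k y"
  unfolding coord_def by (rule alt_add[OF vol_alt]) (auto simp: frame_M)

lemma coord_sm: "frame b \<Longrightarrow> k < n \<Longrightarrow> x \<in> M \<Longrightarrow> a \<in> R \<Longrightarrow> coord b k (a \<star> x) = a * coord b k x"
  unfolding coord_def by (rule alt_sm[OF vol_alt]) (auto simp: frame_M)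

lemma coord_sum:
  assumes b: "frame b" "k < n" and "\<And>i. i \<in> I \<Longrightarrow> x i \<in> M" "\<And>i. i \<in> I \<Longrightarrow> c i \<in> R"
  shows "coord b k (\<Sum>i\<in>I. c i \<star> x i) = (\<Sum>i\<in>I. c i * coord b k (x i))"
  unfolding coord_def using assms by (intro alt_sum[OF vol_alt]) (auto simp: frame_M)

lemma coord_comb:
  assumes b: "frame b" "k < n" and c: "\<And>i. i < n \<Longrightarrow> c i \<in> R"
  shows "coord b k (\<Sum>i<n. c i \<star> b i) = c k"
proof -
  have "coord b k (\<Sum>i<n. c i \<star> b i) = (\<Sum>i<n. c i * (if i = k then u else 0))"
    using b c by (subst coord_sum) (auto simp: frame_M coord_frame intro!: sum.cong)
  also have "\<dots> = (\<Sum>i<n. if i = k then c i else 0)"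
    using c by (intro sum.cong) auto
  finally show ?thesis using b by simp
qed

lemma expand_e:
  assumes "x \<in> M"
  shows "x = (\<Sum>i<n. coord e i x \<star> e i)"
proof -
  obtain c where c: "\<forall>i<n. c i \<in> R" "x = (\<Sum>i<n. c i \<star> e i)"
    using e_span[OF assms] by blast
  then have "coord e k x = c k" if "k < n" for k
    using coord_comb[OF frame_e that, of c] by simp
  then show ?thesis using c(2) by simp
qed

lemma alternating_unique:
  assumes G: "alternating n G" and H: "alternating n H" and eq: "G e = H e"
    and v: "\<And>i. i < n \<Longrightarrow> v i \<in> M"
  shows "G v = H v"
proof -
  have "G v - H v \<in> {0}"
    by (rule alternating_in_submodule[OF alternating_diff[OF G H], of e])
      (use eq v e_span e_M in auto)
  then show ?thesis by simp
qed

lemma derivation_0: "derivation (\<lambda>_. 0)"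
  by (simp add: derivation_def)

text \<open>Cramer's rule. For the \<open>k\<close>-th coordinate, the endomorphism \<open>y \<mapsto> coord e k y \<star> x\<close> is inserted into
  \<open>leibniz_alternating\<close> with zero derivation; its trace form is a multiple of \<open>\<omega>\<close>, and the factor
  is read off at \<open>e\<close>.\<close>

lemma expand:
  assumes b: "frame b" and x: "x \<in> M"
  shows "x = (\<Sum>i<n. coord b i x \<star> b i)"
proof -
  have k: "(\<Sum>j<n. coord e k (b j) * coord b j x) = coord e k x" if k: "k < n" for k
  proof -
    \<comment> \<open>The trace form of \<open>T\<close> at \<open>b\<close> is the \<open>k\<close>-th coordinate of the expansion that is to equal \<open>x\<close>.\<close>
    define T where "T = (\<lambda>y. coord e k y \<star> x)"
    have T: "leibniz (\<lambda>_. 0) T"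
      unfolding leibniz_def T_def
      using x k by (auto simp: coord_R coord_add coord_sm frame_e add_sm mult_sm)
    have vT: "\<omega> (v(j := T (v j))) = coord e k (v j) * \<omega> (v(j := x))"
      if "\<And>i. i < n \<Longrightarrow> v i \<in> M" "j < n" for v j
      unfolding T_def using that x k by (intro alt_sm[OF vol_alt]) (auto intro: coord_R frame_e)
    have "0 - (\<Sum>j<n. \<omega> (b(j := T (b j)))) = - coord e k x * \<omega> b"
    proof (rule alternating_unique[OF leibniz_alternating[OF T derivation_0 vol_alt vol_R] alternating_mult[OF vol_alt]])
      have "(\<Sum>j<n. \<omega> (e(j := T (e j)))) = (\<Sum>j<n. if j = k then coord e k x else 0)"
      proof (rule sum.cong[OF refl])
        fix j assume "j \<in> {..<n}"
        then have j: "j < n" by simp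
        have "\<omega> (e(j := T (e j))) = coord e k (e j) * coord e j x"
          unfolding coord_def[of e j] using j by (intro vT e_M)
        then show "\<omega> (e(j := T (e j))) = (if j = k then coord e k x else 0)"
          using j k x coord_R[OF frame_e k x] by (simp add: coord_frame frame_e)
      qed
      also have "\<dots> = coord e k x" using k by simp
      finally show "0 - (\<Sum>j<n. \<omega> (e(j := T (e j)))) = - coord e k x * \<omega> e"
        using coord_R[OF frame_e k x] by (simp add: vol_e)
    qed (use b in \<open>auto simp: frame_M\<close>)
    then show ?thesis
      using b coord_R[OF frame_e k x] by (simp add: vT frame_M frame_def coord_def)
  qed
  let ?y = "\<Sum>i<n. coord b i x \<star> b i"
  have "?y \<in> M" using b x by (intro M_sum M_sm coord_R) (auto simp: frame_M)
  then have "?y = (\<Sum>k<n. coord e k ?y \<star> e k)" by (rule expand_e)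
  also have "\<dots> = (\<Sum>k<n. coord e k x \<star> e k)"
  proof (rule sum.cong[OF refl])
    fix j assume "j \<in> {..<n}"
    then have "coord e j ?y = coord e j x"
      using b x by (subst coord_sum) (auto simp: frame_e frame_M coord_R k[symmetric] mult.commute intro!: sum.cong)
    then show "coord e j ?y \<star> e j = coord e j x \<star> e j" by simp
  qed
  also have "\<dots> = x" using expand_e[OF x] by simp
  finally show ?thesis by simp
qed

lemma frame_span: "frame b \<Longrightarrow> x \<in> M \<Longrightarrow> \<exists>c. (\<forall>i<n. c i \<in> R) \<and> x = (\<Sum>i<n. c i \<star> b i)"
  using expand coord_R by metis

lemma frame_volume_module: "frame b \<Longrightarrow> volume_module R M sm u n \<omega> b"
  by unfold_locales (use n_pos vol_alt vol_R frame_span in \<open>simp_all add: frame_def\<close>)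

definition covariant :: "('r \<Rightarrow> 'r) \<Rightarrow> ('m \<Rightarrow> 'm) \<Rightarrow> bool" where
  "covariant d D \<longleftrightarrow> leibniz d D \<and>
     (\<forall>v. (\<forall>i<n. v i \<in> M) \<longrightarrow> d (\<omega> v) = (\<Sum>j<n. \<omega> (v(j := D (v j)))))"

lemma covariant_trace:
  assumes "derivation d" "covariant d D" "frame b"
  shows "(\<Sum>j<n. coord b j (D (b j))) = 0"
  using assms der_u[of d] unfolding covariant_def coord_def frame_def by metis

text \<open>The connection whose matrix in the frame \<open>e\<close> has the images of the basis vectors as rows.\<close>

definition matrix_deriv :: "('r \<Rightarrow> 'r) \<Rightarrow> (nat \<Rightarrow> nat \<Rightarrow> 'r) \<Rightarrow> 'm \<Rightarrow> 'm" where
  "matrix_deriv d A x =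
     (\<Sum>i<n. d (coord e i x) \<star> e i + coord e i x \<star> (\<Sum>k<n. A i k \<star> e k))"

text \<open>Preservation of the volume form needs the vanishing of the trace only, by \<open>leibniz_alternating\<close>.\<close>

lemma
  assumes der: "derivation d" and A: "\<And>i k. i < n \<Longrightarrow> k < n \<Longrightarrow> A i k \<in> R"
  shows matrix_deriv_e: "i < n \<Longrightarrow> matrix_deriv d A (e i) = (\<Sum>k<n. A i k \<star> e k)"
    and matrix_deriv_covariant: "(\<Sum>i<n. A i i) = 0 \<Longrightarrow> covariant d (matrix_deriv d A)"
proof -
  define E where "E = (\<lambda>i. \<Sum>k<n. A i k \<star> e k)"
  have E_eq: "(\<Sum>k<n. A i k \<star> e k) = E i" for i by (simp add: E_def)
  have E: "E i \<in> M" if "i < n" for i using that A e_M unfolding E_def by (intro M_sum M_sm) auto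
  have De: "matrix_deriv d A (e i) = E i" if "i < n" for i
  proof -
    have "matrix_deriv d A (e i) = (\<Sum>j<n. if j = i then E i else 0)"
      unfolding matrix_deriv_def E_eq
      using that E by (intro sum.cong) (auto simp: coord_frame frame_e der_u[OF der] der_0[OF der])
    then show ?thesis using that by simp
  qed
  then show "i < n \<Longrightarrow> matrix_deriv d A (e i) = (\<Sum>k<n. A i k \<star> e k)" by (simp add: E_def)
  have lei: "leibniz d (matrix_deriv d A)"
    unfolding leibniz_def
  proof (intro conjI ballI)
    fix x assume "x \<in> M"
    then show "matrix_deriv d A x \<in> M"
      unfolding matrix_deriv_def E_eq using E
      by (intro M_sum M_add M_sm coord_R frame_e der_R[OF der] e_M) auto
  next
    fix x y assume "x \<in> M" "y \<in> M"
    then show "matrix_deriv d A (x + y) = matrix_deriv d A x + matrix_deriv d A y"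
      unfolding matrix_deriv_def sum.distrib[symmetric]
      by (intro sum.cong) (auto simp: coord_add frame_e der_add[OF der] coord_R add_sm)
  next
    fix a x assume a: "a \<in> R" and x: "x \<in> M"
    have "matrix_deriv d A (a \<star> x)
        = (\<Sum>i<n. d a \<star> (coord e i x \<star> e i) + a \<star> (d (coord e i x) \<star> e i + coord e i x \<star> E i))"
      unfolding matrix_deriv_def E_eq
      using a x by (intro sum.cong)
        (auto simp: coord_sm frame_e der_mult[OF der] coord_R add_sm mult_sm sm_add)
    also have "\<dots> = d a \<star> (\<Sum>i<n. coord e i x \<star> e i) + a \<star> matrix_deriv d A x"
      unfolding matrix_deriv_def E_eq by (simp add: sum.distrib sm_sum sm_add)
    finally show "matrix_deriv d A (a \<star> x) = d a \<star> x + a \<star> matrix_deriv d A x"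
      using expand_e[OF x] by simp
  qed
  assume tr: "(\<Sum>i<n. A i i) = 0"
  show "covariant d (matrix_deriv d A)"
    unfolding covariant_def
  proof (intro conjI lei allI impI)
    fix v :: "nat \<Rightarrow> 'm" assume v: "\<forall>i<n. v i \<in> M"
    let ?D = "matrix_deriv d A"
    have "\<omega> (e(j := ?D (e j))) = A j j" if "j < n" for j
      using that A coord_comb[OF frame_e that, of "A j"] by (simp add: De E_def coord_def)
    then have "(\<Sum>j<n. \<omega> (e(j := ?D (e j)))) = 0" using tr by simp
    then have eq: "d (\<omega> e) - (\<Sum>j<n. \<omega> (e(j := ?D (e j)))) = 0 * \<omega> e"
      by (simp add: vol_e der_u[OF der])
    have "d (\<omega> v) - (\<Sum>j<n. \<omega> (v(j := ?D (v j)))) = 0 * \<omega> v"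
      by (rule alternating_unique[OF leibniz_alternating[OF lei der vol_alt vol_R] alternating_mult[OF vol_alt]])
        (use v eq in simp_all)
    then show "d (\<omega> v) = (\<Sum>j<n. \<omega> (v(j := ?D (v j))))" by simp
  qed
qed

definition curvature :: "('m \<Rightarrow> 'm) \<Rightarrow> ('m \<Rightarrow> 'm) \<Rightarrow> 'm \<Rightarrow> 'm" where
  "curvature D D' x = D (D' x) - D' (D x)"

text \<open>The second-order terms in the Leibniz rule cancel because the derivations commute.\<close>

lemma curvature_linear:
  assumes der: "derivation d" "derivation d'" and lei: "leibniz d D" "leibniz d' D'"
    and comm: "\<And>a. a \<in> R \<Longrightarrow> d (d' a) = d' (d a)"
  shows "leibniz (\<lambda>_. 0) (curvature D D')"
  unfolding leibniz_def curvature_def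
  using der lei comm
  by (auto simp: lei_add[OF lei(1)] lei_add[OF lei(2)] lei_sm[OF lei(1)] lei_sm[OF lei(2)]
      lei_M[OF lei(1)] lei_M[OF lei(2)] der_R[OF der(1)] der_R[OF der(2)] M_sm M_add M_diff
      sm_diff algebra_simps)

text \<open>The matrix \<open>d a - d' A + [a, A]\<close> of the curvature, where \<open>A\<close> and \<open>a\<close> are the matrices of the two halves
  of the connection. Rows are images of basis vectors, whence the order in the commutator.\<close>

definition curvature_matrix :: "('r \<Rightarrow> 'r) \<Rightarrow> ('r \<Rightarrow> 'r) \<Rightarrow> (nat \<Rightarrow> nat \<Rightarrow> 'r) \<Rightarrow> (nat \<Rightarrow> nat \<Rightarrow> 'r) \<Rightarrow> nat \<Rightarrow> nat \<Rightarrow> 'r" where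
  "curvature_matrix d d' A a i k = d (a i k) - d' (A i k) + (\<Sum>l<n. a i l * A l k) - (\<Sum>l<n. A i l * a l k)"

lemma curvature_frame:
  assumes b: "frame b" and lei: "leibniz d D" "leibniz d' D'"
    and A: "\<And>i k. i < n \<Longrightarrow> k < n \<Longrightarrow> A i k \<in> R" and a: "\<And>i k. i < n \<Longrightarrow> k < n \<Longrightarrow> a i k \<in> R"
    and D: "\<And>i. i < n \<Longrightarrow> D (b i) = (\<Sum>k<n. A i k \<star> b k)"
    and D': "\<And>i. i < n \<Longrightarrow> D' (b i) = (\<Sum>k<n. a i k \<star> b k)"
    and i: "i < n"
  shows "curvature D D' (b i) = (\<Sum>k<n. curvature_matrix d d' A a i k \<star> b k)"
proof -
  have *: "D1 (\<Sum>k<n. X i k \<star> b k) = (\<Sum>k<n. (d1 (X i k) + (\<Sum>l<n. X i l * Y l k)) \<star> b k)"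
    if lei: "leibniz d1 D1" and X: "\<And>i k. i < n \<Longrightarrow> k < n \<Longrightarrow> X i k \<in> R"
      and D1: "\<And>i. i < n \<Longrightarrow> D1 (b i) = (\<Sum>k<n. Y i k \<star> b k)" for D1 d1 X Y
  proof -
    have "D1 (\<Sum>k<n. X i k \<star> b k) = (\<Sum>k<n. d1 (X i k) \<star> b k + X i k \<star> D1 (b k))"
      using b X i by (subst lei_comb[OF lei]) (auto simp: frame_M)
    also have "\<dots> = (\<Sum>k<n. d1 (X i k) \<star> b k) + (\<Sum>l<n. \<Sum>k<n. (X i l * Y l k) \<star> b k)"
      by (simp add: sum.distrib D1 sm_sum mult_sm)
    also have "(\<Sum>l<n. \<Sum>k<n. (X i l * Y l k) \<star> b k) = (\<Sum>k<n. (\<Sum>l<n. X i l * Y l k) \<star> b k)"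
      by (subst sum.swap) (simp add: sum_sm)
    finally show ?thesis by (simp add: sum.distrib add_sm)
  qed
  have "D (D' (b i)) = (\<Sum>k<n. (d (a i k) + (\<Sum>l<n. a i l * A l k)) \<star> b k)"
    unfolding D'[OF i] by (rule *[OF lei(1)]) (use a D in auto)
  moreover have "D' (D (b i)) = (\<Sum>k<n. (d' (A i k) + (\<Sum>l<n. A i l * a l k)) \<star> b k)"
    unfolding D[OF i] by (rule *[OF lei(2)]) (use A D' in auto)
  ultimately show ?thesis
    by (simp add: curvature_def curvature_matrix_def sum_subtractf[symmetric] diff_sm[symmetric] algebra_simps)
qed

end

section \<open>The triangular system\<close>

context restricted_module
begin

text \<open>Only differences of values of \<open>\<Phi>\<close> are controlled, so the equations may be of any form in the
  unknowns below the diagonal; there they are differential polynomials. Existence corrects one unknown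
  after the other.\<close>

lemma
  fixes N :: nat
  assumes triangular: "\<And>y y' j. \<lbrakk>j < N; \<And>i. y i \<in> R; \<And>i. y' i \<in> R; \<And>i. i < j \<Longrightarrow> y i = y' i\<rbrakk>
      \<Longrightarrow> \<Phi> y' j - \<Phi> y j = w j * (y' j - y j)"
    and h_R: "\<And>j. j < N \<Longrightarrow> h j \<in> R"
    and inverse: "\<And>j a. j < N \<Longrightarrow> a \<in> R \<Longrightarrow> w j * (h j * a) = a"
    and \<Phi>_R: "\<And>y j. (\<And>i. y i \<in> R) \<Longrightarrow> j < N \<Longrightarrow> \<Phi> y j \<in> R"
  shows triangular_solvable: "\<exists>y. (\<forall>i. y i \<in> R) \<and> (\<forall>j<N. \<Phi> y j = 0)"
    and triangular_unique: "\<lbrakk>\<And>i. y i \<in> R; \<And>i. y' i \<in> R; \<And>j. j < N \<Longrightarrow> \<Phi> y j = 0;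
      \<And>j. j < N \<Longrightarrow> \<Phi> y' j = 0; j < N\<rbrakk> \<Longrightarrow> y j = y' j"
proof -
  have "\<exists>y. (\<forall>i. y i \<in> R) \<and> (\<forall>j<m. \<Phi> y j = 0)" if "m \<le> N" for m
    using that
  proof (induction m)
    case (Suc m)
    then obtain y where y: "\<forall>i. y i \<in> R" "\<forall>j<m. \<Phi> y j = 0" by auto
    have m: "m < N" using Suc by simp
    define y' where "y' = y(m := y m - h m * \<Phi> y m)"
    have y'_R: "y' i \<in> R" for i
      using y h_R[OF m] \<Phi>_R[of y m] m unfolding y'_def by auto
    have diff: "\<Phi> y' j - \<Phi> y j = w j * (y' j - y j)" if "j \<le> m" for j
      using that m y y'_R by (intro triangular) (auto simp: y'_def)
    have "\<Phi> y' j = 0" if "j < Suc m" for j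
    proof (cases "j = m")
      case True
      then show ?thesis
        using diff[of m] inverse[OF m \<Phi>_R[of y m]] y m by (simp add: y'_def)
    next
      case False
      then show ?thesis using that diff[of j] y by (simp add: y'_def)
    qed
    then show ?case using y'_R by blast
  qed auto
  then show "\<exists>y. (\<forall>i. y i \<in> R) \<and> (\<forall>j<N. \<Phi> y j = 0)" by blast
next
  assume y: "\<And>i. y i \<in> R" and y': "\<And>i. y' i \<in> R"
    and sol: "\<And>j. j < N \<Longrightarrow> \<Phi> y j = 0" "\<And>j. j < N \<Longrightarrow> \<Phi> y' j = 0" and "j < N"
  from \<open>j < N\<close> show "y j = y' j"
  proof (induction j rule: less_induct)
    case (less j)
    have "\<Phi> y' j - \<Phi> y j = w j * (y' j - y j)"
      using less y y' by (intro triangular) auto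
    then have "w j * (y' j - y j) = 0" using sol less by simp
    then have "w j * (h j * (y' j - y j)) = 0" by (metis mult.left_commute mult_zero_right)
    then show ?case using inverse[of j "y' j - y j"] R_diff[OF y' y] less by simp
  qed
qed

end

context volume_module
begin

text \<open>The matrix of \<open>\<nabla>\<close> in the frame \<open>s, \<nabla> s, \<dots>, \<nabla>\<^bsup>n-1\<^esup> s\<close>. The last diagonal entry is zero because \<open>\<nabla>\<close> preserves
  the volume form, so that \<open>t\<close> starts at index \<open>2\<close>.\<close>

definition companion :: "(nat \<Rightarrow> 'r) \<Rightarrow> nat \<Rightarrow> nat \<Rightarrow> 'r" where
  "companion t i k = (if Suc i < n then if k = Suc i then u else 0
     else if Suc k < n then t (n - k) else 0)"

lemma companion_R: "(\<And>k. k \<in> {2..n} \<Longrightarrow> t k \<in> R) \<Longrightarrow> companion t i k \<in> R"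
  by (auto simp: companion_def)

lemma companion_trace: "(\<Sum>i<n. companion t i i) = 0"
  by (rule sum.neutral) (auto simp: companion_def)

lemma companion_row:
  assumes "Suc i < n" "\<And>l. l < n \<Longrightarrow> f l \<in> R"
  shows "(\<Sum>l<n. companion t i l * f l) = f (Suc i)"
proof -
  have "(\<Sum>l<n. companion t i l * f l) = (\<Sum>l<n. if l = Suc i then f l else 0)"
    using assms by (intro sum.cong) (auto simp: companion_def)
  then show ?thesis using assms by simp
qed

text \<open>The coordinates of \<open>\<nabla> x\<close> in a frame \<open>s, \<nabla> s, \<dots>, \<nabla>\<^bsup>n-1\<^esup> s\<close>.\<close>

definition nabla_row :: "('r \<Rightarrow> 'r) \<Rightarrow> (nat \<Rightarrow> 'r) \<Rightarrow> (nat \<Rightarrow> 'r) \<Rightarrow> nat \<Rightarrow> 'r" where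
  "nabla_row d t x k = d (x k) + (\<Sum>l<n. x l * companion t l k)"

text \<open>The matrix of \<open>\<nabla>'\<close> as a function of the unknowns: \<open>y 0\<close> is \<open>\<mu>\<^sub>1\<close> and \<open>y i\<close>, for \<open>i > 0\<close>, is the factor
  \<open>\<xi>\<^sub>i\<close> in \<open>F b\<^sub>i = \<xi>\<^sub>i s\<close>. There is no such factor in row \<open>1\<close>, since \<open>F s = 0\<close>.\<close>

primrec bar_matrix :: "('r \<Rightarrow> 'r) \<Rightarrow> (nat \<Rightarrow> 'r) \<Rightarrow> (nat \<Rightarrow> 'r) \<Rightarrow> (nat \<Rightarrow> 'r) \<Rightarrow> nat \<Rightarrow> nat \<Rightarrow> 'r" where
  "bar_matrix d t \<mu> y 0 = (\<lambda>k. if k = 0 then y 0 else \<mu> (Suc k))"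
| "bar_matrix d t \<mu> y (Suc i) = (\<lambda>k. nabla_row d t (bar_matrix d t \<mu> y i) k - (if k = 0 \<and> 0 < i then y i else 0))"

text \<open>What volume preservation and parabolicity say about the matrix of \<open>\<nabla>'\<close>. The functions \<open>\<mu>\<^sub>2, \<dots>, \<mu>\<^sub>n\<close>
  are prescribed, whereas \<open>\<mu>\<^sub>1\<close> is not.\<close>

definition normalized :: "('r \<Rightarrow> 'r) \<Rightarrow> ('r \<Rightarrow> 'r) \<Rightarrow> (nat \<Rightarrow> 'r) \<Rightarrow> (nat \<Rightarrow> 'r) \<Rightarrow> (nat \<Rightarrow> nat \<Rightarrow> 'r) \<Rightarrow> bool" where
  "normalized d d' t \<mu> a \<longleftrightarrow> (\<forall>i<n. \<forall>k<n. a i k \<in> R) \<and> (\<forall>k. 1 \<le> k \<and> k < n \<longrightarrow> a 0 k = \<mu> (Suc k)) \<and>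
     (\<Sum>i<n. a i i) = 0 \<and> curvature_matrix d d' (companion t) a 0 0 = 0 \<and>
     (\<forall>i<n. \<forall>k. 1 \<le> k \<and> k < n \<longrightarrow> curvature_matrix d d' (companion t) a i k = 0)"

context
  fixes d d' t \<mu> h
  assumes der: "derivation d" "derivation d'"
    and t_R: "\<And>k. k \<in> {2..n} \<Longrightarrow> t k \<in> R"
    and \<mu>_R: "\<And>k. k \<in> {2..n} \<Longrightarrow> \<mu> k \<in> R"
    and h: "h \<in> R" "of_nat n * h = u"
begin

lemma nabla_row_R: "(\<And>l. l < n \<Longrightarrow> x l \<in> R) \<Longrightarrow> k < n \<Longrightarrow> nabla_row d t x k \<in> R"
  unfolding nabla_row_def by (intro R_add der_R[OF der(1)] R_sum R_mult companion_R t_R) auto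

lemma nabla_row_diff:
  assumes "\<And>l. l < n \<Longrightarrow> x l \<in> R" "\<And>l. l < n \<Longrightarrow> x' l \<in> R" "k < n"
  shows "nabla_row d t (\<lambda>k. x k - x' k) k = nabla_row d t x k - nabla_row d t x' k"
  using assms by (simp add: nabla_row_def der_diff[OF der(1)] left_diff_distrib sum_subtractf)

lemma nabla_row_cong: "(\<And>l. l < n \<Longrightarrow> x l = x' l) \<Longrightarrow> k < n \<Longrightarrow> nabla_row d t x k = nabla_row d t x' k"
  by (simp add: nabla_row_def)

lemma bar_matrix_R: "(\<And>i. y i \<in> R) \<Longrightarrow> k < n \<Longrightarrow> bar_matrix d t \<mu> y i k \<in> R"
  by (induction i arbitrary: k) (auto simp: \<mu>_R nabla_row_R)

text \<open>In the rows before the last one, the curvature measures the failure of the recursion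
  \<open>\<nabla>' b\<^sub>i\<^sub>+\<^sub>1 = \<nabla> \<nabla>' b\<^sub>i\<close>.\<close>

lemma curvature_matrix_step:
  assumes "Suc i < n" "k < n" "\<And>l. l < n \<Longrightarrow> a l k \<in> R"
  shows "curvature_matrix d d' (companion t) a i k = nabla_row d t (a i) k - a (Suc i) k"
proof -
  have "d' (companion t i k) = 0"
    using assms by (simp add: companion_def der_u[OF der(2)] der_0[OF der(2)])
  then show ?thesis
    using companion_row[of i "\<lambda>l. a l k" t] assms by (simp add: curvature_matrix_def nabla_row_def)
qed

lemma curvature_matrix_R:
  assumes "i < n" "k < n" "\<And>i k. i < n \<Longrightarrow> k < n \<Longrightarrow> a i k \<in> R"
  shows "curvature_matrix d d' (companion t) a i k \<in> R"
  unfolding curvature_matrix_def using assms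
  by (intro R_add R_diff R_sum R_mult der_R[OF der(1)] der_R[OF der(2)] companion_R t_R) auto

text \<open>The commutator of two matrices has trace zero, and both derivations annihilate the vanishing traces.\<close>

lemma curvature_matrix_trace:
  assumes a: "\<And>i k. i < n \<Longrightarrow> k < n \<Longrightarrow> a i k \<in> R" and tr: "(\<Sum>i<n. a i i) = 0"
  shows "(\<Sum>i<n. curvature_matrix d d' (companion t) a i i) = 0"
proof -
  have "(\<Sum>i<n. d (a i i)) = d (\<Sum>i<n. a i i)"
    using a by (subst der_sum[OF der(1)]) auto
  moreover have "(\<Sum>i<n. d' (companion t i i)) = d' (\<Sum>i<n. companion t i i)"
    by (subst der_sum[OF der(2)]) (auto intro!: companion_R t_R)
  moreover have "(\<Sum>i<n. \<Sum>l<n. a i l * companion t l i) = (\<Sum>i<n. \<Sum>l<n. companion t i l * a l i)"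
    by (subst sum.swap) (simp add: mult.commute)
  ultimately show ?thesis
    by (simp add: curvature_matrix_def sum.distrib sum_subtractf tr companion_trace der_0[OF der(1)] der_0[OF der(2)])
qed

text \<open>A perturbation \<open>c\<close> of one entry in the first column moves one place to the right with each row, because the
  companion matrix shifts the basis. This is what makes the system triangular; entries in the first
  column may be perturbed again without affecting the leading entry.\<close>

lemma companion_propagation:
  assumes w_R: "\<And>i k. i < n \<Longrightarrow> k < n \<Longrightarrow> w i k \<in> R"
    and start: "\<And>k. k < n \<Longrightarrow> w i0 k = (if k = 0 then c else 0)"
    and step: "\<And>i k. \<lbrakk>i0 \<le> i; Suc i < n; k < n; 0 < k\<rbrakk> \<Longrightarrow> w (Suc i) k = nabla_row d t (w i) k"
    and m: "i0 + m < n"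
  shows "w (i0 + m) m = c \<and> (\<forall>k. m < k \<and> k < n \<longrightarrow> w (i0 + m) k = 0)"
  using m
proof (induction m)
  case 0
  then show ?case using start by auto
next
  case (Suc m)
  then have IH: "w (i0 + m) m = c" "\<And>k. m < k \<Longrightarrow> k < n \<Longrightarrow> w (i0 + m) k = 0" by auto
  have w: "w (i0 + Suc m) k = (if k = Suc m then c else 0)" if k: "m < k" "k < n" for k
  proof -
    have "w (i0 + m) l * companion t l k = (if l = m \<and> k = Suc m then c else 0)" if "l < n" for l
    proof (cases "l \<le> m")
      case True
      then show ?thesis using k Suc.prems IH w_R[of "i0 + m" m] by (auto simp: companion_def)
    next
      case False
      then show ?thesis using that IH(2)[of l] by auto
    qed
    then have "(\<Sum>l<n. w (i0 + m) l * companion t l k) = (\<Sum>l<n. if l = m then if k = Suc m then c else 0 else 0)"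
      by (intro sum.cong) auto
    then have "nabla_row d t (w (i0 + m)) k = (if k = Suc m then c else 0)"
      using k IH(2)[OF k] by (simp add: nabla_row_def der_0[OF der(1)])
    then show ?thesis using step[of "i0 + m" k] k Suc.prems by simp
  qed
  show ?case using w[of "Suc m"] w Suc.prems by simp
qed

text \<open>The equations left for the unknowns. Equation \<open>j > 0\<close> is paired with \<open>\<xi>\<^sub>j\<close>: its perturbation starts in
  row \<open>j + 1\<close>, and in the last row of the curvature it reaches as far as column \<open>n - 1 - j\<close>.\<close>

definition obstruction :: "(nat \<Rightarrow> 'r) \<Rightarrow> nat \<Rightarrow> 'r" where
  "obstruction y j = (if j = 0 then \<Sum>i<n. bar_matrix d t \<mu> y i i
     else curvature_matrix d d' (companion t) (bar_matrix d t \<mu> y) (n - 1) (n - 1 - j))"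

text \<open>Here \<open>w\<close> is the perturbation of the matrix. For \<open>j = 0\<close> it has \<open>n\<close> equal diagonal entries, which gives
  the factor \<open>n\<close> in the trace. For \<open>j > 0\<close> its last row has leading entry \<open>-(y' j - y j)\<close>, in column
  \<open>n - 2 - j\<close>, and \<open>\<nabla>\<close> shifts it to the column of the equation.\<close>

lemma obstruction_triangular:
  assumes j: "j < max 1 (n - 1)" and y: "\<And>i. y i \<in> R" and y': "\<And>i. y' i \<in> R"
    and eq: "\<And>i. i < j \<Longrightarrow> y i = y' i"
  shows "obstruction y' j - obstruction y j = (if j = 0 then of_nat n else - 1) * (y' j - y j)"
proof -
  define w where "w = (\<lambda>i k. bar_matrix d t \<mu> y' i k - bar_matrix d t \<mu> y i k)"
  have w_R: "w i k \<in> R" if "k < n" for i k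
    using that y y' by (auto simp: w_def intro!: R_diff bar_matrix_R)
  have w_Suc: "w (Suc i) k = nabla_row d t (w i) k - (if k = 0 \<and> 0 < i then y' i - y i else 0)" if "k < n" for i k
  proof -
    have "nabla_row d t (w i) k = nabla_row d t (bar_matrix d t \<mu> y' i) k - nabla_row d t (bar_matrix d t \<mu> y i) k"
      unfolding w_def using that y y' by (intro nabla_row_diff bar_matrix_R) auto
    then show ?thesis by (simp add: w_def)
  qed
  show ?thesis
  proof (cases "j = 0")
    case True
    have "w i i = y' 0 - y 0" if "i < n" for i
      using companion_propagation[of w 0 "y' 0 - y 0" i] that w_R by (simp add: w_Suc) (simp add: w_def)
    then have "(\<Sum>i<n. w i i) = of_nat n * (y' 0 - y 0)" by simp
    then show ?thesis using True by (simp add: obstruction_def w_def sum_subtractf)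
  next
    case False
    with j have jn: "0 < j" "Suc j < n" by auto
    have w0: "w i k = 0" if "i \<le> j" "k < n" for i k
      using that
    proof (induction i arbitrary: k)
      case 0
      then show ?case using eq[of 0] jn by (simp add: w_def)
    next
      case (Suc i)
      then have "nabla_row d t (w i) k = 0" by (simp add: nabla_row_def der_0[OF der(1)])
      then show ?case using Suc eq[of i] by (simp add: w_Suc)
    qed
    have sh: "w (Suc j + m) m = - (y' j - y j)" "\<And>k. m < k \<Longrightarrow> k < n \<Longrightarrow> w (Suc j + m) k = 0"
      if "Suc j + m < n" for m
    proof -
      have start: "w (Suc j) k = (if k = 0 then - (y' j - y j) else 0)" if "k < n" for k
      proof -
        have "nabla_row d t (w j) k = 0" using that w0 by (simp add: nabla_row_def der_0[OF der(1)])
        then show ?thesis using that jn by (simp add: w_Suc)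
      qed
      from companion_propagation[of w "Suc j" "- (y' j - y j)" m, OF w_R start _ that]
      show "w (Suc j + m) m = - (y' j - y j)" "\<And>k. m < k \<Longrightarrow> k < n \<Longrightarrow> w (Suc j + m) k = 0"
        by (auto simp: w_Suc)
    qed
    \<comment> \<open>The rightmost column that the perturbation reaches in the last row of the curvature.\<close>
    define k where "k = n - 1 - j"
    have k: "0 < k" "k < n" "Suc j + (k - 1) = n - 1" using jn by (auto simp: k_def)
    have wl: "w (n - 1) l = (if l = k - 1 then - (y' j - y j) else 0)" if "k - 1 \<le> l" "l < n" for l
      using sh[of "k - 1"] k that by (cases "l = k - 1") auto
    have "w (n - 1) l * companion t l k = (if l = k - 1 then - (y' j - y j) else 0)" if "l < n" for l
    proof (cases "k - 1 \<le> l")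
      case True
      have "companion t (k - 1) k = u" using k jn by (simp add: companion_def)
      then show ?thesis
        unfolding wl[OF True that] using R_diff[OF y y', of j j] by simp
    next
      case False
      then have "Suc l < n" "k \<noteq> Suc l" "l \<noteq> k - 1" using k by linarith+
      then show ?thesis by (simp add: companion_def)
    qed
    then have "(\<Sum>l<n. w (n - 1) l * companion t l k) = (\<Sum>l<n. if l = k - 1 then - (y' j - y j) else 0)"
      by (intro sum.cong) auto
    also have "\<dots> = - (y' j - y j)" using k less_imp_diff_less[of k n 1] by simp
    finally have 1: "(\<Sum>l<n. w (n - 1) l * companion t l k) = - (y' j - y j)" .
    have "companion t (n - 1) l * w l k = 0" if l: "l < n" for l
    proof -
      consider "l \<le> j" | "j < l" "l < n - 1" | "l = n - 1" using l by linarith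
      then show ?thesis
      proof cases
        case 2
        then have "w (Suc j + (l - Suc j)) k = 0"
          using k jn by (intro sh(2)) (auto simp: k_def)
        then show ?thesis using 2 by simp
      qed (use w0 k n_pos in \<open>auto simp: companion_def\<close>)
    qed
    then have 2: "(\<Sum>l<n. companion t (n - 1) l * w l k) = 0" by (simp add: sum.neutral)
    have 3: "w (n - 1) k = 0" using wl[of k] k by auto
    have R: "bar_matrix d t \<mu> y' i k \<in> R" "bar_matrix d t \<mu> y i k \<in> R" for i
      using y y' k by (auto intro!: bar_matrix_R)
    have "curvature_matrix d d' (companion t) (bar_matrix d t \<mu> y') (n - 1) k - curvature_matrix d d' (companion t) (bar_matrix d t \<mu> y) (n - 1) k
       = d (w (n - 1) k) + (\<Sum>l<n. w (n - 1) l * companion t l k) - (\<Sum>l<n. companion t (n - 1) l * w l k)"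
      unfolding curvature_matrix_def w_def using R
      by (simp add: der_diff[OF der(1)] left_diff_distrib right_diff_distrib sum_subtractf)
    also have "\<dots> = - (y' j - y j)" using 1 2 3 by (simp add: der_0[OF der(1)])
    finally show ?thesis using False by (simp add: obstruction_def k_def)
  qed
qed

lemma obstruction_R: "(\<And>i. y i \<in> R) \<Longrightarrow> obstruction y j \<in> R"
  unfolding obstruction_def using n_pos by (auto intro!: R_sum bar_matrix_R curvature_matrix_R)

lemmas triangular_thms =
  triangular_solvable[of "max 1 (n - 1)" obstruction "\<lambda>j. if j = 0 then of_nat n else - 1" "\<lambda>j. if j = 0 then h else - u"]
  triangular_unique[of "max 1 (n - 1)" obstruction "\<lambda>j. if j = 0 then of_nat n else - 1" "\<lambda>j. if j = 0 then h else - u"]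

lemma weights:
  "(if j = 0 then h else - u) \<in> R"
  "a \<in> R \<Longrightarrow> (if j = (0::nat) then of_nat n else - 1) * ((if j = 0 then h else - u) * a) = a"
  by (simp_all add: h R_uminus mult.assoc[symmetric])

text \<open>The entry of the curvature in the last row and last column is not among the equations; it equals
  the trace of the curvature.\<close>

lemma normalized_exists: "\<exists>a. normalized d d' t \<mu> a"
proof -
  have "\<exists>y. (\<forall>i. y i \<in> R) \<and> (\<forall>j<max 1 (n - 1). obstruction y j = 0)"
    by (rule triangular_thms(1)) (use obstruction_triangular weights obstruction_R in auto)
  then obtain y where y: "\<And>i. y i \<in> R" and ob: "\<And>j. j < max 1 (n - 1) \<Longrightarrow> obstruction y j = 0"
    by blast
  define a where "a = bar_matrix d t \<mu> y"
  have a_R: "a i k \<in> R" if "k < n" for i k using that y by (simp add: a_def bar_matrix_R)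
  have tr: "(\<Sum>i<n. a i i) = 0" using ob[of 0] by (simp add: obstruction_def a_def)
  have step: "curvature_matrix d d' (companion t) a i k = (if k = 0 \<and> 0 < i then y i else 0)"
    if "Suc i < n" "k < n" for i k
    using curvature_matrix_step[of i k a] that a_R by (simp add: a_def)
  have last: "curvature_matrix d d' (companion t) a (n - 1) k = 0" if k: "1 \<le> k" "k < n" for k
  proof (cases "k = n - 1")
    case True
    have "(\<Sum>i<n. curvature_matrix d d' (companion t) a i i) = curvature_matrix d d' (companion t) a (n - 1) (n - 1)
        + (\<Sum>i\<in>{..<n}-{n - 1}. curvature_matrix d d' (companion t) a i i)"
      using n_pos by (intro sum.remove) auto
    moreover have "curvature_matrix d d' (companion t) a i i = 0" if "i \<in> {..<n} - {n - 1}" for i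
    proof -
      from that have "Suc i < n" by auto
      then show ?thesis using step[of i i] by auto
    qed
    then have "(\<Sum>i\<in>{..<n}-{n - 1}. curvature_matrix d d' (companion t) a i i) = 0"
      by (rule sum.neutral[OF ballI])
    ultimately show ?thesis using curvature_matrix_trace[of a] a_R tr True by simp
  next
    case False
    define j where "j = n - 1 - k"
    have "j < max 1 (n - 1)" "j \<noteq> 0" "n - 1 - j = k" using False k by (auto simp: j_def)
    then show ?thesis using ob[of j] by (simp add: obstruction_def a_def)
  qed
  have "curvature_matrix d d' (companion t) a i k = 0" if "i < n" "1 \<le> k" "k < n" for i k
  proof (cases "Suc i < n")
    case True
    then show ?thesis using that step[of i k] by simp
  next
    case False
    then have "i = n - 1" using that by linarith
    then show ?thesis using that last[of k] by simp
  qed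
  moreover have "curvature_matrix d d' (companion t) a 0 0 = 0"
  proof (cases "Suc 0 < n")
    case True
    then show ?thesis using step[of 0 0] by simp
  next
    case False
    then have "n = 1" using n_pos by simp
    then show ?thesis
      using tr unfolding curvature_matrix_def companion_def by (simp add: der_0[OF der(1)] der_0[OF der(2)])
  qed
  ultimately have "normalized d d' t \<mu> a"
    unfolding normalized_def using a_R tr by (auto simp: a_def)
  then show ?thesis by blast
qed

text \<open>Conversely, every solution arises from the recursion, with unknowns read off from its curvature.\<close>

lemma normalized_bar_matrix:
  assumes "normalized d d' t \<mu> a"
  obtains y where "\<And>i. y i \<in> R" "\<And>i k. i < n \<Longrightarrow> k < n \<Longrightarrow> bar_matrix d t \<mu> y i k = a i k"
    "\<And>j. j < max 1 (n - 1) \<Longrightarrow> obstruction y j = 0"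
proof -
  from assms have a_R: "\<And>i k. i < n \<Longrightarrow> k < n \<Longrightarrow> a i k \<in> R"
    and a0: "\<And>k. 1 \<le> k \<Longrightarrow> k < n \<Longrightarrow> a 0 k = \<mu> (Suc k)" and tr: "(\<Sum>i<n. a i i) = 0"
    and c00: "curvature_matrix d d' (companion t) a 0 0 = 0"
    and c: "\<And>i k. i < n \<Longrightarrow> 1 \<le> k \<Longrightarrow> k < n \<Longrightarrow> curvature_matrix d d' (companion t) a i k = 0"
    unfolding normalized_def by auto
  \<comment> \<open>The value \<open>0\<close> from \<open>n\<close> on only serves to keep all unknowns in \<open>R\<close>.\<close>
  define y where "y = (\<lambda>j. if j = 0 then a 0 0 else if j < n then curvature_matrix d d' (companion t) a j 0 else 0)"
  have y: "y i \<in> R" for i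
    using n_pos a_R by (auto simp: y_def intro!: curvature_matrix_R)
  have eq: "bar_matrix d t \<mu> y i k = a i k" if "i < n" "k < n" for i k
    using that
  proof (induction i arbitrary: k)
    case 0
    then show ?case using a0[of k] by (auto simp: y_def)
  next
    case (Suc i)
    have "nabla_row d t (bar_matrix d t \<mu> y i) k = nabla_row d t (a i) k"
      using Suc by (intro nabla_row_cong) auto
    moreover have "a (Suc i) k = nabla_row d t (a i) k - curvature_matrix d d' (companion t) a i k"
      using curvature_matrix_step[of i k a] Suc a_R by simp
    moreover have "curvature_matrix d d' (companion t) a i k = (if k = 0 \<and> 0 < i then y i else 0)"
      using c[of i k] c00 Suc.prems by (cases "k = 0"; cases "i = 0") (simp_all add: y_def)
    ultimately show ?case by simp
  qed
  have "obstruction y j = 0" if j: "j < max 1 (n - 1)" for j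
  proof (cases "j = 0")
    case True
    then show ?thesis using tr eq by (simp add: obstruction_def)
  next
    case False
    have "obstruction y j = curvature_matrix d d' (companion t) a (n - 1) (n - 1 - j)"
      using False n_pos by (simp add: obstruction_def curvature_matrix_def eq)
    also have "\<dots> = 0" using False j by (intro c) auto
    finally show ?thesis .
  qed
  with y eq that show ?thesis by blast
qed

lemma normalized_unique:
  assumes "normalized d d' t \<mu> a" "normalized d d' t \<mu> a'" "i < n" "k < n"
  shows "a i k = a' i k"
proof -
  obtain y where y: "\<And>i. y i \<in> R" "\<And>i k. i < n \<Longrightarrow> k < n \<Longrightarrow> bar_matrix d t \<mu> y i k = a i k"
    "\<And>j. j < max 1 (n - 1) \<Longrightarrow> obstruction y j = 0"
    using normalized_bar_matrix[OF assms(1)] by blast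
  obtain y' where y': "\<And>i. y' i \<in> R" "\<And>i k. i < n \<Longrightarrow> k < n \<Longrightarrow> bar_matrix d t \<mu> y' i k = a' i k"
    "\<And>j. j < max 1 (n - 1) \<Longrightarrow> obstruction y' j = 0"
    using normalized_bar_matrix[OF assms(2)] by blast
  have yy': "y j = y' j" if "j < max 1 (n - 1)" for j
    by (rule triangular_thms(2)) (use obstruction_triangular weights obstruction_R y y' that in auto)
  have "bar_matrix d t \<mu> y i k = bar_matrix d t \<mu> y' i k" if "i < n" "k < n" for i k
    using that
  proof (induction i arbitrary: k)
    case 0
    then show ?case using yy'[of 0] by simp
  next
    case (Suc i)
    have "nabla_row d t (bar_matrix d t \<mu> y i) k = nabla_row d t (bar_matrix d t \<mu> y' i) k"
      using Suc by (intro nabla_row_cong) auto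
    then show ?case using yy'[of i] Suc by auto
  qed
  then show ?thesis using y(2) y'(2) assms by metis
qed

end

end

section \<open>Unit generators and their coefficients\<close>

context restricted_module
begin

text \<open>The \<open>R\<close>-linear combinations of \<open>B\<close>, in a form that suits induction.\<close>

inductive_set module_span :: "'m set \<Rightarrow> 'm set" for B where
  module_span_0: "0 \<in> module_span B"
| module_span_step: "a \<in> R \<Longrightarrow> b \<in> B \<Longrightarrow> x \<in> module_span B \<Longrightarrow> a \<star> b + x \<in> module_span B"

lemma module_span_M: "x \<in> module_span B \<Longrightarrow> B \<subseteq> M \<Longrightarrow> x \<in> M"
  by (induction rule: module_span.induct) (auto intro!: M_add M_sm)

lemma module_span_leibniz:
  assumes lei: "leibniz d D" and der: "derivation d" and B: "B \<subseteq> M" "B \<subseteq> B'" "D ` B \<subseteq> B'"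
    and x: "x \<in> module_span B"
  shows "D x \<in> module_span B'"
  using x
proof (induction rule: module_span.induct)
  case module_span_0
  then show ?case by (simp add: lei_0[OF lei] module_span.module_span_0)
next
  case (module_span_step a b x)
  then have b: "b \<in> M" "b \<in> B'" "D b \<in> B'" and x: "x \<in> M" using B module_span_M[of x B] by auto
  have "D (a \<star> b + x) = d a \<star> b + (a \<star> D b + D x)"
    using module_span_step b x by (simp add: lei_add[OF lei] lei_sm[OF lei] M_sm add.assoc)
  then show ?case
    using module_span_step b by (auto intro!: module_span.module_span_step der_R[OF der])
qed

lemma iter_sm_module_span:
  assumes lei: "leibniz d D" and der: "derivation d" and f: "f \<in> R" and \<sigma>: "\<sigma> \<in> M"
  shows "\<exists>x\<in>module_span ((\<lambda>l. (D ^^ l) \<sigma>) ` {..<k}). (D ^^ k) (f \<star> \<sigma>) = f \<star> (D ^^ k) \<sigma> + x"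
proof (induction k)
  case 0
  then show ?case by (auto intro: module_span_0)
next
  case (Suc k)
  let ?B = "\<lambda>k. (\<lambda>l. (D ^^ l) \<sigma>) ` {..<k}"
  from Suc obtain x where x: "x \<in> module_span (?B k)" "(D ^^ k) (f \<star> \<sigma>) = f \<star> (D ^^ k) \<sigma> + x" by blast
  have B: "?B k \<subseteq> M" "?B k \<subseteq> ?B (Suc k)"
    using \<sigma> by (auto intro!: lei_iter[OF lei])
  have BD: "D ` ?B k \<subseteq> ?B (Suc k)"
  proof (rule image_subsetI)
    fix x assume "x \<in> ?B k"
    then obtain l where "l < k" "x = (D ^^ l) \<sigma>" by auto
    then show "D x \<in> ?B (Suc k)" by (intro image_eqI[of _ _ "Suc l"]) auto
  qed
  have xM: "x \<in> M" using x B by (auto intro: module_span_M)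
  have "(D ^^ Suc k) (f \<star> \<sigma>) = f \<star> (D ^^ Suc k) \<sigma> + (d f \<star> (D ^^ k) \<sigma> + D x)"
    using f \<sigma> xM lei_iter[OF lei \<sigma>, of k]
    by (simp add: x(2) lei_add[OF lei] lei_sm[OF lei] M_sm add.assoc add.left_commute)
  moreover have "d f \<star> (D ^^ k) \<sigma> + D x \<in> module_span (?B (Suc k))"
    using module_span_leibniz[OF lei der B BD x(1)] f by (intro module_span_step der_R[OF der]) auto
  ultimately show ?case by blast
qed

lemma alt_module_span:
  assumes alt: "alternating n G" and v: "\<And>i. i < n \<Longrightarrow> v i \<in> M" and k: "k < n"
    and eq: "\<And>i. i < k \<Longrightarrow> v i = b i" and x: "x \<in> module_span (b ` {..<k})"
  shows "G (v(k := x)) = 0"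
  using x
proof (induction rule: module_span.induct)
  case module_span_0
  then show ?case by (intro alt_0[OF alt] v k)
next
  case (module_span_step a y x)
  then obtain l where l: "l < k" "y = b l" by auto
  have M: "y \<in> M" "x \<in> M"
    using l eq[of l] v[of l] k module_span_M[OF module_span_step(3)] eq v by (auto simp: image_subset_iff)
      (metis less_trans lessThan_iff)
  have "G (v(k := y)) = 0"
    using l k v eq[of l] M by (intro alt_eq[OF alt, of _ l k]) auto
  have "G (v(k := a \<star> y + x)) = G (v(k := a \<star> y)) + G (v(k := x))"
    using M module_span_step(1) by (intro alt_add[OF alt] v k) auto
  also have "G (v(k := a \<star> y)) = a * G (v(k := y))"
    using M module_span_step(1) by (intro alt_sm[OF alt] v k) auto
  finally show ?case using module_span_step.IH \<open>G (v(k := y)) = 0\<close> by simp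
qed

text \<open>The determinant of a triangular matrix with constant diagonal \<open>f\<close>. The arguments are replaced one after
  the other, starting with the first.\<close>

lemma alternating_triangular:
  assumes alt: "alternating n G" and b: "\<And>i. i < n \<Longrightarrow> b i \<in> M" and f: "f \<in> R"
    and v: "\<And>k. k < n \<Longrightarrow> \<exists>x\<in>module_span (b ` {..<k}). v k = f \<star> b k + x"
  shows "G v = f ^ n * G b"
proof -
  have vM: "v k \<in> M" if "k < n" for k
  proof -
    from v[OF that] obtain x where x: "x \<in> module_span (b ` {..<k})" "v k = f \<star> b k + x" by blast
    have "x \<in> M" using that b by (intro module_span_M[OF x(1)]) auto
    then show ?thesis using x(2) b[OF that] f by auto
  qed
  \<comment> \<open>The tuple in which the first \<open>k\<close> vectors have been replaced already.\<close>
  define w where "w = (\<lambda>k i. if i < k then b i else v i)"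
  have "G v = f ^ k * G (w k)" if "k \<le> n" for k
    using that
  proof (induction k)
    case 0
    then show ?case by (simp add: w_def)
  next
    case (Suc k)
    then have k: "k < n" by simp
    have wM: "w k i \<in> M" if "i < n" for i using that vM b by (simp add: w_def)
    from v[OF k] obtain x where x: "x \<in> module_span (b ` {..<k})" "v k = f \<star> b k + x" by blast
    have xM: "x \<in> M" using k b by (intro module_span_M[OF x(1)]) auto
    have "w k = (w k)(k := f \<star> b k + x)" using x(2) by (auto simp: w_def)
    then have "G (w k) = G ((w k)(k := f \<star> b k + x))" by (rule arg_cong)
    also have "\<dots> = G ((w k)(k := f \<star> b k)) + G ((w k)(k := x))"
      using xM b[OF k] f by (intro alt_add[OF alt] wM k) auto
    also have "G ((w k)(k := f \<star> b k)) = f * G ((w k)(k := b k))"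
      using b[OF k] f by (intro alt_sm[OF alt] wM k)
    also have "G ((w k)(k := x)) = 0"
      by (rule alt_module_span[OF alt _ k _ x(1)]) (use wM in \<open>simp_all add: w_def\<close>)
    also have "(w k)(k := b k) = w (Suc k)" by (auto simp: w_def)
    finally show ?case using Suc by (simp add: ac_simps)
  qed
  from this[of n] have "G v = f ^ n * G (w n)" by simp
  also have "G (w n) = G b" by (rule alt_cong[OF alt]) (simp add: w_def)
  finally show ?thesis .
qed

end

context volume_module
begin

lemma sum_companion:
  "(\<Sum>k=2..n. t k \<star> b (n - k)) = (\<Sum>i<n. companion t (n - 1) i \<star> b i)"
proof -
  have "(\<Sum>i<n. companion t (n - 1) i \<star> b i) = (\<Sum>i\<in>{..<n - 1}. companion t (n - 1) i \<star> b i)"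
    using n_pos by (intro sum.mono_neutral_right) (auto simp: companion_def)
  also have "\<dots> = (\<Sum>k=2..n. t k \<star> b (n - k))"
    by (rule sum.reindex_bij_witness[of _ "\<lambda>k. n - k" "\<lambda>i. n - i"]) (auto simp: companion_def)
  finally show ?thesis by simp
qed

lemma sum_shift: "(\<Sum>k=1..n. \<mu> k \<star> b (k - 1)) = (\<Sum>i<n. \<mu> (Suc i) \<star> b i)"
  by (rule sum.reindex_bij_witness[of _ "Suc" "\<lambda>k. k - 1"]) auto

text \<open>The line is spanned by \<open>e 0\<close>.\<close>

definition unit_generator :: "('m \<Rightarrow> 'm) \<Rightarrow> 'm \<Rightarrow> bool" where
  "unit_generator D s \<longleftrightarrow> (\<exists>f\<in>R. s = f \<star> e 0) \<and> frame (\<lambda>k. (D ^^ k) s)"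

text \<open>The equations that define the functions \<open>t\<close> and \<open>\<mu>\<close>.\<close>

definition hat_coefficients :: "('m \<Rightarrow> 'm) \<Rightarrow> ('m \<Rightarrow> 'm) \<Rightarrow> 'm \<Rightarrow> (nat \<Rightarrow> 'r) \<Rightarrow> (nat \<Rightarrow> 'r) \<Rightarrow> bool" where
  "hat_coefficients D D' s t \<mu> \<longleftrightarrow> (\<forall>k\<in>{2..n}. t k \<in> R) \<and> (\<forall>k\<in>{1..n}. \<mu> k \<in> R) \<and>
     (D ^^ n) s = (\<Sum>k=2..n. t k \<star> (D ^^ (n - k)) s) \<and>
     D' s = (\<Sum>k=1..n. \<mu> k \<star> (D ^^ (k - 1)) s)"

text \<open>For the curvature \<open>F\<close>, the condition on the moment map, stated without reference to a frame.\<close>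

definition parabolic_at :: "('m \<Rightarrow> 'm) \<Rightarrow> 'm \<Rightarrow> bool" where
  "parabolic_at F s \<longleftrightarrow> F s = 0 \<and> (\<forall>x\<in>M. \<exists>\<xi>\<in>R. F x = \<xi> \<star> s)"

text \<open>By the Leibniz rule \<open>\<nabla>\<^sup>k (f \<sigma>)\<close> is \<open>f \<nabla>\<^sup>k \<sigma>\<close> up to lower derivatives of \<open>\<sigma>\<close>.\<close>

lemma vol_iter_sm:
  assumes "leibniz d D" "derivation d" "f \<in> R" "\<sigma> \<in> M"
  shows "\<omega> (\<lambda>k. (D ^^ k) (f \<star> \<sigma>)) = f ^ n * \<omega> (\<lambda>k. (D ^^ k) \<sigma>)"
  using assms iter_sm_module_span[OF assms] by (intro alternating_triangular[OF vol_alt]) auto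

lemma unit_generator_M: "unit_generator D s \<Longrightarrow> s \<in> M"
  using e_M n_pos by (auto simp: unit_generator_def)

lemma unit_generator_exists:
  assumes D: "leibniz d D" "derivation d" and c: "c \<in> R" and f: "f \<in> R"
    and eq: "f ^ n * \<omega> (\<lambda>k. (D ^^ k) (c \<star> e 0)) = u"
  shows "unit_generator D (f \<star> c \<star> e 0)"
proof -
  have M: "c \<star> e 0 \<in> M" using c e_M n_pos by auto
  have "f \<star> c \<star> e 0 = (f * c) \<star> e 0" by (simp add: mult_sm)
  moreover have "frame (\<lambda>k. (D ^^ k) (f \<star> c \<star> e 0))"
    using M f eq vol_iter_sm[OF D f M] lei_iter[OF D(1)] by (simp add: frame_def M_sm)
  ultimately show ?thesis using c f unfolding unit_generator_def by blast
qed

text \<open>The factor by which \<open>s\<close> differs from \<open>e 0\<close> is invertible because it divides the volume of the frame of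
  \<open>s\<close>, which is \<open>u\<close>.\<close>

lemma line_of_unit_generator:
  assumes "unit_generator D s"
  obtains q where "q \<in> R" "e 0 = q \<star> s"
proof -
  let ?b = "\<lambda>k. (D ^^ k) s"
  obtain g where g: "g \<in> R" "s = g \<star> e 0" and b: "frame ?b" using assms by (auto simp: unit_generator_def)
  have b0: "?b = ?b(0 := g \<star> e 0)" using g by auto
  have "u = \<omega> (?b(0 := g \<star> e 0))" using b b0 by (simp add: frame_def)
  also have "\<dots> = g * \<omega> (?b(0 := e 0))"
    using g(1) n_pos e_M frame_M[OF b] by (intro alt_sm[OF vol_alt]) auto
  finally have u: "u = coord ?b 0 (e 0) * g" by (simp add: coord_def mult.commute)
  have "e 0 = u \<star> e 0" using e_M n_pos by simp
  also have "\<dots> = coord ?b 0 (e 0) \<star> s" by (simp add: u mult_sm g(2)[symmetric])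
  finally show thesis using that coord_R[OF b n_pos e_M[OF n_pos]] by blast
qed

text \<open>Two unit generators differ by a factor \<open>f\<close> with \<open>f\<^sup>n = u\<close>. Differentiating this equation gives \<open>n f\<^bsup>n-1\<^esup> d f = 0\<close>,
  so that \<open>f\<close> is a constant for every derivation and drops out of the equations for \<open>t\<close> and \<open>\<mu>\<close>.\<close>

lemma unit_generator_unique:
  assumes D: "leibniz d D" "derivation d" and h: "h \<in> R" "of_nat n * h = u"
    and s: "unit_generator D s" "unit_generator D s'"
  obtains f where "f \<in> R" "f ^ n * u = u" "s' = f \<star> s"
    "\<And>d'. derivation d' \<Longrightarrow> d' f = 0"
proof -
  obtain q where q: "q \<in> R" "e 0 = q \<star> s" using line_of_unit_generator[OF s(1)] .
  obtain g where g: "g \<in> R" "s' = g \<star> e 0" using s(2) by (auto simp: unit_generator_def)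
  define f where "f = g * q"
  have f: "f \<in> R" "s' = f \<star> s" using q g by (auto simp: f_def mult_sm)
  have pow: "f ^ n * u = u"
    using vol_iter_sm[OF D f(1) unit_generator_M[OF s(1)]] s f(2) by (simp add: unit_generator_def frame_def)
  moreover have "d' f = 0" if der: "derivation d'" for d'
  proof -
    have df: "d' f \<in> R" using der f by (simp add: der_R)
    obtain m where m: "n = Suc m" using n_pos gr0_conv_Suc by auto
    have "d' (u * f ^ Suc m) = 0" using pow m der_u[OF der] by (simp add: mult.commute)
    then have "of_nat n * (f ^ m * d' f) = 0" using der_pow[OF der f(1), of m] m by simp
    then have "(of_nat n * h) * (f * (f ^ m * d' f)) = 0"
      by (metis mult.left_commute mult.assoc mult_zero_right)
    then have "f ^ n * u * d' f = 0" unfolding h(2) by (simp add: m ac_simps)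
    then show ?thesis using pow df by simp
  qed
  ultimately show thesis using that f by blast
qed

lemma iter_const_sm:
  assumes D: "leibniz d D" and f: "f \<in> R" "d f = 0" and s: "s \<in> M"
  shows "(D ^^ k) (f \<star> s) = f \<star> (D ^^ k) s"
  using f s lei_iter[OF D s] by (induction k) (auto simp: lei_sm[OF D])

lemma hat_coefficients_unique:
  assumes s: "unit_generator D s" and o: "hat_coefficients D D' s t \<mu>" "hat_coefficients D D' s t' \<mu>'"
  shows "(\<forall>k\<in>{2..n}. t k = t' k) \<and> (\<forall>k\<in>{1..n}. \<mu> k = \<mu>' k)"
proof -
  let ?b = "\<lambda>k. (D ^^ k) s"
  have b: "frame ?b" using s by (simp add: unit_generator_def)
  note o' = o[unfolded hat_coefficients_def sum_companion[of _ ?b] sum_shift[of _ ?b]]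
  have cR: "\<And>i. i < n \<Longrightarrow> companion t (n - 1) i \<in> R" "\<And>i. i < n \<Longrightarrow> companion t' (n - 1) i \<in> R"
    using o by (auto intro!: companion_R simp: hat_coefficients_def)
  have c: "companion t (n - 1) i = companion t' (n - 1) i" if "i < n" for i
    using coord_comb[OF b that, of "companion t (n - 1)"] coord_comb[OF b that, of "companion t' (n - 1)"]
      cR o' by simp
  have mR: "\<And>i. i < n \<Longrightarrow> \<mu> (Suc i) \<in> R" "\<And>i. i < n \<Longrightarrow> \<mu>' (Suc i) \<in> R"
    using o by (auto simp: hat_coefficients_def)
  have m: "\<mu> (Suc i) = \<mu>' (Suc i)" if "i < n" for i
    using coord_comb[OF b that, of "\<lambda>i. \<mu> (Suc i)"] coord_comb[OF b that, of "\<lambda>i. \<mu>' (Suc i)"]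
      mR o' by simp
  show ?thesis
  proof (intro conjI ballI)
    fix k assume k: "k \<in> {2..n}"
    then have "n - k < n" "Suc (n - k) < n" "\<not> Suc (n - 1) < n" "n - (n - k) = k" by auto
    then show "t k = t' k" using c[of "n - k"] by (simp add: companion_def)
  next
    fix k assume "k \<in> {1..n}"
    then show "\<mu> k = \<mu>' k" using m[of "k - 1"] by auto
  qed
qed

lemma hat_coefficients_change_unit:
  assumes D: "leibniz d D" "derivation d" "leibniz d' D'" "derivation d'"
    and h: "h \<in> R" "of_nat n * h = u"
    and s: "unit_generator D s" "unit_generator D s'" and o: "hat_coefficients D D' s t \<mu>"
  shows "hat_coefficients D D' s' t \<mu>"
proof -
  obtain f where f: "f \<in> R" "s' = f \<star> s" "\<And>d'. derivation d' \<Longrightarrow> d' f = 0"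
    using unit_generator_unique[OF D(1,2) h s] by blast
  have sM: "s \<in> M" using unit_generator_M[OF s(1)] .
  have it: "(D ^^ k) s' = f \<star> (D ^^ k) s" for k
    unfolding f(2) using iter_const_sm[OF D(1) f(1) f(3)[OF D(2)] sM] .
  have "D' s' = f \<star> D' s" unfolding f(2) using f(1) f(3)[OF D(4)] sM by (simp add: lei_sm[OF D(3)])
  moreover have "f \<star> a \<star> x = a \<star> f \<star> x" for a x
    by (metis mult_sm mult.commute)
  ultimately show ?thesis
    using o unfolding hat_coefficients_def it by (simp add: sm_sum)
qed

text \<open>There is no term \<open>\<nabla>\<^bsup>n-1\<^esup> s\<close> in \<open>\<nabla>\<^sup>n s\<close>, since its coefficient is the trace of \<open>\<nabla>\<close> in a frame of constant
  volume.\<close>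

lemma hat_coefficients_exist:
  assumes D: "covariant d D" "derivation d" and D': "D' s \<in> M" and s: "unit_generator D s"
  shows "\<exists>t \<mu>. hat_coefficients D D' s t \<mu>"
proof -
  let ?b = "\<lambda>k. (D ^^ k) s"
  have b: "frame ?b" using s by (simp add: unit_generator_def)
  have lei: "leibniz d D" using D by (simp add: covariant_def)
  have nM: "(D ^^ n) s \<in> M" using lei_iter[OF lei unit_generator_M[OF s]] .
  define c where "c = (\<lambda>i. coord ?b i ((D ^^ n) s))"
  have cR: "c i \<in> R" if "i < n" for i using coord_R[OF b that nM] by (simp add: c_def)
  have "c (n - 1) = 0"
  proof -
    have "(\<Sum>j<n. coord ?b j (D (?b j))) = coord ?b (n - 1) (D (?b (n - 1)))
        + (\<Sum>j\<in>{..<n}-{n - 1}. coord ?b j (D (?b j)))"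
      using n_pos by (intro sum.remove) auto
    moreover have "coord ?b j (D (?b j)) = 0" if "j \<in> {..<n} - {n - 1}" for j
    proof -
      from that have "Suc j < n" by auto
      then show ?thesis using coord_frame[OF b, of j "Suc j"] by simp
    qed
    then have "(\<Sum>j\<in>{..<n}-{n - 1}. coord ?b j (D (?b j))) = 0" by (rule sum.neutral[OF ballI])
    moreover have "D (?b (n - 1)) = (D ^^ n) s" using n_pos by (cases n) auto
    ultimately show ?thesis using covariant_trace[OF D(2,1) b] by (simp add: c_def)
  qed
  define t where "t = (\<lambda>k. c (n - k))"
  define \<mu> where "\<mu> = (\<lambda>k. coord ?b (k - 1) (D' s))"
  have "(D ^^ n) s = (\<Sum>i<n. c i \<star> ?b i)" using expand[OF b nM] by (simp add: c_def)
  also have "\<dots> = (\<Sum>i<n. companion t (n - 1) i \<star> ?b i)"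
  proof (rule sum.cong[OF refl])
    fix i assume "i \<in> {..<n}"
    then have "Suc i < n \<or> i = n - 1" "i < n" by auto
    then have "c i = companion t (n - 1) i"
      using \<open>c (n - 1) = 0\<close> by (auto simp: companion_def t_def)
    then show "c i \<star> ?b i = companion t (n - 1) i \<star> ?b i" by simp
  qed
  finally have "(D ^^ n) s = (\<Sum>k=2..n. t k \<star> ?b (n - k))" by (simp add: sum_companion[of t ?b])
  moreover have "D' s = (\<Sum>k=1..n. \<mu> k \<star> ?b (k - 1))"
    unfolding sum_shift[of \<mu> ?b] using expand[OF b D'] by (simp add: \<mu>_def)
  moreover have "t k \<in> R" if "k \<in> {2..n}" for k using that cR by (auto simp: t_def)
  moreover have "\<mu> k \<in> R" if "k \<in> {1..n}" for k using that coord_R[OF b _ D', of "k - 1"] by (auto simp: \<mu>_def)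
  ultimately have "hat_coefficients D D' s t \<mu>" by (simp add: hat_coefficients_def)
  then show ?thesis by blast
qed

lemma hat_coefficients_companion:
  assumes s: "unit_generator D s" and o: "hat_coefficients D D' s t \<mu>" and i: "i < n"
  shows "D ((D ^^ i) s) = (\<Sum>k<n. companion t i k \<star> (D ^^ k) s)"
proof (cases "Suc i < n")
  case True
  have b: "frame (\<lambda>k. (D ^^ k) s)" using s by (simp add: unit_generator_def)
  have "(\<Sum>k<n. companion t i k \<star> (D ^^ k) s) = (\<Sum>k<n. if k = Suc i then (D ^^ Suc i) s else 0)"
    using True frame_M[OF b, of "Suc i"] by (intro sum.cong) (auto simp: companion_def)
  then show ?thesis using True by simp
next
  case False
  then have "i = n - 1" "D ((D ^^ i) s) = (D ^^ n) s" using i by (auto simp: not_less_eq less_Suc_eq)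
  then show ?thesis using o sum_companion[of t "\<lambda>k. (D ^^ k) s"] by (simp add: hat_coefficients_def)
qed

text \<open>Parabolicity may be tested in any frame whose first vector generates the line, by linearity of the
  curvature.\<close>

lemma parabolic_at_frame:
  assumes F: "leibniz (\<lambda>_. 0) F" and e': "frame e'" and c: "c \<in> R" "s = c \<star> e' 0"
    and c': "c' \<in> R" "e' 0 = c' \<star> s"
    and 0: "F (e' 0) = 0" and j: "\<And>j. j \<in> {1..<n} \<Longrightarrow> \<exists>\<xi>\<in>R. F (e' j) = \<xi> \<star> e' 0"
  shows "parabolic_at F s"
  unfolding parabolic_at_def
proof (intro conjI ballI)
  show "F s = 0"
    using c 0 frame_M[OF e' n_pos] by (simp add: lei_sm[OF F])
  fix x assume x: "x \<in> M"
  have "\<exists>\<xi>\<in>R. F (e' j) = \<xi> \<star> e' 0" if "j < n" for j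
    using j[of j] that 0 by (cases "j = 0") (auto intro: bexI[of _ 0])
  then obtain \<xi> where \<xi>: "\<And>j. j < n \<Longrightarrow> \<xi> j \<in> R \<and> F (e' j) = \<xi> j \<star> e' 0" by metis
  have "F x = F (\<Sum>j<n. coord e' j x \<star> e' j)" using expand[OF e' x] by simp
  also have "\<dots> = (\<Sum>j<n. coord e' j x \<star> F (e' j))"
    using e' x by (subst lei_comb[OF F]) (auto simp: coord_R frame_M)
  also have "\<dots> = (\<Sum>j<n. coord e' j x * \<xi> j) \<star> e' 0"
    by (simp add: \<xi> sum_sm mult_sm)
  also have "\<dots> = ((\<Sum>j<n. coord e' j x * \<xi> j) * c') \<star> s" using c'(2) by (simp add: mult_sm)
  finally show "\<exists>\<xi>\<in>R. F x = \<xi> \<star> s"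
    using c'(1) \<xi> x e' by (intro bexI[where x = "(\<Sum>j<n. coord e' j x * \<xi> j) * c'"])
      (auto intro!: R_mult R_sum coord_R)
qed

lemma hat_coefficients_normalized:
  assumes D: "covariant d D" "derivation d" "covariant d' D'" "derivation d'"
    and s: "unit_generator D s" and o: "hat_coefficients D D' s t \<mu>" and par: "parabolic_at (curvature D D') s"
  shows "normalized d d' t \<mu> (\<lambda>i k. coord (\<lambda>k. (D ^^ k) s) k (D' ((D ^^ i) s)))"
proof -
  let ?b = "\<lambda>k. (D ^^ k) s"
  define a where "a = (\<lambda>i k. coord ?b k (D' (?b i)))"
  have lei: "leibniz d D" "leibniz d' D'" using D by (auto simp: covariant_def)
  have b: "frame ?b" using s by (simp add: unit_generator_def)
  have D'M: "D' (?b i) \<in> M" if "i < n" for i using that by (intro lei_M[OF lei(2)] frame_M[OF b])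
  have a_R: "a i k \<in> R" if "i < n" "k < n" for i k
    unfolding a_def using that by (intro coord_R[OF b] D'M)
  have A_R: "companion t i k \<in> R" for i k using o by (intro companion_R) (simp add: hat_coefficients_def)
  have curvature_matrix_R: "curvature_matrix d d' (companion t) a i k \<in> R" if "i < n" "k < n" for i k
    unfolding curvature_matrix_def using a_R A_R that
    by (intro R_add R_diff R_sum R_mult der_R[OF D(2)] der_R[OF D(4)]) auto
  have F: "curvature D D' (?b i) = (\<Sum>k<n. curvature_matrix d d' (companion t) a i k \<star> ?b k)" if "i < n" for i
    using that a_R A_R hat_coefficients_companion[OF s o] expand[OF b D'M]
    by (intro curvature_frame[OF b lei]) (auto simp: a_def)
  have curvature_matrix: "curvature_matrix d d' (companion t) a i k = coord ?b k (curvature D D' (?b i))" if "i < n" "k < n" for i k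
    unfolding F[OF that(1)] using that curvature_matrix_R by (subst coord_comb[OF b]) auto
  have c0: "coord ?b k 0 = 0" if "k < n" for k
    using coord_sm[OF b that M_0, of 0] by simp
  show ?thesis
    unfolding normalized_def a_def[symmetric]
  proof (intro conjI allI impI)
    show "a i k \<in> R" if "i < n" "k < n" for i k using that by (rule a_R)
    show "(\<Sum>i<n. a i i) = 0" unfolding a_def by (rule covariant_trace[OF D(4,3) b])
    show "a 0 k = \<mu> (Suc k)" if "1 \<le> k \<and> k < n" for k
    proof -
      have "D' s = (\<Sum>i<n. \<mu> (Suc i) \<star> ?b i)" and "\<And>i. i < n \<Longrightarrow> \<mu> (Suc i) \<in> R"
        using o unfolding hat_coefficients_def sum_shift[of \<mu> ?b] by auto
      then show ?thesis using that coord_comb[OF b, of k "\<lambda>i. \<mu> (Suc i)"] by (simp add: a_def)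
    qed
    show "curvature_matrix d d' (companion t) a 0 0 = 0"
      using par n_pos c0 by (simp add: curvature_matrix parabolic_at_def)
    show "curvature_matrix d d' (companion t) a i k = 0" if i: "i < n" and k: "1 \<le> k \<and> k < n" for i k
    proof -
      obtain \<xi> where "\<xi> \<in> R" "curvature D D' (?b i) = \<xi> \<star> ?b 0"
        using par frame_M[OF b i] by (auto simp: parabolic_at_def)
      then show ?thesis
        using i k n_pos frame_M[OF b n_pos] coord_frame[OF b, of k 0] by (simp add: curvature_matrix coord_sm[OF b])
    qed
  qed
qed

text \<open>The endomorphism that takes the frame \<open>b\<close> to the frame \<open>c\<close>.\<close>

definition transport :: "(nat \<Rightarrow> 'm) \<Rightarrow> (nat \<Rightarrow> 'm) \<Rightarrow> 'm \<Rightarrow> 'm" where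
  "transport b c x = (\<Sum>k<n. coord b k x \<star> c k)"

context
  fixes b c assumes b: "frame b" and c: "frame c"
begin

lemma transport_M: "x \<in> M \<Longrightarrow> transport b c x \<in> M"
  unfolding transport_def by (intro M_sum M_sm coord_R[OF b] frame_M[OF c]) auto

lemma transport_add: "x \<in> M \<Longrightarrow> y \<in> M \<Longrightarrow> transport b c (x + y) = transport b c x + transport b c y"
  using b by (simp add: transport_def coord_add add_sm sum.distrib)

lemma transport_sm: "a \<in> R \<Longrightarrow> x \<in> M \<Longrightarrow> transport b c (a \<star> x) = a \<star> transport b c x"
  using b by (simp add: transport_def coord_sm mult_sm sm_sum)

lemma transport_frame: "i < n \<Longrightarrow> transport b c (b i) = c i"
proof -
  assume i: "i < n"
  have "transport b c (b i) = (\<Sum>k<n. if k = i then c k else 0)"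
    unfolding transport_def using i b c by (intro sum.cong) (auto simp: coord_frame frame_M)
  then show ?thesis using i by simp
qed

lemma transport_inverse: "x \<in> M \<Longrightarrow> transport c b (transport b c x) = x"
proof -
  assume x: "x \<in> M"
  have "coord c k (transport b c x) = coord b k x" if "k < n" for k
    unfolding transport_def using that b c x by (intro coord_comb coord_R)
  then show ?thesis using expand[OF b x] by (simp add: transport_def[of c b])
qed

lemma transport_vol:
  assumes v: "\<And>i. i < n \<Longrightarrow> v i \<in> M"
  shows "\<omega> (\<lambda>i. transport b c (v i)) = \<omega> v"
proof -
  interpret B: volume_module R M sm u n \<omega> b using frame_volume_module[OF b] .
  let ?G = "\<lambda>v. \<omega> (\<lambda>i. transport b c (v i))"
  have upd: "(\<lambda>i. transport b c ((v(j := x)) i)) = (\<lambda>i. transport b c (v i))(j := transport b c x)" for v j x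
    by auto
  have alt: "alternating n ?G"
  proof (rule alternatingI)
    show "?G v = ?G v'" if "\<And>i. i < n \<Longrightarrow> v i = v' i" for v v'
      using that by (intro alt_cong[OF vol_alt]) simp
    show "?G (v(j := x + y)) = ?G (v(j := x)) + ?G (v(j := y))"
      if "\<And>i. i < n \<Longrightarrow> v i \<in> M" "j < n" "x \<in> M" "y \<in> M" for v j x y
      unfolding upd transport_add[OF that(3,4)]
      using that by (intro alt_add[OF vol_alt] transport_M)
    show "?G (v(j := a \<star> x)) = a * ?G (v(j := x))"
      if "\<And>i. i < n \<Longrightarrow> v i \<in> M" "j < n" "a \<in> R" "x \<in> M" for v j a x
      unfolding upd transport_sm[OF that(3,4)]
      using that by (intro alt_sm[OF vol_alt] transport_M)
    show "?G v = 0" if "\<And>i. i < n \<Longrightarrow> v i \<in> M" "i < n" "j < n" "i \<noteq> j" "v i = v j" for v i j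
      using that by (intro alt_eq[OF vol_alt, of _ i j] transport_M) auto
  qed
  have eq: "?G b = \<omega> b"
  proof -
    have "?G b = \<omega> c" by (rule alt_cong[OF vol_alt]) (simp add: transport_frame)
    then show ?thesis using b c by (simp add: frame_def)
  qed
  show ?thesis by (rule B.alternating_unique[OF alt vol_alt eq]) (rule v)
qed

lemma transport_leibniz:
  assumes D: "leibniz d D" and E: "leibniz d E" and der: "derivation d"
    and A: "\<And>i k. i < n \<Longrightarrow> k < n \<Longrightarrow> A i k \<in> R"
    and Db: "\<And>i. i < n \<Longrightarrow> D (b i) = (\<Sum>k<n. A i k \<star> b k)"
    and Ec: "\<And>i. i < n \<Longrightarrow> E (c i) = (\<Sum>k<n. A i k \<star> c k)"
    and x: "x \<in> M"
  shows "E (transport b c x) = transport b c (D x)"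
proof -
  have T: "leibniz (\<lambda>_. 0) (transport b c)"
    by (simp add: leibniz_def transport_M transport_add transport_sm)
  have TD: "transport b c (D (b i)) = E (c i)" if "i < n" for i
    unfolding Db[OF that] Ec[OF that]
    using that A b by (subst lei_comb[OF T]) (auto simp: frame_M transport_frame)
  have cR: "coord b i x \<in> R" if "i < n" for i using that b x by (intro coord_R)
  have "E (transport b c x) = (\<Sum>i<n. d (coord b i x) \<star> c i + coord b i x \<star> E (c i))"
    unfolding transport_def using c cR by (subst lei_comb[OF E]) (auto simp: frame_M)
  also have "\<dots> = (\<Sum>i<n. transport b c (d (coord b i x) \<star> b i + coord b i x \<star> D (b i)))"
  proof (rule sum.cong[OF refl])
    fix i assume "i \<in> {..<n}"
    then have i: "i < n" by simp
    show "d (coord b i x) \<star> c i + coord b i x \<star> E (c i)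
        = transport b c (d (coord b i x) \<star> b i + coord b i x \<star> D (b i))"
      using i b cR der_R[OF der cR[OF i]] frame_M[OF b i] lei_M[OF D]
      by (simp add: transport_add transport_sm M_sm TD transport_frame)
  qed
  also have "\<dots> = transport b c (\<Sum>i<n. d (coord b i x) \<star> b i + coord b i x \<star> D (b i))"
    using b cR by (intro lei_sum[OF T, symmetric] M_add M_sm der_R[OF der] lei_M[OF D] frame_M) auto
  also have "(\<Sum>i<n. d (coord b i x) \<star> b i + coord b i x \<star> D (b i)) = D (\<Sum>i<n. coord b i x \<star> b i)"
    using b cR by (subst lei_comb[OF D]) (auto simp: frame_M)
  finally show ?thesis using expand[OF b x] by simp
qed

end

text \<open>Equal functions give equal companion matrices, and by \<open>normalized_unique\<close> equal matrices of the second
  half as well.\<close>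

theorem hat_coefficients_determine_connection:
  assumes der: "derivation d" "derivation d'" and h: "h \<in> R" "of_nat n * h = u"
    and D: "covariant d D" "covariant d' D'" "unit_generator D s" "hat_coefficients D D' s t \<mu>"
      "parabolic_at (curvature D D') s"
    and E: "covariant d E" "covariant d' E'" "unit_generator E r" "hat_coefficients E E' r t' \<mu>'"
      "parabolic_at (curvature E E') r"
    and t: "\<And>k. k \<in> {2..n} \<Longrightarrow> t k = t' k" and \<mu>: "\<And>k. k \<in> {2..n} \<Longrightarrow> \<mu> k = \<mu>' k"
    and x: "x \<in> M"
  defines "g \<equiv> transport (\<lambda>k. (D ^^ k) s) (\<lambda>k. (E ^^ k) r)"
  shows "E (g x) = g (D x)" and "E' (g x) = g (D' x)"
proof -
  let ?b = "\<lambda>k. (D ^^ k) s" and ?c = "\<lambda>k. (E ^^ k) r"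
  have b: "frame ?b" and c: "frame ?c" using D E by (auto simp: unit_generator_def)
  have lei: "leibniz d D" "leibniz d E" "leibniz d' D'" "leibniz d' E'"
    using D E by (auto simp: covariant_def)
  have R: "\<And>k. k \<in> {2..n} \<Longrightarrow> t k \<in> R" "\<And>k. k \<in> {2..n} \<Longrightarrow> \<mu> k \<in> R"
    using D(4) by (auto simp: hat_coefficients_def)
  have comp: "companion t' i k = companion t i k" if "k < n" for i k
    using that t by (auto simp: companion_def)
  show "E (g x) = g (D x)"
    unfolding g_def
  proof (rule transport_leibniz[OF b c lei(1,2) der(1), where A = "companion t"])
    show "companion t i k \<in> R" for i k using R(1) by (rule companion_R)
    show "E (?c i) = (\<Sum>k<n. companion t i k \<star> ?c k)" if "i < n" for i
      using hat_coefficients_companion[OF E(3,4) that] comp by simp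
  qed (rule hat_coefficients_companion[OF D(3,4)], assumption, rule x)
  let ?a = "\<lambda>i k. coord ?b k (D' (?b i))" and ?a' = "\<lambda>i k. coord ?c k (E' (?c i))"
  have M: "D' (?b i) \<in> M" "E' (?c i) \<in> M" if "i < n" for i
    using that by (auto intro!: lei_M[OF lei(3)] lei_M[OF lei(4)] frame_M[OF b] frame_M[OF c])
  have na: "normalized d d' t \<mu> ?a"
    using hat_coefficients_normalized[OF D(1) der(1) D(2) der(2) D(3-5)] .
  have na': "normalized d d' t \<mu> ?a'"
  proof -
    have curvature_matrix: "curvature_matrix d d' (companion t') ?a' i k = curvature_matrix d d' (companion t) ?a' i k" if "k < n" for i k
      using that unfolding curvature_matrix_def by (simp add: comp)
    show ?thesis
      using hat_coefficients_normalized[OF E(1) der(1) E(2) der(2) E(3-5)] \<mu> n_pos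
      by (auto simp: normalized_def curvature_matrix)
  qed
  have a: "?a i k = ?a' i k" if "i < n" "k < n" for i k
    by (rule normalized_unique[OF der _ _ h na na' that]) (fact R)+
  show "E' (g x) = g (D' x)"
    unfolding g_def
  proof (rule transport_leibniz[OF b c lei(3,4) der(2), where A = ?a])
    show "?a i k \<in> R" if "i < n" "k < n" for i k using that by (intro coord_R[OF b] M)
    show "D' (?b i) = (\<Sum>k<n. ?a i k \<star> ?b k)" if "i < n" for i using expand[OF b M(1)[OF that]] .
    show "E' (?c i) = (\<Sum>k<n. ?a i k \<star> ?c k)" if "i < n" for i
      using expand[OF c M(2)[OF that]] a that by simp
  qed (rule x)
qed

text \<open>The matrices are prescribed in the frame \<open>e\<close>, so \<open>e 0\<close> becomes the unit generator.\<close>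

theorem hat_coefficients_realized:
  assumes der: "derivation d" "derivation d'" and h: "h \<in> R" "of_nat n * h = u"
    and comm: "\<And>a. a \<in> R \<Longrightarrow> d (d' a) = d' (d a)"
    and t: "\<And>k. k \<in> {2..n} \<Longrightarrow> t k \<in> R" and \<mu>: "\<And>k. k \<in> {2..n} \<Longrightarrow> \<mu> k \<in> R"
  shows "\<exists>D D' \<mu>'. covariant d D \<and> covariant d' D' \<and> unit_generator D (e 0) \<and> hat_coefficients D D' (e 0) t \<mu>' \<and>
    (\<forall>k\<in>{2..n}. \<mu>' k = \<mu> k) \<and> parabolic_at (curvature D D') (e 0)"
proof -
  obtain a where a: "normalized d d' t \<mu> a"
    using normalized_exists[OF der _ _ h, of t \<mu>] t \<mu> by blast
  then have a_R: "\<And>i k. i < n \<Longrightarrow> k < n \<Longrightarrow> a i k \<in> R" and tr: "(\<Sum>i<n. a i i) = 0"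
    by (auto simp: normalized_def)
  have A_R: "\<And>i k. companion t i k \<in> R" using t by (rule companion_R)
  define D where "D = matrix_deriv d (companion t)"
  define D' where "D' = matrix_deriv d' a"
  have De: "D (e i) = (\<Sum>k<n. companion t i k \<star> e k)" if "i < n" for i
    unfolding D_def using der A_R that by (intro matrix_deriv_e)
  have D'e: "D' (e i) = (\<Sum>k<n. a i k \<star> e k)" if "i < n" for i
    unfolding D'_def using der a_R that by (intro matrix_deriv_e)
  have cov: "covariant d D" "covariant d' D'"
    unfolding D_def D'_def using der a_R A_R tr companion_trace by (auto intro!: matrix_deriv_covariant)
  then have lei: "leibniz d D" "leibniz d' D'" by (auto simp: covariant_def)
  have Dk: "(D ^^ k) (e 0) = e k" if "k < n" for k
    using that
  proof (induction k)
    case (Suc k)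
    have "D (e k) = (\<Sum>l<n. companion t k l \<star> e l)" using Suc.prems by (intro De) simp
    also have "\<dots> = (\<Sum>l<n. if l = Suc k then e (Suc k) else 0)"
      using Suc.prems e_M by (intro sum.cong) (auto simp: companion_def)
    finally have "D (e k) = e (Suc k)" using Suc.prems by simp
    then show ?case using Suc by simp
  qed simp
  have "frame (\<lambda>k. (D ^^ k) (e 0))"
    using frame_e alt_cong[OF vol_alt, of "\<lambda>k. (D ^^ k) (e 0)" e] by (simp add: frame_def Dk)
  moreover have "e 0 = u \<star> e 0" using e_M n_pos by simp
  ultimately have unit: "unit_generator D (e 0)" using R_u unfolding unit_generator_def by blast
  define \<mu>' where "\<mu>' = (\<lambda>k. a 0 (k - 1))"
  have "(D ^^ n) (e 0) = (\<Sum>k=2..n. t k \<star> (D ^^ (n - k)) (e 0))"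
  proof -
    have "(D ^^ n) (e 0) = D (e (n - 1))" using n_pos Dk[of "n - 1"] by (cases n) auto
    also have "\<dots> = (\<Sum>k=2..n. t k \<star> e (n - k))" unfolding sum_companion[of t e] using n_pos by (intro De) auto
    also have "\<dots> = (\<Sum>k=2..n. t k \<star> (D ^^ (n - k)) (e 0))" by (intro sum.cong) (auto simp: Dk)
    finally show ?thesis .
  qed
  moreover have "D' (e 0) = (\<Sum>k=1..n. \<mu>' k \<star> (D ^^ (k - 1)) (e 0))"
  proof -
    have "D' (e 0) = (\<Sum>k=1..n. \<mu>' k \<star> e (k - 1))"
      unfolding sum_shift[of \<mu>' e] using D'e[OF n_pos] by (simp add: \<mu>'_def)
    also have "\<dots> = (\<Sum>k=1..n. \<mu>' k \<star> (D ^^ (k - 1)) (e 0))" by (intro sum.cong) (auto simp: Dk)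
    finally show ?thesis .
  qed
  moreover have "\<mu>' k \<in> R" if "k \<in> {1..n}" for k using that n_pos by (auto simp: \<mu>'_def intro!: a_R)
  ultimately have "hat_coefficients D D' (e 0) t \<mu>'" using t by (simp add: hat_coefficients_def)
  moreover have "\<mu>' k = \<mu> k" if "k \<in> {2..n}" for k
  proof -
    have "1 \<le> k - 1 \<and> k - 1 < n" "Suc (k - 1) = k" using that by auto
    then show ?thesis using a unfolding normalized_def \<mu>'_def by metis
  qed
  moreover have "parabolic_at (curvature D D') (e 0)"
  proof -
    have F: "curvature D D' (e i) = curvature_matrix d d' (companion t) a i 0 \<star> e 0" if "i < n" for i
    proof -
      have "curvature D D' (e i) = (\<Sum>k<n. curvature_matrix d d' (companion t) a i k \<star> e k)"
        using that a_R A_R De D'e by (intro curvature_frame[OF frame_e lei]) auto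
      also have "\<dots> = (\<Sum>k<n. if k = 0 then curvature_matrix d d' (companion t) a i 0 \<star> e 0 else 0)"
        using that a by (intro sum.cong) (auto simp: normalized_def)
      finally show ?thesis using n_pos by simp
    qed
    have curvature_matrix_R: "curvature_matrix d d' (companion t) a i 0 \<in> R" if "i < n" for i
      unfolding curvature_matrix_def using a_R A_R that n_pos
      by (intro R_add R_diff R_sum R_mult der_R[OF der(1)] der_R[OF der(2)]) auto
    have "e 0 = u \<star> e 0" using e_M n_pos by simp
    moreover have "curvature D D' (e 0) = 0" using F[OF n_pos] a by (simp add: normalized_def)
    ultimately show ?thesis
      using F curvature_matrix_R by (intro parabolic_at_frame[OF curvature_linear[OF der lei comm] frame_e R_u _ R_u]) auto
  qed
  ultimately show ?thesis using cov unit by blast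
qed

text \<open>Gauge equivalent connections have the same functions: the transformation carries a unit generator
  and its equations along.\<close>

lemma hat_coefficients_gauge:
  assumes D: "leibniz d D" "leibniz d' D'"
    and g: "leibniz (\<lambda>_. 0) g" and g_vol: "\<And>v. (\<And>i. i < n \<Longrightarrow> v i \<in> M) \<Longrightarrow> \<omega> (\<lambda>i. g (v i)) = \<omega> v"
    and line: "q \<in> R" "g (e 0) = q \<star> e 0"
    and E: "\<And>x. x \<in> M \<Longrightarrow> E (g x) = g (D x)" and E': "\<And>x. x \<in> M \<Longrightarrow> E' (g x) = g (D' x)"
    and s: "unit_generator D s" and o: "hat_coefficients D D' s t \<mu>"
  shows "unit_generator E (g s) \<and> hat_coefficients E E' (g s) t \<mu>"
proof -
  have sM: "s \<in> M" using unit_generator_M[OF s] .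
  have DM: "(D ^^ k) s \<in> M" for k using lei_iter[OF D(1) sM] .
  have iter: "(E ^^ k) (g s) = g ((D ^^ k) s)" for k
    by (induction k) (simp_all add: E DM)
  obtain f where f: "f \<in> R" "s = f \<star> e 0" using s by (auto simp: unit_generator_def)
  have "g s = (f * q) \<star> e 0"
    using f line e_M[OF n_pos] by (simp add: lei_sm[OF g] mult_sm)
  moreover have "frame (\<lambda>k. (E ^^ k) (g s))"
    using s DM g_vol[of "\<lambda>k. (D ^^ k) s"] lei_M[OF g] by (simp add: unit_generator_def frame_def iter)
  ultimately have "unit_generator E (g s)" using f line unfolding unit_generator_def by blast
  moreover have comb: "g (\<Sum>k\<in>I. c k \<star> (D ^^ m k) s) = (\<Sum>k\<in>I. c k \<star> (E ^^ m k) (g s))"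
    if "\<And>k. k \<in> I \<Longrightarrow> c k \<in> R" for I :: "nat set" and c m
    using that DM by (subst lei_comb[OF g]) (auto simp: iter)
  have "hat_coefficients E E' (g s) t \<mu>"
    using o comb[of "{2..n}" t "\<lambda>k. n - k"] comb[of "{1..n}" \<mu> "\<lambda>k. k - 1"]
    unfolding hat_coefficients_def iter[of n] E'[OF sM] by simp
  ultimately show ?thesis by blast
qed

end

section \<open>Smooth functions of a complex variable\<close>

abbreviation fd :: "(complex \<Rightarrow> complex) \<Rightarrow> complex \<Rightarrow> complex \<Rightarrow> complex" where
  "fd f w \<equiv> frechet_derivative f (at w)"

lemma fd_works: "f differentiable (at w) \<Longrightarrow> (f has_derivative fd f w) (at w)"
  by (simp add: frechet_derivative_works)

lemma fd_eq: "(f has_derivative f') (at w) \<Longrightarrow> fd f w = f'"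
  by (simp add: frechet_derivative_at[symmetric])

lemma fd_cong:
  assumes "open W" "w \<in> W" "\<And>x. x \<in> W \<Longrightarrow> f x = g x" "f differentiable (at w)"
  shows "g differentiable (at w)" "fd g w = fd f w"
proof -
  have "(g has_derivative fd f w) (at w)"
    using has_derivative_transform_within_open[OF fd_works[OF assms(4)] assms(1,2,3)] .
  then show "g differentiable (at w)" "fd g w = fd f w"
    by (auto simp: differentiable_def fd_eq)
qed

lemma Ck_on_cong:
  assumes "open W" "\<And>w. w \<in> W \<Longrightarrow> f w = g w" "Ck_on k W f"
  shows "Ck_on k W g"
  using assms(2,3)
proof (induction k arbitrary: f g)
  case 0
  then show ?case using continuous_on_cong[of W W f g] by simp
next
  case (Suc k)
  have d: "g differentiable (at w)" "fd g w = fd f w" if "w \<in> W" for w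
    using fd_cong[OF assms(1) that, of f g] Suc.prems that by auto
  moreover have "Ck_on k W (\<lambda>w. fd g w v)" for v
    by (rule Suc.IH[of "\<lambda>w. fd f w v"]) (use Suc.prems d in auto)
  ultimately show ?case by simp
qed

lemma Ck_on_subset: "Ck_on k W f \<Longrightarrow> V \<subseteq> W \<Longrightarrow> Ck_on k V f"
  by (induction k arbitrary: f) (auto intro: continuous_on_subset)

text \<open>This passes from bundle frames, which need not be defined on the whole chart, to the chart.\<close>

lemma Ck_on_local:
  assumes "\<And>w. w \<in> W \<Longrightarrow> \<exists>V. open V \<and> w \<in> V \<and> Ck_on k V f"
  shows "Ck_on k W f"
  using assms
proof (induction k arbitrary: f)
  case 0
  have "continuous (at w) f" if "w \<in> W" for w
    using 0[OF that] by (auto simp: continuous_on_eq_continuous_at)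
  then show ?case by (simp add: continuous_at_imp_continuous_on)
next
  case (Suc k)
  have "f differentiable (at w)" if "w \<in> W" for w
    using Suc.prems[OF that] by auto
  moreover have "Ck_on k W (\<lambda>w. fd f w v)" for v
  proof (rule Suc.IH)
    fix w assume "w \<in> W"
    then show "\<exists>V. open V \<and> w \<in> V \<and> Ck_on k V (\<lambda>w. fd f w v)"
      using Suc.prems[of w] by auto
  qed
  ultimately show ?case by simp
qed

lemma Ck_on_Suc_imp: "Ck_on (Suc k) W f \<Longrightarrow> Ck_on k W f"
proof (induction k arbitrary: f)
  case 0
  then show ?case
    by (auto intro!: continuous_at_imp_continuous_on differentiable_imp_continuous_within)
next
  case (Suc k)
  from Suc.prems have "Ck_on (Suc k) W (\<lambda>w. fd f w v)" for v by auto
  from Suc.IH[OF this] Suc.prems show ?case by auto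
qed

lemma Ck_on_SucI:
  assumes "open W" "\<And>w. w \<in> W \<Longrightarrow> (f has_derivative f' w) (at w)"
    and "\<And>v. Ck_on k W (\<lambda>w. f' w v)"
  shows "Ck_on (Suc k) W f"
proof -
  have "Ck_on k W (\<lambda>w. fd f w v)" for v
    by (rule Ck_on_cong[OF assms(1) _ assms(3)[of v]]) (simp add: fd_eq[OF assms(2)])
  then show ?thesis using assms(2) by (auto simp: differentiable_def)
qed

lemma Ck_on_SucD: "Ck_on (Suc k) W f \<Longrightarrow> w \<in> W \<Longrightarrow> (f has_derivative fd f w) (at w)"
  by (auto intro: fd_works)

lemma Ck_on_const: "open W \<Longrightarrow> Ck_on k W (\<lambda>_. c)"
  by (induction k arbitrary: c) auto

lemma Ck_on_add: "open W \<Longrightarrow> Ck_on k W f \<Longrightarrow> Ck_on k W g \<Longrightarrow> Ck_on k W (\<lambda>w. f w + g w)"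
proof (induction k arbitrary: f g)
  case (Suc k)
  show ?case
    by (rule Ck_on_SucI[OF Suc.prems(1), of _ "\<lambda>w v. fd f w v + fd g w v"])
      (use Suc in \<open>auto intro!: has_derivative_add dest: fd_works\<close>)
qed (auto intro!: continuous_intros)

lemma Ck_on_mult: "open W \<Longrightarrow> Ck_on k W f \<Longrightarrow> Ck_on k W g \<Longrightarrow> Ck_on k W (\<lambda>w. f w * g w)"
proof (induction k arbitrary: f g)
  case (Suc k)
  show ?case
  proof (rule Ck_on_SucI[OF Suc.prems(1), of _ "\<lambda>w v. f w * fd g w v + fd f w v * g w"])
    show "((\<lambda>w. f w * g w) has_derivative (\<lambda>v. f w * fd g w v + fd f w v * g w)) (at w)" if "w \<in> W" for w
      using Suc.prems that by (intro has_derivative_mult) (auto dest: Ck_on_SucD simp del: Ck_on.simps(2))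
    show "Ck_on k W (\<lambda>w. f w * fd g w v + fd f w v * g w)" for v
      using Suc.prems Ck_on_Suc_imp[OF Suc.prems(2)] Ck_on_Suc_imp[OF Suc.prems(3)]
      by (intro Ck_on_add Suc.IH) auto
  qed
qed (auto intro!: continuous_intros)

lemma Ck_on_cnj: "open W \<Longrightarrow> Ck_on k W f \<Longrightarrow> Ck_on k W (\<lambda>w. cnj (f w))"
proof (induction k arbitrary: f)
  case (Suc k)
  show ?case
    by (rule Ck_on_SucI[OF Suc.prems(1), of _ "\<lambda>w v. cnj (fd f w v)"])
      (use Suc in \<open>auto intro!: has_derivative_cnj dest: fd_works\<close>)
qed (auto intro!: continuous_intros)

lemma Ck_on_holomorphic: "open W \<Longrightarrow> h holomorphic_on W \<Longrightarrow> Ck_on k W h"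
proof (induction k arbitrary: h)
  case 0
  then show ?case by (simp add: holomorphic_on_imp_continuous_on)
next
  case (Suc k)
  show ?case
  proof (rule Ck_on_SucI[OF Suc.prems(1)])
    show "(h has_derivative (*) (deriv h w)) (at w)" if "w \<in> W" for w
      using holomorphic_derivI[OF Suc.prems(2,1) that] by (simp add: has_field_derivative_def)
    show "Ck_on k W (\<lambda>w. deriv h w * v)" for v
      using Suc.prems by (intro Ck_on_mult Ck_on_const Suc.IH holomorphic_deriv)
  qed
qed

lemma wirt_decomp:
  assumes "f differentiable (at w)"
  shows "fd f w v = wirt f w * v + wirt_bar f w * cnj v"
proof -
  interpret bounded_linear "fd f w"
    using fd_works[OF assms] by (rule has_derivative_bounded_linear)
  have "v = Re v *\<^sub>R 1 + Im v *\<^sub>R \<i>" by (simp add: complex_eq_iff)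
  then have "fd f w v = Re v *\<^sub>R fd f w 1 + Im v *\<^sub>R fd f w \<i>"
    using add scaleR by metis
  then show ?thesis
    by (simp add: wirt_def wirt_bar_def complex_eq_iff) (simp add: field_simps)
qed

lemma Ck_on_wirt:
  assumes "open W" "Ck_on (Suc k) W f"
  shows "Ck_on k W (wirt f)" "Ck_on k W (wirt_bar f)"
proof -
  have "Ck_on k W (\<lambda>w. fd f w v)" for v using assms by auto
  then have c: "Ck_on k W (\<lambda>w. (1/2) * fd f w 1 + c * fd f w \<i>)" for c
    by (intro Ck_on_add Ck_on_mult Ck_on_const assms(1))
  show "Ck_on k W (wirt f)" "Ck_on k W (wirt_bar f)"
    by (rule Ck_on_cong[OF assms(1) _ c[of "- \<i> / 2"]], simp add: wirt_def field_simps,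
        rule Ck_on_cong[OF assms(1) _ c[of "\<i> / 2"]], simp add: wirt_bar_def field_simps)
qed

text \<open>The chain rule in the form \<open>d f(h)(h' v) = (\<partial>f)(h) h' v + (\<partial>'f)(h) cnj (h' v)\<close>, with \<open>\<partial>\<close> and \<open>\<partial>'\<close> the
  two Wirtinger derivatives, keeps all terms complex valued, so the induction stays within one class
  of functions.\<close>

lemma Ck_on_compose_holomorphic:
  assumes "open W" "open V" "h holomorphic_on W" "h ` W \<subseteq> V" "Ck_on k V f"
  shows "Ck_on k W (\<lambda>w. f (h w))"
  using assms(5)
proof (induction k arbitrary: f)
  case 0
  then show ?case
    using continuous_on_compose2[of V f W h] assms by (simp add: holomorphic_on_imp_continuous_on)
next
  case (Suc k)
  define f' where "f' = (\<lambda>w v. wirt f (h w) * (deriv h w * v) + wirt_bar f (h w) * (cnj (deriv h w) * cnj v))"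
  show ?case
  proof (rule Ck_on_SucI[OF assms(1)])
    show "((\<lambda>w. f (h w)) has_derivative f' w) (at w)" if "w \<in> W" for w
    proof -
      have "(h has_derivative (*) (deriv h w)) (at w)"
        using holomorphic_derivI[OF assms(3,1) that] by (simp add: has_field_derivative_def)
      moreover have d: "f differentiable (at (h w))" using Suc.prems that assms(4) by auto
      ultimately have "(f \<circ> h has_derivative (fd f (h w) \<circ> (*) (deriv h w))) (at w)"
        using fd_works by (intro diff_chain_at)
      moreover have "fd f (h w) \<circ> (*) (deriv h w) = f' w"
        by (auto simp: f'_def fun_eq_iff wirt_decomp[OF d])
      ultimately show ?thesis by (simp add: o_def)
    qed
    show "Ck_on k W (\<lambda>w. f' w v)" for v
    proof -
      have d: "Ck_on k W (deriv h)" using assms by (intro Ck_on_holomorphic holomorphic_deriv)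
      show ?thesis unfolding f'_def
        using Suc.IH[OF Ck_on_wirt(1)[OF assms(2) Suc.prems]] Suc.IH[OF Ck_on_wirt(2)[OF assms(2) Suc.prems]]
          d assms(1)
        by (intro Ck_on_add Ck_on_mult Ck_on_const Ck_on_cnj)
    qed
  qed
qed

lemma Csmooth_on_wirt:
  "open W \<Longrightarrow> Csmooth_on W f \<Longrightarrow> Csmooth_on W (wirt f)"
  "open W \<Longrightarrow> Csmooth_on W f \<Longrightarrow> Csmooth_on W (wirt_bar f)"
  unfolding Csmooth_on_def by (blast intro: Ck_on_wirt)+

lemma Csmooth_on_differentiable: "Csmooth_on W f \<Longrightarrow> w \<in> W \<Longrightarrow> f differentiable (at w)"
  unfolding Csmooth_on_def using Ck_on.simps(2)[of 0 W f] by blast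

lemma
  assumes "open W" "w \<in> W" "\<And>x. x \<in> W \<Longrightarrow> f x = g x" "f differentiable (at w)"
  shows wirt_cong: "wirt g w = wirt f w" and wirt_bar_cong: "wirt_bar g w = wirt_bar f w"
  using fd_cong[OF assms] by (auto simp: wirt_def wirt_bar_def)

lemma
  assumes "f differentiable (at w)" "g differentiable (at w)"
  shows wirt_add: "wirt (\<lambda>w. f w + g w) w = wirt f w + wirt g w"
    and wirt_bar_add: "wirt_bar (\<lambda>w. f w + g w) w = wirt_bar f w + wirt_bar g w"
    and wirt_mult: "wirt (\<lambda>w. f w * g w) w = wirt f w * g w + f w * wirt g w"
    and wirt_bar_mult: "wirt_bar (\<lambda>w. f w * g w) w = wirt_bar f w * g w + f w * wirt_bar g w"
proof -
  have "fd (\<lambda>w. f w + g w) w = (\<lambda>v. fd f w v + fd g w v)"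
    using assms by (intro fd_eq has_derivative_add fd_works)
  then show "wirt (\<lambda>w. f w + g w) w = wirt f w + wirt g w"
      "wirt_bar (\<lambda>w. f w + g w) w = wirt_bar f w + wirt_bar g w"
    by (simp_all add: wirt_def wirt_bar_def field_simps)
  have "fd (\<lambda>w. f w * g w) w = (\<lambda>v. f w * fd g w v + fd f w v * g w)"
    using assms by (intro fd_eq has_derivative_mult fd_works)
  then show "wirt (\<lambda>w. f w * g w) w = wirt f w * g w + f w * wirt g w"
      "wirt_bar (\<lambda>w. f w * g w) w = wirt_bar f w * g w + f w * wirt_bar g w"
    by (simp_all add: wirt_def wirt_bar_def field_simps)
qed

lemma interval_derivative_bound:
  fixes \<phi> :: "real \<Rightarrow> complex"
  assumes "0 \<le> t" "\<And>r. r \<in> {0..t} \<Longrightarrow> (\<phi> has_vector_derivative \<phi>' r) (at r within {0..t})"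
    and "\<And>r. r \<in> {0..t} \<Longrightarrow> norm (\<phi>' r) \<le> B"
  shows "norm (\<phi> t - \<phi> 0) \<le> B * t"
proof -
  have "norm (\<phi> t - \<phi> 0) \<le> B * norm (t - 0)"
  proof (rule differentiable_bound[of "{0..t}" _ "\<lambda>r h. h *\<^sub>R \<phi>' r"])
    show "onorm (\<lambda>h. h *\<^sub>R \<phi>' r) \<le> B" if "r \<in> {0..t}" for r
      using assms(3)[OF that] by (intro onorm_le) (simp add: mult.commute[of B] mult_left_mono)
  qed (use assms in \<open>auto simp: has_vector_derivative_def\<close>)
  then show ?thesis using assms(1) by simp
qed

text \<open>The mean value inequality is applied twice, first along \<open>b\<close> and then along \<open>a\<close>. The second difference is
  symmetric in \<open>a\<close> and \<open>b\<close>, which gives the symmetry of second derivatives.\<close>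

lemma second_difference:
  assumes f: "Csmooth_on W f" and W: "open W" and w: "w \<in> W" and \<epsilon>: "0 < \<epsilon>"
  shows "\<exists>\<delta>>0. \<forall>t. 0 < t \<and> t < \<delta> \<longrightarrow>
     norm (f (w + t *\<^sub>R a + t *\<^sub>R b) - f (w + t *\<^sub>R a) - f (w + t *\<^sub>R b) + f w
       - t\<^sup>2 *\<^sub>R fd (\<lambda>x. fd f x a) w b) \<le> \<epsilon> * t\<^sup>2"
proof -
  define g where "g = (\<lambda>x. fd f x a)"
  define c where "c = fd g w b"
  have C2: "Ck_on (Suc (Suc 0)) W f" using f by (auto simp: Csmooth_on_def)
  have df: "(f has_derivative fd f x) (at x)" if "x \<in> W" for x
    using C2 that by (auto intro: fd_works)
  have dg: "(g has_derivative fd g x) (at x)" if "x \<in> W" for x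
    using C2 that unfolding g_def by (auto intro: fd_works)
  have "continuous_on W (\<lambda>x. fd g x b)" using C2 unfolding g_def by simp
  then have "continuous (at w) (\<lambda>x. fd g x b)" using W w by (simp add: continuous_on_eq_continuous_at)
  then obtain d1 where d1: "d1 > 0" "\<And>x. dist x w < d1 \<Longrightarrow> dist (fd g x b) c < \<epsilon>"
    using \<epsilon> unfolding continuous_at_eps_delta c_def dist_norm by metis
  obtain d2 where d2: "d2 > 0" "ball w d2 \<subseteq> W" using W w openE by blast
  define d where "d = min d1 d2"
  \<comment> \<open>For \<open>t < \<delta>\<close> the whole parallelogram spanned by \<open>t a\<close> and \<open>t b\<close> at \<open>w\<close> lies in the ball of radius \<open>d\<close>.\<close>
  define \<delta> where "\<delta> = d / (norm a + norm b + 1)"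
  have "\<delta> > 0" using d1 d2 by (simp add: \<delta>_def d_def add_nonneg_pos)
  moreover have "norm (f (w + t *\<^sub>R a + t *\<^sub>R b) - f (w + t *\<^sub>R a) - f (w + t *\<^sub>R b) + f w - t\<^sup>2 *\<^sub>R c) \<le> \<epsilon> * t\<^sup>2"
    if t: "0 < t" "t < \<delta>" for t
  proof -
    have near: "dist (w + s *\<^sub>R a + r *\<^sub>R b) w < d" if "s \<in> {0..t}" "r \<in> {0..t}" for s r
    proof -
      have "dist (w + s *\<^sub>R a + r *\<^sub>R b) w = norm (s *\<^sub>R a + r *\<^sub>R b)" by (simp add: dist_norm)
      also have "\<dots> \<le> s * norm a + r * norm b"
        using that norm_triangle_ineq[of "s *\<^sub>R a" "r *\<^sub>R b"] by simp
      also have "\<dots> \<le> t * norm a + t * norm b" using that by (intro add_mono mult_right_mono) auto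
      also have "\<dots> < t * (norm a + norm b + 1)" using t by (simp add: algebra_simps)
      also have "\<dots> \<le> d"
        using less_imp_le[OF t(2)] unfolding \<delta>_def by (subst (asm) pos_le_divide_eq) (simp_all add: add_nonneg_pos)
      finally show ?thesis .
    qed
    then have inW: "w + s *\<^sub>R a + r *\<^sub>R b \<in> W" if "s \<in> {0..t}" "r \<in> {0..t}" for s r
      using that d2 by (force simp: d_def dist_commute)
    have inner: "norm (g (w + s *\<^sub>R a + t *\<^sub>R b) - g (w + s *\<^sub>R a) - t *\<^sub>R c) \<le> \<epsilon> * t" if s: "s \<in> {0..t}" for s
    proof -
      define \<psi> where "\<psi> = (\<lambda>r. g (w + s *\<^sub>R a + r *\<^sub>R b) - r *\<^sub>R c)"
      have "norm (\<psi> t - \<psi> 0) \<le> \<epsilon> * t"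
      proof (rule interval_derivative_bound)
        fix r assume r: "r \<in> {0..t}"
        have "((\<lambda>r. g (w + s *\<^sub>R a + r *\<^sub>R b)) has_vector_derivative fd g (w + s *\<^sub>R a + r *\<^sub>R b) b) (at r within {0..t})"
        proof -
          have "((\<lambda>r. w + s *\<^sub>R a + r *\<^sub>R b) has_derivative (\<lambda>h. h *\<^sub>R b)) (at r within {0..t})"
            by (auto intro!: derivative_eq_intros)
          from has_derivative_compose[OF this dg[OF inW[OF s r]]] show ?thesis
            unfolding has_vector_derivative_def
            using linear_scale[OF has_derivative_linear[OF dg[OF inW[OF s r]]]] by simp
        qed
        then show "(\<psi> has_vector_derivative fd g (w + s *\<^sub>R a + r *\<^sub>R b) b - c) (at r within {0..t})"
          unfolding \<psi>_def by (auto intro!: derivative_eq_intros)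
        show "norm (fd g (w + s *\<^sub>R a + r *\<^sub>R b) b - c) \<le> \<epsilon>"
          using d1(2)[of "w + s *\<^sub>R a + r *\<^sub>R b"] near[OF s r] by (simp add: d_def dist_norm)
      qed (use t in auto)
      then show ?thesis by (simp add: \<psi>_def algebra_simps)
    qed
    define \<phi> where "\<phi> = (\<lambda>s. f (w + s *\<^sub>R a + t *\<^sub>R b) - f (w + s *\<^sub>R a) - (s * t) *\<^sub>R c)"
    have "norm (\<phi> t - \<phi> 0) \<le> (\<epsilon> * t) * t"
    proof (rule interval_derivative_bound)
      fix s assume s: "s \<in> {0..t}"
      have 1: "((\<lambda>s. f (w + s *\<^sub>R a + r *\<^sub>R b)) has_vector_derivative g (w + s *\<^sub>R a + r *\<^sub>R b)) (at s within {0..t})"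
        if r: "r \<in> {0..t}" for r
      proof -
        have "((\<lambda>s. w + s *\<^sub>R a + r *\<^sub>R b) has_derivative (\<lambda>h. h *\<^sub>R a)) (at s within {0..t})"
          by (auto intro!: derivative_eq_intros)
        from has_derivative_compose[OF this df[OF inW[OF s r]]] show ?thesis
          unfolding has_vector_derivative_def g_def
          using linear_scale[OF has_derivative_linear[OF df[OF inW[OF s r]]]] by simp
      qed
      from 1[of t] 1[of 0] t
      have "((\<lambda>s. f (w + s *\<^sub>R a + t *\<^sub>R b)) has_vector_derivative g (w + s *\<^sub>R a + t *\<^sub>R b)) (at s within {0..t})"
        "((\<lambda>s. f (w + s *\<^sub>R a)) has_vector_derivative g (w + s *\<^sub>R a)) (at s within {0..t})" by auto
      then show "(\<phi> has_vector_derivative g (w + s *\<^sub>R a + t *\<^sub>R b) - g (w + s *\<^sub>R a) - t *\<^sub>R c) (at s within {0..t})"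
        unfolding \<phi>_def by (auto intro!: derivative_eq_intros)
    qed (use inner t in auto)
    then show ?thesis by (simp add: \<phi>_def power2_eq_square algebra_simps)
  qed
  ultimately show ?thesis unfolding c_def g_def by blast
qed

lemma symmetric_second_derivative:
  assumes f: "Csmooth_on W f" and W: "open W" and w: "w \<in> W"
  shows "fd (\<lambda>x. fd f x a) w b = fd (\<lambda>x. fd f x b) w a"
proof -
  let ?c = "fd (\<lambda>x. fd f x a) w b" and ?c' = "fd (\<lambda>x. fd f x b) w a"
  have "norm (?c - ?c') \<le> 2 * \<epsilon>" if \<epsilon>: "\<epsilon> > 0" for \<epsilon> :: real
  proof -
    obtain d1 where d1: "d1 > 0" "\<And>t. 0 < t \<Longrightarrow> t < d1 \<Longrightarrow>
       norm (f (w + t *\<^sub>R a + t *\<^sub>R b) - f (w + t *\<^sub>R a) - f (w + t *\<^sub>R b) + f w - t\<^sup>2 *\<^sub>R ?c) \<le> \<epsilon> * t\<^sup>2"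
      using second_difference[OF f W w \<epsilon>, of a b] by blast
    obtain d2 where d2: "d2 > 0" "\<And>t. 0 < t \<Longrightarrow> t < d2 \<Longrightarrow>
       norm (f (w + t *\<^sub>R b + t *\<^sub>R a) - f (w + t *\<^sub>R b) - f (w + t *\<^sub>R a) + f w - t\<^sup>2 *\<^sub>R ?c') \<le> \<epsilon> * t\<^sup>2"
      using second_difference[OF f W w \<epsilon>, of b a] by blast
    define t where "t = min d1 d2 / 2"
    have t: "0 < t" "t < d1" "t < d2" using d1 d2 by (auto simp: t_def min_def)
    define X where "X = f (w + t *\<^sub>R a + t *\<^sub>R b) - f (w + t *\<^sub>R a) - f (w + t *\<^sub>R b) + f w"
    have "norm (X - t\<^sup>2 *\<^sub>R ?c) \<le> \<epsilon> * t\<^sup>2" using d1(2)[OF t(1,2)] by (simp add: X_def)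
    moreover have "norm (X - t\<^sup>2 *\<^sub>R ?c') \<le> \<epsilon> * t\<^sup>2" using d2(2)[OF t(1,3)] by (simp add: X_def algebra_simps)
    ultimately have "norm ((X - t\<^sup>2 *\<^sub>R ?c') - (X - t\<^sup>2 *\<^sub>R ?c)) \<le> \<epsilon> * t\<^sup>2 + \<epsilon> * t\<^sup>2"
      using norm_triangle_ineq4[of "X - t\<^sup>2 *\<^sub>R ?c'" "X - t\<^sup>2 *\<^sub>R ?c"] by linarith
    also have "(X - t\<^sup>2 *\<^sub>R ?c') - (X - t\<^sup>2 *\<^sub>R ?c) = t\<^sup>2 *\<^sub>R (?c - ?c')" by (simp add: algebra_simps)
    finally have "t\<^sup>2 * norm (?c - ?c') \<le> t\<^sup>2 * (2 * \<epsilon>)" by (simp only: norm_scaleR) (simp add: mult.commute)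
    then show ?thesis using t(1) by simp
  qed
  from this[of "e / 2" for e] have "norm (?c - ?c') \<le> 0 + e" if "e > 0" for e using that by simp
  then have "norm (?c - ?c') \<le> 0" by (rule field_le_epsilon)
  then show ?thesis by simp
qed

lemma wirt_commute:
  assumes f: "Csmooth_on W f" and W: "open W" and w: "w \<in> W"
  shows "wirt (wirt_bar f) w = wirt_bar (wirt f) w"
proof -
  have d: "(\<lambda>x. fd f x v) differentiable (at w)" for v
    using f w unfolding Csmooth_on_def using Ck_on.simps(2)[of "Suc 0" W f] Ck_on.simps(2)[of 0 W "\<lambda>x. fd f x v"] by blast
  have 1: "fd (wirt_bar f) w v = (fd (\<lambda>x. fd f x 1) w v + \<i> * fd (\<lambda>x. fd f x \<i>) w v) / 2" for v
    unfolding wirt_bar_def[abs_def]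
    by (rule fun_cong[OF fd_eq]) (use fd_works[OF d] in \<open>auto intro!: derivative_eq_intros\<close>)
  have 2: "fd (wirt f) w v = (fd (\<lambda>x. fd f x 1) w v - \<i> * fd (\<lambda>x. fd f x \<i>) w v) / 2" for v
    unfolding wirt_def[abs_def]
    by (rule fun_cong[OF fd_eq]) (use fd_works[OF d] in \<open>auto intro!: derivative_eq_intros\<close>)
  show ?thesis
    unfolding wirt_def[of "wirt_bar f"] wirt_bar_def[of "wirt f"] 1 2
    using symmetric_second_derivative[OF assms, of 1 \<i>] by (simp add: field_simps)
qed

text \<open>A continuous logarithm \<open>l\<close> of \<open>f\<close> exists on a simply connected set; near \<open>w\<close> it is \<open>l w + Ln (f x / f w)\<close>
  and hence differentiable. The root \<open>g = exp (- l / n)\<close> satisfies \<open>d g = - g\<^bsup>n+1\<^esup> d f / n\<close>, from which its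
  smoothness follows by induction on the order.\<close>

lemma smooth_nth_root_inverse:
  assumes W: "open W" "simply_connected W" and f: "Csmooth_on W f" and nz: "\<And>w. w \<in> W \<Longrightarrow> f w \<noteq> 0"
    and n: "0 < n"
  obtains g where "Csmooth_on W g" "\<And>w. w \<in> W \<Longrightarrow> g w ^ n * f w = 1"
proof -
  have "continuous_on W f" using f Ck_on.simps(1)[of W f] unfolding Csmooth_on_def by blast
  then obtain l where l: "continuous_on W l" "\<And>w. w \<in> W \<Longrightarrow> f w = exp (l w)"
    by (rule continuous_logarithm_on_simply_connected[OF _ W(2) open_imp_locally_path_connected[OF W(1)]])
      (use nz in auto)
  have df: "(f has_derivative fd f w) (at w)" if "w \<in> W" for w
    using Csmooth_on_differentiable[OF f that] by (rule fd_works)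
  have dl: "(l has_derivative (\<lambda>v. fd f w v / f w)) (at w)" if w: "w \<in> W" for w
  proof -
    have "continuous (at w) l" using l(1) W(1) w by (simp add: continuous_on_eq_continuous_at)
    then obtain d where d: "d > 0" "\<And>x. dist x w < d \<Longrightarrow> dist (l x) (l w) < pi"
      using pi_gt_zero unfolding continuous_at_eps_delta dist_norm by metis
    have ev: "l w + Ln (f x / f w) = l x" if x: "x \<in> W \<inter> ball w d" for x
    proof -
      have "norm (l x - l w) < pi" using d(2)[of x] x by (simp add: dist_norm norm_minus_commute)
      then have "\<bar>Im (l x - l w)\<bar> < pi" using abs_Im_le_cmod[of "l x - l w"] by linarith
      then have "Ln (exp (l x - l w)) = l x - l w" by (intro Ln_exp) auto
      then show ?thesis using l(2)[of x] l(2)[OF w] x by (simp add: exp_diff)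
    qed
    have "((\<lambda>x. l w + Ln (f x / f w)) has_derivative (\<lambda>v. fd f w v / f w)) (at w)"
    proof -
      have "((\<lambda>x. f x / f w) has_derivative (\<lambda>v. fd f w v / f w)) (at w)"
        using df[OF w] nz[OF w] by (auto intro!: derivative_eq_intros)
      moreover have "(Ln has_derivative (*) 1) (at (f w / f w))"
        using has_field_derivative_Ln[of 1] nz[OF w] by (simp add: has_field_derivative_def)
      ultimately have "((\<lambda>x. Ln (f x / f w)) has_derivative (\<lambda>v. 1 * (fd f w v / f w))) (at w)"
        by (rule has_derivative_compose)
      then show ?thesis by (auto intro!: derivative_eq_intros)
    qed
    then show ?thesis
      by (rule has_derivative_transform_within_open[of _ _ _ _ "W \<inter> ball w d"]) (use W w d ev in auto)
  qed
  define g where "g = (\<lambda>w. exp (- l w / of_nat n))"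
  have gn: "g w ^ n * f w = 1" if "w \<in> W" for w
  proof -
    have "g w ^ n = exp (- l w)" unfolding g_def using n by (simp add: exp_of_nat_mult[symmetric])
    then show ?thesis using l(2)[OF that] by (simp add: exp_minus)
  qed
  have dg: "(g has_derivative (\<lambda>v. (- 1 / of_nat n) * (g w * (g w ^ n * fd f w v)))) (at w)" if w: "w \<in> W" for w
  proof -
    have "(g has_derivative (\<lambda>v. exp (- l w / of_nat n) * (- (fd f w v / f w) / of_nat n))) (at w)"
    proof -
      have "((\<lambda>w. - l w / of_nat n) has_derivative (\<lambda>v. - (fd f w v / f w) / of_nat n)) (at w)"
        using dl[OF w] n by (auto intro!: derivative_eq_intros)
      from has_derivative_compose[OF this, of exp "(*) (exp (- l w / of_nat n))"] show ?thesis
        unfolding g_def using DERIV_exp[of "- l w / of_nat n"] by (simp add: has_field_derivative_def)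
    qed
    moreover have "1 / f w = g w ^ n" using gn[OF w] nz[OF w] by (simp add: field_simps)
    then have "v / f w = g w ^ n * v" for v by (metis mult.commute mult_1 times_divide_eq_left)
    ultimately show ?thesis by (simp add: g_def)
  qed
  have "Ck_on k W g" for k
  proof (induction k)
    case 0
    show ?case using dg by (auto intro!: continuous_at_imp_continuous_on has_derivative_continuous)
  next
    case (Suc k)
    have pow: "Ck_on k W (\<lambda>w. g w ^ m)" for m
      by (induction m) (use Suc W in \<open>auto intro!: Ck_on_const Ck_on_mult\<close>)
    have fdk: "Ck_on k W (\<lambda>w. fd f w v)" for v
      using f unfolding Csmooth_on_def using Ck_on.simps(2)[of k W f] by blast
    show ?case
      by (rule Ck_on_SucI[OF W(1) dg]) (assumption, intro Ck_on_mult Ck_on_const W(1) Suc pow fdk)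
  qed
  then have "Csmooth_on W g" by (simp add: Csmooth_on_def)
  with gn show thesis by (intro that[of g])
qed

section \<open>Smooth functions and sections over a surface\<close>

lemma sum_apply: "(\<Sum>i\<in>I. f i) p = (\<Sum>i\<in>I. f i p)"
  by (induction I rule: infinite_finite_induct) auto

lemma
  assumes "open W" "Csmooth_on W f" "Csmooth_on W g"
  shows Csmooth_on_add: "Csmooth_on W (\<lambda>w. f w + g w)"
    and Csmooth_on_mult: "Csmooth_on W (\<lambda>w. f w * g w)"
  using assms by (simp_all add: Csmooth_on_def Ck_on_add Ck_on_mult)

lemma Csmooth_on_const: "open W \<Longrightarrow> Csmooth_on W (\<lambda>_. c)"
  by (simp add: Csmooth_on_def Ck_on_const)

lemma Csmooth_on_cong: "open W \<Longrightarrow> (\<And>w. w \<in> W \<Longrightarrow> f w = g w) \<Longrightarrow> Csmooth_on W f \<Longrightarrow> Csmooth_on W g"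
  unfolding Csmooth_on_def using Ck_on_cong by blast

locale riemann_surface =
  fixes X :: "('s::topological_space, 'v::ab_group_add) vbundle"
  assumes cs: "complex_structure X"
begin

lemma chart:
  assumes "(U, z) \<in> charts X"
  shows "open U" "open (z ` U)" "homeomorphism U (z ` U) z (inv_into U z)"
    and inv_chart: "p \<in> U \<Longrightarrow> inv_into U z (z p) = p"
    and chart_image_open: "open W \<Longrightarrow> open (z ` (U \<inter> W))"
proof -
  show *: "open U" "open (z ` U)" "homeomorphism U (z ` U) z (inv_into U z)"
    using cs assms unfolding complex_structure_def by auto
  show "p \<in> U \<Longrightarrow> inv_into U z (z p) = p"
    using *(3) by (simp add: homeomorphism_def)
  assume "open W"
  then have "openin (top_of_set U) (U \<inter> W)" by (simp add: openin_open_Int)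
  from homeomorphism_imp_open_map[OF *(3) this] *(2) show "open (z ` (U \<inter> W))"
    by (simp add: openin_open_eq)
qed

lemma smooth_fun_cong:
  assumes "open W" "\<And>p. p \<in> W \<Longrightarrow> f p = g p" "smooth_fun X W f"
  shows "smooth_fun X W g"
  unfolding smooth_fun_def
proof clarify
  fix U z assume c: "(U, z) \<in> charts X"
  then have "Csmooth_on (z ` (U \<inter> W)) (f \<circ> inv_into U z)"
    using assms(3) unfolding smooth_fun_def by blast
  then show "Csmooth_on (z ` (U \<inter> W)) (g \<circ> inv_into U z)"
    by (rule Csmooth_on_cong[OF chart_image_open[OF c assms(1)], rotated])
      (use assms(2) inv_chart[OF c] in auto)
qed

lemma smooth_fun_const: "open W \<Longrightarrow> smooth_fun X W (\<lambda>_. c)"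
  unfolding smooth_fun_def by (auto simp: o_def intro!: Csmooth_on_const chart_image_open)

lemma
  assumes "open W" "smooth_fun X W f" "smooth_fun X W g"
  shows smooth_fun_add: "smooth_fun X W (\<lambda>p. f p + g p)"
    and smooth_fun_mult: "smooth_fun X W (\<lambda>p. f p * g p)"
  using assms unfolding smooth_fun_def o_def
  by (auto intro!: Csmooth_on_add Csmooth_on_mult chart_image_open)

lemma smooth_fun_subset: "smooth_fun X W f \<Longrightarrow> V \<subseteq> W \<Longrightarrow> smooth_fun X V f"
  unfolding smooth_fun_def Csmooth_on_def
proof clarify
  fix U z k assume "\<forall>(U, z)\<in>charts X. \<forall>k. Ck_on k (z ` (U \<inter> W)) (f \<circ> inv_into U z)"
    and V: "V \<subseteq> W" and "(U, z) \<in> charts X"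
  then have "Ck_on k (z ` (U \<inter> W)) (f \<circ> inv_into U z)" by blast
  then show "Ck_on k (z ` (U \<inter> V)) (f \<circ> inv_into U z)"
    by (rule Ck_on_subset) (use V in blast)
qed

lemma smooth_fun_local:
  assumes "\<And>p. p \<in> W \<Longrightarrow> \<exists>V. open V \<and> p \<in> V \<and> smooth_fun X (W \<inter> V) f" "open W"
  shows "smooth_fun X W f"
  unfolding smooth_fun_def Csmooth_on_def
proof clarify
  fix U z k assume c: "(U, z) \<in> charts X"
  show "Ck_on k (z ` (U \<inter> W)) (f \<circ> inv_into U z)"
  proof (rule Ck_on_local)
    fix w assume "w \<in> z ` (U \<inter> W)"
    then obtain p where p: "p \<in> U" "p \<in> W" "w = z p" by auto
    then obtain V where V: "open V" "p \<in> V" "smooth_fun X (W \<inter> V) f" using assms by blast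
    then have "Ck_on k (z ` (U \<inter> (W \<inter> V))) (f \<circ> inv_into U z)"
      using c unfolding smooth_fun_def Csmooth_on_def by blast
    moreover have "open (z ` (U \<inter> (W \<inter> V)))" using V assms by (intro chart_image_open[OF c]) auto
    ultimately show "\<exists>V. open V \<and> w \<in> V \<and> Ck_on k V (f \<circ> inv_into U z)"
      using p V by blast
  qed
qed

text \<open>Smoothness in one chart suffices on its domain, as the changes of coordinates are holomorphic.\<close>

lemma smooth_fun_chart:
  assumes c: "(U, z) \<in> charts X" and f: "Csmooth_on (z ` U) (f \<circ> inv_into U z)"
  shows "smooth_fun X U f"
  unfolding smooth_fun_def
proof clarify
  fix U' z' assume c': "(U', z') \<in> charts X"
  let ?h = "z \<circ> inv_into U' z'" and ?W = "z' ` (U' \<inter> U)"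
  have W: "open ?W" using chart_image_open[OF c' chart(1)[OF c]] .
  have hol: "?h holomorphic_on ?W"
    using cs c c' unfolding complex_structure_def by blast
  have img: "?h ` ?W \<subseteq> z ` U" using inv_chart[OF c'] by auto
  have "Csmooth_on ?W (\<lambda>w. (f \<circ> inv_into U z) (?h w))"
    unfolding Csmooth_on_def
    using Ck_on_compose_holomorphic[OF W chart(2)[OF c] hol img] f unfolding Csmooth_on_def by blast
  then show "Csmooth_on ?W (f \<circ> inv_into U' z')"
    by (rule Csmooth_on_cong[OF W, rotated]) (auto simp: inv_chart[OF c] inv_chart[OF c'])
qed

text \<open>The identity of the ring of smooth functions on \<open>W\<close> extended by zero.\<close>

definition ind :: "'s set \<Rightarrow> 's \<Rightarrow> complex" where
  "ind W p = (if p \<in> W then 1 else 0)"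

lemma smooth_funsI:
  assumes "open W" "smooth_fun X W f"
  shows "(\<lambda>p. if p \<in> W then f p else 0) \<in> smooth_funs X W"
  unfolding smooth_funs_def using smooth_fun_cong[OF assms(1) _ assms(2)] by auto

lemma smooth_funs_const: "open W \<Longrightarrow> (\<lambda>p. c * ind W p) \<in> smooth_funs X W"
  using smooth_funsI[OF _ smooth_fun_const, of W c] by (auto simp: ind_def if_distrib cong: if_cong)

lemma smooth_funs_ring:
  assumes W: "open W"
  shows "ind W \<in> smooth_funs X W"
    and "f \<in> smooth_funs X W \<Longrightarrow> g \<in> smooth_funs X W \<Longrightarrow> f + g \<in> smooth_funs X W"
    and "f \<in> smooth_funs X W \<Longrightarrow> g \<in> smooth_funs X W \<Longrightarrow> f * g \<in> smooth_funs X W"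
    and "f \<in> smooth_funs X W \<Longrightarrow> - f \<in> smooth_funs X W"
    and "f \<in> smooth_funs X W \<Longrightarrow> ind W * f = f"
proof -
  show "ind W \<in> smooth_funs X W" using smooth_funs_const[OF W, of 1] by simp
  show add: "f + g \<in> smooth_funs X W" if "f \<in> smooth_funs X W" "g \<in> smooth_funs X W" for f g
    using that smooth_fun_add[OF W, of f g] by (simp add: smooth_funs_def plus_fun_def)
  show mult: "f * g \<in> smooth_funs X W" if "f \<in> smooth_funs X W" "g \<in> smooth_funs X W" for f g
    using that smooth_fun_mult[OF W, of f g] by (simp add: smooth_funs_def times_fun_def)
  show "- f \<in> smooth_funs X W" if f: "f \<in> smooth_funs X W"
  proof -
    have "(\<lambda>p. - 1 * ind W p) * f = - f"
      using f by (auto simp: smooth_funs_def ind_def fun_eq_iff)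
    then show ?thesis using mult[OF smooth_funs_const[OF W, of "- 1"] f] by simp
  qed
  show "ind W * f = f" if "f \<in> smooth_funs X W"
    using that by (auto simp: smooth_funs_def ind_def fun_eq_iff)
qed

end

locale volume_bundle = riemann_surface X
  for X :: "('s::topological_space, 'v::ab_group_add) vbundle" +
  fixes n :: nat
  assumes vb: "vector_bundle n X" and vf: "volume_form n X" and n_pos: "0 < n"
begin

sublocale V: vector_space "smul X"
  by (rule conjunct1[OF vb[unfolded vector_bundle_def]])

lemma frame_at:
  obtains W e where "(W, e) \<in> frames X" "p \<in> W"
proof -
  have "(\<Union>(W, e)\<in>frames X. W) = UNIV" using vb unfolding vector_bundle_def by (elim conjE)
  then have "p \<in> (\<Union>(W, e)\<in>frames X. W)" by (simp only: UNIV_I)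
  with that show thesis by auto
qed

lemma
  assumes "(W, e) \<in> frames X"
  shows frame_open: "open W" and frame_basis: "p \<in> W \<Longrightarrow> basis_at X n p (\<lambda>i. e i p)"
proof -
  have "\<forall>(W, e)\<in>frames X. open W \<and> (\<forall>p\<in>W. basis_at X n p (\<lambda>i. e i p))"
    using vb unfolding vector_bundle_def by (elim conjE)
  from bspec[OF this assms] show "open W" "p \<in> W \<Longrightarrow> basis_at X n p (\<lambda>i. e i p)" by auto
qed

lemma restricted_module_fibre: "restricted_module UNIV (fibre X p) (smul X) 1"
proof -
  obtain W e where "(W, e) \<in> frames X" "p \<in> W" by (rule frame_at)
  then have b: "basis_at X n p (\<lambda>i. e i p)" by (rule frame_basis)
  define S where "S = (\<lambda>c. \<Sum>i<n. smul X (c i) (e i p))"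
  have img: "fibre X p = range S"
  proof -
    have "fibre X p = S ` ({..<n} \<rightarrow>\<^sub>E UNIV)"
      using b by (simp add: basis_at_def bij_betw_def S_def)
    also have "\<dots> = range S"
    proof (intro equalityI subsetI)
      fix x assume "x \<in> range S"
      then obtain c where x: "x = S c" by auto
      have c: "S c = S (restrict c {..<n})" by (simp add: S_def)
      show "x \<in> S ` ({..<n} \<rightarrow>\<^sub>E UNIV)" unfolding x c by (rule imageI) (simp add: PiE_def extensional_def)
    qed auto
    finally show ?thesis .
  qed
  have S0: "S (\<lambda>_. 0) = 0" by (simp add: S_def)
  have Sa: "S c + S d = S (\<lambda>i. c i + d i)" for c d
    by (simp add: S_def sum.distrib V.scale_left_distrib)
  have Sm: "smul X a (S c) = S (\<lambda>i. a * c i)" for a c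
    by (simp add: S_def V.scale_sum_right)
  show ?thesis
  proof
    show "0 \<in> fibre X p" unfolding img using S0 by (metis rangeI)
    show "x + y \<in> fibre X p" if "x \<in> fibre X p" "y \<in> fibre X p" for x y
      using that unfolding img by (auto simp: Sa)
    show "smul X a x \<in> fibre X p" if "x \<in> fibre X p" for a x
      using that unfolding img by (auto simp: Sm)
  qed (simp_all add: V.scale_right_distrib V.scale_left_distrib)
qed

lemma vol_alternating: "restricted_module.alternating UNIV (fibre X p) (smul X) n (vol X p)"
proof -
  interpret F: restricted_module UNIV "fibre X p" "smul X" 1 by (rule restricted_module_fibre)
  have cong: "\<forall>p v v'. (\<forall>i<n. v i = v' i) \<longrightarrow> vol X p v = vol X p v'"
    using vf unfolding volume_form_def by (elim conjE)
  have vf': "\<forall>p v. (\<forall>i<n. v i \<in> fibre X p) \<longrightarrow>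
        (\<forall>j<n. \<forall>x\<in>fibre X p. \<forall>y\<in>fibre X p. \<forall>a.
           vol X p (v(j := smul X a x + y)) = a * vol X p (v(j := x)) + vol X p (v(j := y))) \<and>
        (\<forall>i<n. \<forall>j<n. i \<noteq> j \<and> v i = v j \<longrightarrow> vol X p v = 0)"
    using vf unfolding volume_form_def by (elim conjE)
  have module_span: "vol X p (v(j := smul X a x + y)) = a * vol X p (v(j := x)) + vol X p (v(j := y))"
    if "\<And>i. i < n \<Longrightarrow> v i \<in> fibre X p" "j < n" "x \<in> fibre X p" "y \<in> fibre X p" for v j x y a
    using vf'[rule_format, of v p] that by simp
  show ?thesis
  proof (rule F.alternatingI)
    show "vol X p v = vol X p v'" if "\<And>i. i < n \<Longrightarrow> v i = v' i" for v v'
      using cong that by blast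
    show "vol X p (v(j := x + y)) = vol X p (v(j := x)) + vol X p (v(j := y))"
      if "\<And>i. i < n \<Longrightarrow> v i \<in> fibre X p" "j < n" "x \<in> fibre X p" "y \<in> fibre X p" for v j x y
      using module_span[of v j x y 1] that by simp
    show "vol X p (v(j := smul X c x)) = c * vol X p (v(j := x))"
      if "\<And>i. i < n \<Longrightarrow> v i \<in> fibre X p" "j < n" "c \<in> UNIV" "x \<in> fibre X p" for v j c x
      using module_span[of v j x 0 1] module_span[of v j x 0 c] that by simp
    show "vol X p v = 0"
      if "\<And>i. i < n \<Longrightarrow> v i \<in> fibre X p" "i < n" "j < n" "i \<noteq> j" "v i = v j" for v i j
      using vf'[rule_format, of v p] that by simp
  qed
qed

text \<open>The extension by zero keeps the values in the ring of functions over \<open>W\<close>.\<close>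

definition section_vol :: "'s set \<Rightarrow> (nat \<Rightarrow> 's \<Rightarrow> 'v) \<Rightarrow> 's \<Rightarrow> complex" where
  "section_vol W v p = (if p \<in> W then vol X p (\<lambda>i. v i p) else 0)"

lemma upd_apply: "(\<lambda>i. (v(j := x)) i p) = (\<lambda>i. v i p)(j := x p)"
  by auto

text \<open>Stated for an arbitrary module of sections, because it is used both over \<open>U\<close> and over its intersection
  with the domain of a frame of the bundle.\<close>

lemma section_vol_alternating:
  assumes rm: "restricted_module R M (smult_sec X) u" and M: "\<And>\<sigma> p. \<sigma> \<in> M \<Longrightarrow> p \<in> W \<Longrightarrow> \<sigma> p \<in> fibre X p"
  shows "restricted_module.alternating R M (smult_sec X) n (section_vol W)"
proof -
  interpret S: restricted_module R M "smult_sec X" u by (rule rm)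
  show ?thesis
  proof (rule S.alternatingI)
    fix v v' :: "nat \<Rightarrow> 's \<Rightarrow> 'v" assume eq: "\<And>i. i < n \<Longrightarrow> v i = v' i"
    show "section_vol W v = section_vol W v'"
    proof
      fix p
      interpret F: restricted_module UNIV "fibre X p" "smul X" 1 by (rule restricted_module_fibre)
      have "vol X p (\<lambda>i. v i p) = vol X p (\<lambda>i. v' i p)"
        by (rule F.alt_cong[OF vol_alternating]) (simp add: eq)
      then show "section_vol W v p = section_vol W v' p" by (simp add: section_vol_def)
    qed
  next
    fix v j x y assume v: "\<And>i. i < n \<Longrightarrow> v i \<in> M" and j: "j < n" and xy: "x \<in> M" "y \<in> M"
    show "section_vol W (v(j := x + y)) = section_vol W (v(j := x)) + section_vol W (v(j := y))"
    proof
      fix p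
      interpret F: restricted_module UNIV "fibre X p" "smul X" 1 by (rule restricted_module_fibre)
      show "section_vol W (v(j := x + y)) p = (section_vol W (v(j := x)) + section_vol W (v(j := y))) p"
        unfolding section_vol_def upd_apply plus_fun_apply
        using F.alt_add[OF vol_alternating, of "\<lambda>i. v i p" j "x p" "y p"] M v j xy by simp
    qed
  next
    fix v j c x assume v: "\<And>i. i < n \<Longrightarrow> v i \<in> M" and j: "j < n" and c: "c \<in> R" and x: "x \<in> M"
    show "section_vol W (v(j := smult_sec X c x)) = c * section_vol W (v(j := x))"
    proof
      fix p
      interpret F: restricted_module UNIV "fibre X p" "smul X" 1 by (rule restricted_module_fibre)
      show "section_vol W (v(j := smult_sec X c x)) p = (c * section_vol W (v(j := x))) p"
        unfolding section_vol_def upd_apply times_fun_apply smult_sec_def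
        using F.alt_sm[OF vol_alternating, of "\<lambda>i. v i p" j "c p" "x p"] M v j x by simp
    qed
  next
    fix v i j assume v: "\<And>i. i < n \<Longrightarrow> v i \<in> M" and ij: "i < n" "j < n" "i \<noteq> j" and eq: "v i = v j"
    show "section_vol W v = 0"
    proof
      fix p
      interpret F: restricted_module UNIV "fibre X p" "smul X" 1 by (rule restricted_module_fibre)
      show "section_vol W v p = 0 p"
        using F.alt_eq[OF vol_alternating, of "\<lambda>i. v i p" i j] M v ij eq
        by (simp add: section_vol_def)
    qed
  qed
qed

lemma restricted_module_sections_on:
  assumes W: "open W" and M0: "\<And>\<sigma> p. \<sigma> \<in> M \<Longrightarrow> p \<notin> W \<Longrightarrow> \<sigma> p = 0"
    and M: "0 \<in> M" "\<And>x y. x \<in> M \<Longrightarrow> y \<in> M \<Longrightarrow> x + y \<in> M"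
      "\<And>f x. f \<in> smooth_funs X W \<Longrightarrow> x \<in> M \<Longrightarrow> smult_sec X f x \<in> M"
  shows "restricted_module (smooth_funs X W) M (smult_sec X) (ind W)"
proof
  show "smult_sec X (ind W) x = x" if "x \<in> M" for x
    using M0[OF that] by (auto simp: smult_sec_def ind_def fun_eq_iff)
qed (use M smooth_funs_ring[OF W] in \<open>auto simp: fun_eq_iff smult_sec_def V.scale_right_distrib V.scale_left_distrib\<close>)

lemma smooth_comb_0: "open W \<Longrightarrow> smooth_comb X n W e 0"
  unfolding smooth_comb_def by (rule exI[of _ "\<lambda>_ _. 0"]) (auto intro: smooth_fun_const)

lemma smooth_comb_add:
  assumes "open W" "smooth_comb X n W e \<sigma>" "smooth_comb X n W e \<tau>"
  shows "smooth_comb X n W e (\<sigma> + \<tau>)"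
proof -
  obtain c d where "\<forall>i<n. smooth_fun X W (c i)" "\<forall>i<n. smooth_fun X W (d i)"
    and "\<forall>p\<in>W. \<sigma> p = (\<Sum>i<n. smul X (c i p) (e i p))" "\<forall>p\<in>W. \<tau> p = (\<Sum>i<n. smul X (d i p) (e i p))"
    using assms unfolding smooth_comb_def by blast
  then show ?thesis unfolding smooth_comb_def
    by (intro exI[of _ "\<lambda>i p. c i p + d i p"]) (auto intro!: smooth_fun_add assms(1) simp: V.scale_left_distrib sum.distrib)
qed

lemma smooth_comb_sm:
  assumes "open W" "smooth_comb X n W e \<sigma>" "smooth_fun X W f"
  shows "smooth_comb X n W e (smult_sec X f \<sigma>)"
proof -
  obtain c where "\<forall>i<n. smooth_fun X W (c i)" "\<forall>p\<in>W. \<sigma> p = (\<Sum>i<n. smul X (c i p) (e i p))"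
    using assms unfolding smooth_comb_def by blast
  then show ?thesis unfolding smooth_comb_def
    by (intro exI[of _ "\<lambda>i p. f p * c i p"])
      (auto intro!: smooth_fun_mult assms simp: V.scale_sum_right smult_sec_def)
qed

lemma frame_fibre: "(W, e) \<in> frames X \<Longrightarrow> p \<in> W \<Longrightarrow> i < n \<Longrightarrow> e i p \<in> fibre X p"
proof -
  assume "(W, e) \<in> frames X" "p \<in> W" and i: "i < n"
  then have b: "basis_at X n p (\<lambda>i. e i p)" by (intro frame_basis)
  define c where "c = (\<lambda>k. if k < n then if k = i then 1 else 0 else undefined :: complex)"
  have "c \<in> {..<n} \<rightarrow>\<^sub>E UNIV" by (simp add: PiE_def extensional_def c_def)
  then have "(\<Sum>k<n. smul X (c k) (e k p)) \<in> fibre X p"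
    using b unfolding basis_at_def bij_betw_def by blast
  also have "(\<Sum>k<n. smul X (c k) (e k p)) = (\<Sum>k<n. if k = i then e i p else 0)"
    by (intro sum.cong) (auto simp: c_def)
  also have "\<dots> = e i p" using i by simp
  finally show ?thesis .
qed

text \<open>On the domain of a frame of the bundle the volume of the frame is smooth by hypothesis, and
  \<open>alternating_in_submodule\<close> extends this to all tuples of smooth combinations.\<close>

lemma section_vol_smooth_local:
  assumes fr: "(W', e) \<in> frames X" and W: "open W" "W \<subseteq> W'"
    and v: "\<And>i. i < n \<Longrightarrow> smooth_comb X n W e (v i)"
  shows "smooth_fun X W (\<lambda>p. vol X p (\<lambda>i. v i p))"
proof -
  define M where "M = {\<sigma>. smooth_comb X n W e \<sigma> \<and> (\<forall>p. p \<notin> W \<longrightarrow> \<sigma> p = 0)}"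
  \<comment> \<open>Frames of the bundle are not assumed to vanish outside their domain.\<close>
  define cut where "cut = (\<lambda>(\<sigma> :: 's \<Rightarrow> 'v) p. if p \<in> W then \<sigma> p else 0)"
  have cut_M: "cut \<sigma> \<in> M" if "smooth_comb X n W e \<sigma>" for \<sigma>
    using that by (auto simp: M_def cut_def smooth_comb_def)
  have rm: "restricted_module (smooth_funs X W) M (smult_sec X) (ind W)"
    by (rule restricted_module_sections_on[OF W(1)])
      (auto simp: M_def smult_sec_def smooth_funs_def
        intro: smooth_comb_0 smooth_comb_add smooth_comb_sm W)
  interpret S: restricted_module "smooth_funs X W" M "smult_sec X" "ind W" by (rule rm)
  have fib: "\<sigma> p \<in> fibre X p" if \<sigma>: "\<sigma> \<in> M" "p \<in> W" for \<sigma> p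
  proof -
    interpret F: restricted_module UNIV "fibre X p" "smul X" 1 by (rule restricted_module_fibre)
    obtain c where "\<sigma> p = (\<Sum>i<n. smul X (c i p) (e i p))"
      using \<sigma> unfolding M_def smooth_comb_def by blast
    then show ?thesis using \<sigma> W frame_fibre[OF fr] by (auto intro!: F.M_sum F.M_sm)
  qed
  have e: "smooth_comb X n W e (e i)" if i: "i < n" for i
    unfolding smooth_comb_def
  proof (intro exI conjI ballI allI impI)
    show "smooth_fun X W (\<lambda>p. if k = i then 1 else 0)" for k by (simp add: smooth_fun_const W)
    fix p
    have "(\<Sum>k<n. smul X (if k = i then 1 else 0) (e k p)) = (\<Sum>k<n. if k = i then e i p else 0)"
      by (intro sum.cong) auto
    then show "e i p = (\<Sum>k<n. smul X (if k = i then 1 else 0) (e k p))" using i by simp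
  qed
  have alt: "S.alternating n (section_vol W)"
    by (rule section_vol_alternating[OF rm]) (rule fib)
  have "section_vol W (\<lambda>i. cut (v i)) \<in> smooth_funs X W"
  proof (rule S.alternating_in_submodule[OF alt, of "\<lambda>i. cut (e i)"])
    show "cut (e i) \<in> M" if "i < n" for i using e[OF that] by (rule cut_M)
    show "cut (v i) \<in> M" if "i < n" for i using v[OF that] by (rule cut_M)
    show "\<exists>c. (\<forall>i<n. c i \<in> smooth_funs X W) \<and> x = (\<Sum>i<n. smult_sec X (c i) (cut (e i)))" if x: "x \<in> M" for x
    proof -
      obtain c where c: "\<forall>i<n. smooth_fun X W (c i)" "\<forall>p\<in>W. x p = (\<Sum>i<n. smul X (c i p) (e i p))"
        using x by (auto simp: M_def smooth_comb_def)
      have "x p = (\<Sum>i<n. smult_sec X (\<lambda>p. if p \<in> W then c i p else 0) (cut (e i))) p" for p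
        using c(2) x by (cases "p \<in> W") (auto simp: sum_apply smult_sec_def cut_def M_def)
      then show ?thesis
        using c(1) W by (intro exI[of _ "\<lambda>i p. if p \<in> W then c i p else 0"]) (auto intro!: smooth_funsI)
    qed
    show "section_vol W (\<lambda>i. cut (e i)) \<in> smooth_funs X W"
    proof -
      have "\<forall>(W, e)\<in>frames X. smooth_fun X W (\<lambda>p. vol X p (\<lambda>i. e i p)) \<and> (\<forall>p\<in>W. vol X p (\<lambda>i. e i p) \<noteq> 0)"
        using vf unfolding volume_form_def by (elim conjE)
      from bspec[OF this fr] have "smooth_fun X W' (\<lambda>p. vol X p (\<lambda>i. e i p))" by simp
      then have "smooth_fun X W (\<lambda>p. vol X p (\<lambda>i. e i p))" using W smooth_fun_subset by blast
      from smooth_funsI[OF W(1) this] show ?thesis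
        by (simp add: section_vol_def[abs_def] cut_def cong: if_cong)
    qed
  qed (use smooth_funs_ring[OF W(1)] S.R_0 in auto)
  then have "smooth_fun X W (section_vol W (\<lambda>i. cut (v i)))" by (simp add: smooth_funs_def)
  then show ?thesis by (rule smooth_fun_cong[OF W(1), rotated]) (simp add: section_vol_def cut_def)
qed

lemma sections_fibre: "\<sigma> \<in> sections X n U \<Longrightarrow> p \<in> U \<Longrightarrow> \<sigma> p \<in> fibre X p"
  and sections_outside: "\<sigma> \<in> sections X n U \<Longrightarrow> p \<notin> U \<Longrightarrow> \<sigma> p = 0"
  by (auto simp: sections_def)

lemma sections_comb: "\<sigma> \<in> sections X n U \<Longrightarrow> (W, e) \<in> frames X \<Longrightarrow> smooth_comb X n (U \<inter> W) e \<sigma>"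
  by (auto simp: sections_def)

lemma restricted_module_sections:
  assumes U: "open U"
  shows "restricted_module (smooth_funs X U) (sections X n U) (smult_sec X) (ind U)"
proof (rule restricted_module_sections_on[OF U])
  have op: "open (U \<inter> W')" if "(W', e) \<in> frames X" for W' e using that frame_open U by blast
  have F: "0 \<in> fibre X p" "x \<in> fibre X p \<Longrightarrow> y \<in> fibre X p \<Longrightarrow> x + y \<in> fibre X p"
    "x \<in> fibre X p \<Longrightarrow> smul X a x \<in> fibre X p" for p x y a
  proof -
    interpret F: restricted_module UNIV "fibre X p" "smul X" 1 by (rule restricted_module_fibre)
    show "0 \<in> fibre X p" "x \<in> fibre X p \<Longrightarrow> y \<in> fibre X p \<Longrightarrow> x + y \<in> fibre X p"
      "x \<in> fibre X p \<Longrightarrow> smul X a x \<in> fibre X p" by auto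
  qed
  show "0 \<in> sections X n U" using F op by (auto simp: sections_def intro!: smooth_comb_0)
  show "x + y \<in> sections X n U" if "x \<in> sections X n U" "y \<in> sections X n U" for x y
    using that F op unfolding sections_def by (fastforce intro!: smooth_comb_add)
  show "smult_sec X f x \<in> sections X n U" if "f \<in> smooth_funs X U" "x \<in> sections X n U" for f x
  proof -
    have "smooth_comb X n (U \<inter> W') e (smult_sec X f x)" if "(W', e) \<in> frames X" for W' e
      using that op[OF that] \<open>f \<in> _\<close> \<open>x \<in> _\<close>
      by (intro smooth_comb_sm) (auto simp: sections_def smooth_funs_def intro: smooth_fun_subset)
    then show ?thesis using that F by (auto simp: sections_def smult_sec_def)
  qed
qed (simp add: sections_outside)

lemma section_vol_smooth:
  assumes U: "open U" and v: "\<And>i. i < n \<Longrightarrow> v i \<in> sections X n U"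
  shows "section_vol U v \<in> smooth_funs X U"
proof -
  have "smooth_fun X U (\<lambda>p. vol X p (\<lambda>i. v i p))"
  proof (rule smooth_fun_local[OF _ U])
    fix p assume "p \<in> U"
    obtain W e where We: "(W, e) \<in> frames X" "p \<in> W" by (rule frame_at)
    have "smooth_fun X (U \<inter> W) (\<lambda>p. vol X p (\<lambda>i. v i p))"
      using sections_comb[OF v We(1)] frame_open[OF We(1)] U
      by (intro section_vol_smooth_local[OF We(1)]) auto
    then show "\<exists>V. open V \<and> p \<in> V \<and> smooth_fun X (U \<inter> V) (\<lambda>p. vol X p (\<lambda>i. v i p))"
      using We frame_open by blast
  qed
  from smooth_funsI[OF U this] show ?thesis by (simp add: section_vol_def[abs_def])
qed

end

section \<open>Sections over a chart\<close>

lemma fun_power_apply: "((f :: 'a \<Rightarrow> complex) ^ k) p = f p ^ k"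
  by (induction k) auto

lemma fun_of_nat_apply: "(of_nat k :: 'a \<Rightarrow> complex) p = of_nat k"
  by (induction k) auto

locale adapted_chart = volume_bundle X n
  for X :: "('s::topological_space, 'v::ab_group_add) vbundle" and n :: nat +
  fixes U :: "'s set" and z :: "'s \<Rightarrow> complex" and e :: "nat \<Rightarrow> 's \<Rightarrow> 'v"
  assumes Uz: "(U, z) \<in> charts X" and sc: "simply_connected (z ` U)" and ad: "adapted_frame X n U e"
begin

lemma U_open: "open U" using chart(1)[OF Uz] .

lemma zU_open: "open (z ` U)" using chart(2)[OF Uz] .

lemma e_sections: "i < n \<Longrightarrow> e i \<in> sections X n U"
  and e_basis: "p \<in> U \<Longrightarrow> basis_at X n p (\<lambda>i. e i p)"
  and e_vol: "p \<in> U \<Longrightarrow> vol X p (\<lambda>i. e i p) = 1"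
  and e_line: "p \<in> U \<Longrightarrow> line X p = range (\<lambda>a. smul X a (e 0 p))"
  using ad unfolding adapted_frame_def generates_line_def by blast+

text \<open>The algebra above applies in each fibre, which turns pointwise statements about the gauge transformations
  into instances of it.\<close>

lemma fibre_module:
  assumes p: "p \<in> U"
  shows "volume_module UNIV (fibre X p) (smul X) 1 n (vol X p) (\<lambda>i. e i p)"
proof -
  interpret F: restricted_module UNIV "fibre X p" "smul X" 1 by (rule restricted_module_fibre)
  show ?thesis
  proof
    show "F.alternating n (vol X p)" by (rule vol_alternating)
    show "vol X p (\<lambda>i. e i p) = 1" using e_vol[OF p] .
    show "e i p \<in> fibre X p" if "i < n" for i using sections_fibre[OF e_sections[OF that] p] .
    show "\<exists>c. (\<forall>i<n. c i \<in> UNIV) \<and> x = (\<Sum>i<n. smul X (c i) (e i p))" if x: "x \<in> fibre X p" for x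
    proof -
      have "(\<lambda>c. \<Sum>i<n. smul X (c i) (e i p)) ` ({..<n} \<rightarrow>\<^sub>E UNIV) = fibre X p"
        using e_basis[OF p] by (simp only: basis_at_def bij_betw_def)
      with x have "x \<in> (\<lambda>c. \<Sum>i<n. smul X (c i) (e i p)) ` ({..<n} \<rightarrow>\<^sub>E UNIV)" by (simp only:)
      then obtain c where "x = (\<Sum>i<n. smul X (c i) (e i p))" by (rule imageE)
      then show ?thesis by blast
    qed
  qed (simp_all add: n_pos)
qed

text \<open>Coordinates with respect to \<open>e\<close> are volumes by Cramer's rule in the fibres, and hence smooth.\<close>

lemma sections_module:
  "volume_module (smooth_funs X U) (sections X n U) (smult_sec X) (ind U) n (section_vol U) e"
proof -
  interpret S: restricted_module "smooth_funs X U" "sections X n U" "smult_sec X" "ind U"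
    by (rule restricted_module_sections[OF U_open])
  show ?thesis
  proof
    show alt: "S.alternating n (section_vol U)"
      by (rule section_vol_alternating[OF S.restricted_module_axioms]) (rule sections_fibre)
    show "section_vol U v \<in> smooth_funs X U" if "\<And>i. i < n \<Longrightarrow> v i \<in> sections X n U" for v
      using section_vol_smooth[OF U_open] that by blast
    show "section_vol U e = ind U" by (auto simp: section_vol_def ind_def e_vol)
    show "\<exists>c. (\<forall>i<n. c i \<in> smooth_funs X U) \<and> x = (\<Sum>i<n. smult_sec X (c i) (e i))"
      if x: "x \<in> sections X n U" for x
    proof -
      define c where "c = (\<lambda>i. section_vol U (e(i := x)))"
      have "c i \<in> smooth_funs X U" if "i < n" for i
        unfolding c_def using x e_sections by (intro section_vol_smooth U_open) auto
      moreover have "x = (\<Sum>i<n. smult_sec X (c i) (e i))"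
      proof
        fix p
        show "x p = (\<Sum>i<n. smult_sec X (c i) (e i)) p"
        proof (cases "p \<in> U")
          case True
          interpret F: volume_module UNIV "fibre X p" "smul X" 1 n "vol X p" "\<lambda>i. e i p"
            by (rule fibre_module[OF True])
          have 1: "x p = (\<Sum>i<n. smul X (F.coord (\<lambda>i. e i p) i (x p)) (e i p))"
            using sections_fibre[OF x True] by (rule F.expand_e)
          have "F.coord (\<lambda>i. e i p) i (x p) = c i p" for i
            unfolding F.coord_def c_def section_vol_def upd_apply using True by simp
          with 1 show ?thesis by (simp add: sum_apply smult_sec_def)
        next
          case False
          then show ?thesis
            using sections_outside[OF x False] by (simp add: sum_apply smult_sec_def c_def section_vol_def)
        qed
      qed
      ultimately show ?thesis by blast
    qed
  qed (use n_pos e_sections in auto)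
qed

sublocale S: volume_module "smooth_funs X U" "sections X n U" "smult_sec X" "ind U" n "section_vol U" e
  by (rule sections_module)

lemma smooth_funs_outside: "f \<in> smooth_funs X U \<Longrightarrow> p \<notin> U \<Longrightarrow> f p = 0"
  by (simp add: smooth_funs_def)

lemma smooth_funs_chart: "f \<in> smooth_funs X U \<Longrightarrow> Csmooth_on (z ` U) (f \<circ> inv_into U z)"
proof -
  assume "f \<in> smooth_funs X U"
  then have "\<forall>(U', z)\<in>charts X. Csmooth_on (z ` (U' \<inter> U)) (f \<circ> inv_into U' z)"
    unfolding smooth_funs_def smooth_fun_def mem_Collect_eq by (rule conjunct1)
  from bspec[OF this Uz] show ?thesis by simp
qed

lemma sections_eqI:
  assumes "\<sigma> \<in> sections X n U" "\<tau> \<in> sections X n U" "\<And>p. p \<in> U \<Longrightarrow> \<sigma> p = \<tau> p"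
  shows "\<sigma> = \<tau>"
  using assms sections_outside by (metis ext)

lemma derivation_of_chart:
  assumes P: "P = wirt \<and> d = dz U z \<or> P = wirt_bar \<and> d = dz_bar U z"
  shows "S.derivation d"
proof -
  have d: "d f p = (if p \<in> U then P (f \<circ> inv_into U z) (z p) else 0)" for f p
    using P by (auto simp: dz_def dz_bar_def)
  have P_smooth: "Csmooth_on (z ` U) f \<Longrightarrow> Csmooth_on (z ` U) (P f)" for f
    using P Csmooth_on_wirt[OF zU_open] by blast
  have P_add: "P (\<lambda>w. f w + g w) w = P f w + P g w"
    and P_mult: "P (\<lambda>w. f w * g w) w = P f w * g w + f w * P g w"
    if "f differentiable at w" "g differentiable at w" for f g w
    using P wirt_add[OF that] wirt_bar_add[OF that] wirt_mult[OF that] wirt_bar_mult[OF that] by auto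
  have diff: "f \<circ> inv_into U z differentiable at (z p)" if "f \<in> smooth_funs X U" "p \<in> U" for f p
    using Csmooth_on_differentiable[OF smooth_funs_chart[OF that(1)]] that(2) by blast
  show ?thesis unfolding S.derivation_def
  proof (intro conjI ballI)
    fix f assume f: "f \<in> smooth_funs X U"
    have "Csmooth_on (z ` U) (d f \<circ> inv_into U z)"
      by (rule Csmooth_on_cong[OF zU_open _ P_smooth[OF smooth_funs_chart[OF f]]])
        (auto simp: d inv_chart[OF Uz])
    from smooth_fun_chart[OF Uz this] show "d f \<in> smooth_funs X U"
      by (simp add: smooth_funs_def d)
  next
    fix f g assume fg: "f \<in> smooth_funs X U" "g \<in> smooth_funs X U"
    show "d (f + g) = d f + d g"
      using P_add[OF diff[OF fg(1)] diff[OF fg(2)]]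
      by (auto simp: fun_eq_iff d o_def)
    show "d (f * g) = d f * g + f * d g"
      using P_mult[OF diff[OF fg(1)] diff[OF fg(2)]] inv_chart[OF Uz]
      by (auto simp: fun_eq_iff d o_def)
  qed
qed

lemma der: "S.derivation (dz U z)" "S.derivation (dz_bar U z)"
  using derivation_of_chart by blast+

lemma dz_commute: "f \<in> smooth_funs X U \<Longrightarrow> dz U z (dz_bar U z f) = dz_bar U z (dz U z f)"
proof
  fix p assume f: "f \<in> smooth_funs X U"
  let ?f = "f \<circ> inv_into U z"
  note sm = smooth_funs_chart[OF f]
  show "dz U z (dz_bar U z f) p = dz_bar U z (dz U z f) p"
  proof (cases "p \<in> U")
    case True
    have "wirt (dz_bar U z f \<circ> inv_into U z) (z p) = wirt (wirt_bar ?f) (z p)"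
      by (rule wirt_cong[OF zU_open]) (use True in \<open>auto simp: dz_bar_def inv_chart[OF Uz]
          intro: Csmooth_on_differentiable[OF Csmooth_on_wirt(2)[OF zU_open sm]]\<close>)
    moreover have "wirt_bar (dz U z f \<circ> inv_into U z) (z p) = wirt_bar (wirt ?f) (z p)"
      by (rule wirt_bar_cong[OF zU_open]) (use True in \<open>auto simp: dz_def inv_chart[OF Uz]
          intro: Csmooth_on_differentiable[OF Csmooth_on_wirt(1)[OF zU_open sm]]\<close>)
    moreover have "wirt (wirt_bar ?f) (z p) = wirt_bar (wirt ?f) (z p)"
      using wirt_commute[OF sm zU_open] True by blast
    ultimately show ?thesis
      using True by (simp add: dz_def[of U z "dz_bar U z f"] dz_bar_def[of U z "dz U z f"])
  qed (simp add: dz_def dz_bar_def)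
qed

text \<open>Division by \<open>n\<close> is needed to solve the trace equation for \<open>\<mu>\<^sub>1\<close>.\<close>

lemma n_inverse:
  obtains h where "h \<in> smooth_funs X U" "of_nat n * h = ind U"
proof
  show "(\<lambda>p. (1 / of_nat n) * ind U p) \<in> smooth_funs X U" by (rule smooth_funs_const[OF U_open])
  show "of_nat n * (\<lambda>p. (1 / of_nat n) * ind U p) = ind U"
    using n_pos by (auto simp: fun_eq_iff fun_of_nat_apply)
qed

lemma nth_root:
  assumes w: "w \<in> smooth_funs X U" and nz: "\<And>p. p \<in> U \<Longrightarrow> w p \<noteq> 0"
  obtains f where "f \<in> smooth_funs X U" "f ^ n * w = ind U"
proof -
  obtain g where g: "Csmooth_on (z ` U) g" "\<And>y. y \<in> z ` U \<Longrightarrow> g y ^ n * (w \<circ> inv_into U z) y = 1"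
    by (rule smooth_nth_root_inverse[OF zU_open sc smooth_funs_chart[OF w] _ n_pos])
      (use nz inv_chart[OF Uz] in auto)
  define f where "f = (\<lambda>p. if p \<in> U then g (z p) else 0)"
  have "Csmooth_on (z ` U) (f \<circ> inv_into U z)"
    by (rule Csmooth_on_cong[OF zU_open _ g(1)]) (auto simp: f_def inv_chart[OF Uz])
  from smooth_fun_chart[OF Uz this] have "f \<in> smooth_funs X U" by (simp add: smooth_funs_def f_def)
  moreover have "f ^ n * w = ind U"
  proof
    fix p show "(f ^ n * w) p = ind U p"
      using g(2)[of "z p"] smooth_funs_outside[OF w, of p]
      by (auto simp: fun_power_apply f_def ind_def inv_chart[OF Uz])
  qed
  ultimately show thesis using that by blast
qed

lemma covariant_iff:
  assumes out: "\<And>f p. p \<notin> U \<Longrightarrow> d f p = 0"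
  shows "covariant_derivative X n U d D \<longleftrightarrow> S.covariant d D"
proof -
  have vol: "(\<lambda>q. vol X q (\<lambda>i. \<tau> i q)) = section_vol U \<tau>" if \<tau>: "\<forall>i<n. \<tau> i \<in> sections X n U" for \<tau>
  proof
    fix q
    interpret F: restricted_module UNIV "fibre X q" "smul X" 1 by (rule restricted_module_fibre)
    show "vol X q (\<lambda>i. \<tau> i q) = section_vol U \<tau> q"
    proof (cases "q \<in> U")
      case False
      then have "\<tau> i q = 0" if "i < n" for i using \<tau> that sections_outside by blast
      then have "vol X q (\<lambda>i. \<tau> i q) = vol X q ((\<lambda>_. 0)(0 := 0))"
        by (intro F.alt_cong[OF vol_alternating]) auto
      also have "\<dots> = 0" using n_pos by (intro F.alt_0[OF vol_alternating]) auto
      finally show ?thesis using False by (simp add: section_vol_def)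
    qed (simp add: section_vol_def)
  qed
  have trace: "(\<forall>p\<in>U. d (\<lambda>q. vol X q (\<lambda>i. \<tau> i q)) p = (\<Sum>j<n. vol X p ((\<lambda>i. \<tau> i p)(j := D (\<tau> j) p))))
      \<longleftrightarrow> d (section_vol U \<tau>) = (\<Sum>j<n. section_vol U (\<tau>(j := D (\<tau> j))))" if \<tau>: "\<forall>i<n. \<tau> i \<in> sections X n U" for \<tau>
  proof -
    have "(\<Sum>j<n. section_vol U (\<tau>(j := D (\<tau> j)))) p
        = (if p \<in> U then \<Sum>j<n. vol X p ((\<lambda>i. \<tau> i p)(j := D (\<tau> j) p)) else 0)" for p
      unfolding sum_apply section_vol_def upd_apply by simp
    then show ?thesis unfolding vol[OF \<tau>] fun_eq_iff using out by auto
  qed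
  have leibniz: "smult_sec X (d f) \<sigma> + smult_sec X f (D \<sigma>)
      = (\<lambda>p. smul X (d f p) (\<sigma> p) + smul X (f p) (D \<sigma> p))" for f \<sigma>
    by (auto simp: smult_sec_def fun_eq_iff)
  have traces: "(\<forall>\<tau>. (\<forall>i<n. \<tau> i \<in> sections X n U) \<longrightarrow>
        (\<forall>p\<in>U. d (\<lambda>q. vol X q (\<lambda>i. \<tau> i q)) p = (\<Sum>j<n. vol X p ((\<lambda>i. \<tau> i p)(j := D (\<tau> j) p)))))
      \<longleftrightarrow> (\<forall>\<tau>. (\<forall>i<n. \<tau> i \<in> sections X n U) \<longrightarrow> d (section_vol U \<tau>) = (\<Sum>j<n. section_vol U (\<tau>(j := D (\<tau> j)))))"
    by (intro iff_allI imp_cong refl trace)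
  show ?thesis
    unfolding covariant_derivative_def traces S.covariant_def S.leibniz_def leibniz
    unfolding plus_fun_def by (simp only: conj_assoc)
qed

lemma connections_iff:
  "A \<in> connections X n U z \<longleftrightarrow> S.covariant (dz U z) (fst A) \<and> S.covariant (dz_bar U z) (snd A)"
proof -
  have "A \<in> connections X n U z \<longleftrightarrow>
      covariant_derivative X n U (dz U z) (fst A) \<and> covariant_derivative X n U (dz_bar U z) (snd A)"
    by (cases A) (simp add: connections_def)
  also have "\<dots> \<longleftrightarrow> S.covariant (dz U z) (fst A) \<and> S.covariant (dz_bar U z) (snd A)"
    by (subst (1 2) covariant_iff) (auto simp: dz_def dz_bar_def)
  finally show ?thesis .
qed

text \<open>The factor of proportionality is a coordinate, so it is smooth.\<close>

lemma line_sections_iff: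
  "\<sigma> \<in> line_sections X n U \<longleftrightarrow> (\<exists>f\<in>smooth_funs X U. \<sigma> = smult_sec X f (e 0))"
proof
  assume "\<exists>f\<in>smooth_funs X U. \<sigma> = smult_sec X f (e 0)"
  then show "\<sigma> \<in> line_sections X n U"
    using n_pos by (auto simp: line_sections_def e_line smult_sec_def intro!: S.M_sm e_sections)
next
  assume "\<sigma> \<in> line_sections X n U"
  then have \<sigma>: "\<sigma> \<in> sections X n U" and line: "\<And>p. p \<in> U \<Longrightarrow> \<sigma> p \<in> line X p"
    by (auto simp: line_sections_def)
  let ?f = "S.coord e 0 \<sigma>"
  have f: "?f \<in> smooth_funs X U" using \<sigma> n_pos by (intro S.coord_R S.frame_e)
  have "\<sigma> = smult_sec X ?f (e 0)"
  proof (rule sections_eqI[OF \<sigma>])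
    show "smult_sec X ?f (e 0) \<in> sections X n U" using f n_pos e_sections by (intro S.M_sm) auto
    fix p assume p: "p \<in> U"
    interpret F: volume_module UNIV "fibre X p" "smul X" 1 n "vol X p" "\<lambda>i. e i p"
      by (rule fibre_module[OF p])
    obtain a where a: "\<sigma> p = smul X a (e 0 p)" using line[OF p] e_line[OF p] by auto
    have "?f p = F.coord (\<lambda>i. e i p) 0 (smul X a (e 0 p))"
      unfolding S.coord_def F.coord_def section_vol_def upd_apply a[symmetric] using p by simp
    also have "\<dots> = a"
      using n_pos F.e_M[of 0] F.coord_frame[OF F.frame_e, of 0 0] by (simp add: F.coord_sm F.frame_e)
    finally show "\<sigma> p = smult_sec X ?f (e 0) p" using a by (simp add: smult_sec_def)
  qed
  with f show "\<exists>f\<in>smooth_funs X U. \<sigma> = smult_sec X f (e 0)" by blast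
qed

lemma section_vol_eq_ind: "section_vol U v = ind U \<longleftrightarrow> (\<forall>p\<in>U. vol X p (\<lambda>i. v i p) = 1)"
  by (auto simp: section_vol_def ind_def fun_eq_iff)

lemma unit_section_iff:
  assumes "S.leibniz d (fst A)"
  shows "unit_section X n U A s \<longleftrightarrow> S.unit_generator (fst A) s"
proof -
  have "S.frame (\<lambda>k. (fst A ^^ k) s) \<longleftrightarrow> (\<forall>p\<in>U. vol X p (\<lambda>k. (fst A ^^ k) s p) = 1)"
    if "\<exists>f\<in>smooth_funs X U. s = smult_sec X f (e 0)"
  proof -
    have "s \<in> sections X n U" using that e_sections[OF n_pos] S.M_sm by blast
    then show ?thesis using S.lei_iter[OF assms] by (simp add: S.frame_def section_vol_eq_ind)
  qed
  then show ?thesis unfolding unit_section_def line_sections_iff S.unit_generator_def by blast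
qed

lemma hat_coefficients_iff:
  assumes D: "S.leibniz d D" "S.leibniz d' D'" and s: "s \<in> sections X n U"
    and R: "\<forall>k\<in>{2..n}. t k \<in> smooth_funs X U" "\<forall>k\<in>{1..n}. \<mu> k \<in> smooth_funs X U"
  shows "S.hat_coefficients D D' s t \<mu> \<longleftrightarrow>
    (\<forall>p\<in>U. (D ^^ n) s p = (\<Sum>k=2..n. smul X (t k p) ((D ^^ (n - k)) s p))) \<and>
    (\<forall>p\<in>U. D' s p = (\<Sum>k=1..n. smul X (\<mu> k p) ((D ^^ (k - 1)) s p)))"
proof -
  have eq: "x = (\<Sum>k\<in>I. smult_sec X (c k) (y k)) \<longleftrightarrow> (\<forall>p\<in>U. x p = (\<Sum>k\<in>I. smul X (c k p) (y k p)))"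
    if "x \<in> sections X n U" "\<forall>k\<in>I. c k \<in> smooth_funs X U" "\<And>k. y k \<in> sections X n U" for x c y and I :: "nat set"
  proof -
    have "(\<Sum>k\<in>I. smult_sec X (c k) (y k)) \<in> sections X n U" using that by (intro S.M_sum S.M_sm) auto
    then have "x = (\<Sum>k\<in>I. smult_sec X (c k) (y k)) \<longleftrightarrow> (\<forall>p\<in>U. x p = (\<Sum>k\<in>I. smult_sec X (c k) (y k)) p)"
      using sections_eqI[OF that(1)] by metis
    then show ?thesis by (simp add: sum_apply smult_sec_def)
  qed
  have it: "(D ^^ k) s \<in> sections X n U" for k using S.lei_iter[OF D(1) s] .
  show ?thesis
    unfolding S.hat_coefficients_def eq[OF it R(1) it] eq[OF S.lei_M[OF D(2) s] R(2) it] using R by simp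
qed

text \<open>The definite description is meaningful since all unit sections yield the same functions.\<close>

lemma hat_functions_eq:
  assumes A: "A \<in> connections X n U z" and s: "S.unit_generator (fst A) s" and o: "S.hat_coefficients (fst A) (snd A) s t \<mu>"
  shows "hat_functions X n U A = (restrict \<mu> {1..n}, restrict t {2..n})"
proof -
  have lei: "S.leibniz (dz U z) (fst A)" "S.leibniz (dz_bar U z) (snd A)"
    using A by (auto simp: connections_iff S.covariant_def)
  obtain h where h: "h \<in> smooth_funs X U" "of_nat n * h = ind U" by (rule n_inverse)
  have char: "(\<mu>' \<in> {1..n} \<rightarrow>\<^sub>E smooth_funs X U \<and> t' \<in> {2..n} \<rightarrow>\<^sub>E smooth_funs X U \<and>
     (\<exists>s. unit_section X n U A s \<and>
        (\<forall>p\<in>U. (fst A ^^ n) s p = (\<Sum>k=2..n. smul X (t' k p) ((fst A ^^ (n - k)) s p))) \<and>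
        (\<forall>p\<in>U. snd A s p = (\<Sum>k=1..n. smul X (\<mu>' k p) ((fst A ^^ (k - 1)) s p))))) \<longleftrightarrow>
     \<mu>' = restrict \<mu> {1..n} \<and> t' = restrict t {2..n}" (is "?L \<longleftrightarrow> ?R") for \<mu>' t'
  proof
    assume L: ?L
    then obtain s' where s': "S.unit_generator (fst A) s'" and
      eqs: "(\<forall>p\<in>U. (fst A ^^ n) s' p = (\<Sum>k=2..n. smul X (t' k p) ((fst A ^^ (n - k)) s' p))) \<and>
        (\<forall>p\<in>U. snd A s' p = (\<Sum>k=1..n. smul X (\<mu>' k p) ((fst A ^^ (k - 1)) s' p)))"
      unfolding unit_section_iff[OF lei(1)] by blast
    have R: "\<forall>k\<in>{2..n}. t' k \<in> smooth_funs X U" "\<forall>k\<in>{1..n}. \<mu>' k \<in> smooth_funs X U"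
      using L by auto
    have "S.hat_coefficients (fst A) (snd A) s' t' \<mu>'"
      using hat_coefficients_iff[OF lei S.unit_generator_M[OF s'] R] eqs by blast
    then have "S.hat_coefficients (fst A) (snd A) s t' \<mu>'"
      using S.hat_coefficients_change_unit[OF lei(1) der(1) lei(2) der(2) h s' s] by blast
    from S.hat_coefficients_unique[OF s this o]
    have eq: "\<And>k. k \<in> {2..n} \<Longrightarrow> t' k = t k" "\<And>k. k \<in> {1..n} \<Longrightarrow> \<mu>' k = \<mu> k" by blast+
    have undef: "\<And>k. k \<notin> {2..n} \<Longrightarrow> t' k = undefined" "\<And>k. k \<notin> {1..n} \<Longrightarrow> \<mu>' k = undefined"
      using L PiE_arb[of t' "{2..n}"] PiE_arb[of \<mu>' "{1..n}"] by blast+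
    show ?R using eq undef unfolding restrict_def fun_eq_iff by presburger
  next
    assume R: ?R
    have mem: "\<forall>k\<in>{2..n}. t' k \<in> smooth_funs X U" "\<forall>k\<in>{1..n}. \<mu>' k \<in> smooth_funs X U"
      using R o by (auto simp: S.hat_coefficients_def)
    have "S.hat_coefficients (fst A) (snd A) s t' \<mu>'"
      using R o unfolding S.hat_coefficients_def by (auto intro!: sum.cong)
    note eqs = iffD1[OF hat_coefficients_iff[OF lei S.unit_generator_M[OF s] mem] this]
    show ?L
    proof (intro conjI exI)
      show "\<mu>' \<in> {1..n} \<rightarrow>\<^sub>E smooth_funs X U" "t' \<in> {2..n} \<rightarrow>\<^sub>E smooth_funs X U"
        using mem R by (auto simp: PiE_def extensional_def)
      show "unit_section X n U A s" using s unit_section_iff[OF lei(1)] by blast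
    qed (fact conjunct1[OF eqs], fact conjunct2[OF eqs])
  qed
  show ?thesis
    unfolding hat_functions_def by (rule the_equality) (auto simp only: char prod.case split: prod.splits)
qed

lemma hat_params_eq:
  assumes "A \<in> connections X n U z" "S.unit_generator (fst A) s" "S.hat_coefficients (fst A) (snd A) s t \<mu>"
  shows "hat_params X n U A = (restrict \<mu> {2..n}, restrict t {2..n})"
  unfolding hat_params_def hat_mu_def hat_t_def hat_functions_eq[OF assms]
  by (auto simp: restrict_def fun_eq_iff)

end

section \<open>Generic parabolic connections and gauge transformations\<close>

context adapted_chart
begin

lemma covariant_leibniz:
  assumes "A \<in> connections X n U z"
  shows "S.leibniz (dz U z) (fst A)" "S.leibniz (dz_bar U z) (snd A)"
  using assms by (auto simp: connections_iff S.covariant_def)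

lemma curv_curvature: "curv A = S.curvature (fst A) (snd A)"
  by (simp add: fun_eq_iff curv_def S.curvature_def)

lemma curvature_leibniz:
  assumes "A \<in> connections X n U z"
  shows "S.leibniz (\<lambda>_. 0) (curv A)"
  unfolding curv_curvature
  using S.curvature_linear[OF der covariant_leibniz[OF assms] dz_commute] .

text \<open>Multiplication of a section by \<open>f\<close> multiplies its determinant by \<open>f\<^sup>n\<close>, so an \<open>n\<close>-th root normalizes it.
  Simple connectedness of the chart is used here.\<close>

lemma generic_imp_unit_generator:
  assumes A: "A \<in> connections X n U z" and g: "generic X n U A"
  shows "\<exists>s. S.unit_generator (fst A) s"
proof -
  obtain \<sigma> where \<sigma>: "\<sigma> \<in> line_sections X n U" "\<And>p. p \<in> U \<Longrightarrow> vol X p (\<lambda>k. (fst A ^^ k) \<sigma> p) \<noteq> 0"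
    using g unfolding generic_def by blast
  obtain c where c: "c \<in> smooth_funs X U" "\<sigma> = smult_sec X c (e 0)"
    using \<sigma>(1) line_sections_iff by blast
  note lei = covariant_leibniz[OF A]
  have "\<sigma> \<in> sections X n U" using \<sigma>(1) by (simp add: line_sections_def)
  then have "section_vol U (\<lambda>k. (fst A ^^ k) \<sigma>) \<in> smooth_funs X U"
    by (intro S.vol_R S.lei_iter[OF lei(1)])
  moreover have "section_vol U (\<lambda>k. (fst A ^^ k) \<sigma>) p \<noteq> 0" if "p \<in> U" for p
    using \<sigma>(2)[OF that] that by (simp add: section_vol_def)
  ultimately obtain f where "f \<in> smooth_funs X U" "f ^ n * section_vol U (\<lambda>k. (fst A ^^ k) \<sigma>) = ind U"
    using nth_root by blast
  then show ?thesis
    using S.unit_generator_exists[OF lei(1) der(1) c(1)] unfolding c(2) by blast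
qed

text \<open>The adapted frame in the definition of parabolicity may differ from \<open>e\<close>; both span the same line.\<close>

lemma parabolic_imp_parabolic_at:
  assumes A: "A \<in> connections X n U z" and par: "parabolic X n U A" and s: "S.unit_generator (fst A) s"
  shows "S.parabolic_at (curv A) s"
proof -
  obtain e' where e': "adapted_frame X n U e'" and F0: "\<And>p. p \<in> U \<Longrightarrow> curv A (e' 0) p = 0"
    and Fj: "\<And>j. j \<in> {1..<n} \<Longrightarrow> \<exists>\<xi>\<in>smooth_funs X U. \<forall>p\<in>U. curv A (e' j) p = smul X (\<xi> p) (e' 0 p)"
    using par unfolding parabolic_def by blast
  interpret E: adapted_chart X n U z e'
    by unfold_locales (fact Uz sc e')+
  have line: "(\<exists>f\<in>smooth_funs X U. \<sigma> = smult_sec X f (e 0)) \<longleftrightarrow> (\<exists>f\<in>smooth_funs X U. \<sigma> = smult_sec X f (e' 0))" for \<sigma>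
    using line_sections_iff E.line_sections_iff by blast
  obtain c where c: "c \<in> smooth_funs X U" "s = smult_sec X c (e' 0)"
    using s line[of s] by (auto simp: S.unit_generator_def)
  have "e' 0 = smult_sec X (ind U) (e' 0)" using E.e_sections[OF n_pos] by simp
  then obtain f where f: "f \<in> smooth_funs X U" "e' 0 = smult_sec X f (e 0)"
    using line[of "e' 0"] S.R_u by blast
  obtain q where q: "q \<in> smooth_funs X U" "e 0 = smult_sec X q s"
    using S.line_of_unit_generator[OF s] .
  have c': "f * q \<in> smooth_funs X U" "e' 0 = smult_sec X (f * q) s"
    using f q by (auto simp: S.mult_sm)
  have FM: "curv A x \<in> sections X n U" if "x \<in> sections X n U" for x
    using S.lei_M[OF curvature_leibniz[OF A] that] .
  show ?thesis
  proof (rule S.parabolic_at_frame[where e' = e', OF curvature_leibniz[OF A] _ c c'])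
    show "S.frame e'" using E.S.frame_e by (simp add: S.frame_def E.S.frame_def)
    show "curv A (e' 0) = 0"
      using F0 FM E.e_sections[OF n_pos] by (intro sections_eqI) auto
    show "\<exists>\<xi>\<in>smooth_funs X U. curv A (e' j) = smult_sec X \<xi> (e' 0)" if j: "j \<in> {1..<n}" for j
    proof -
      obtain \<xi> where \<xi>: "\<xi> \<in> smooth_funs X U" "\<forall>p\<in>U. curv A (e' j) p = smul X (\<xi> p) (e' 0 p)"
        using Fj[OF j] by blast
      have "curv A (e' j) = smult_sec X \<xi> (e' 0)"
        using j \<xi> FM E.e_sections n_pos by (intro sections_eqI S.M_sm) (auto simp: smult_sec_def)
      then show ?thesis using \<xi>(1) by blast
    qed
  qed
qed

lemma generic_parabolic_iff:
  "A \<in> generic_parabolic X n U z \<longleftrightarrow> A \<in> connections X n U z \<and>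
     (\<exists>s. S.unit_generator (fst A) s \<and> S.parabolic_at (S.curvature (fst A) (snd A)) s)"
proof
  assume "A \<in> generic_parabolic X n U z"
  then show "A \<in> connections X n U z \<and>
     (\<exists>s. S.unit_generator (fst A) s \<and> S.parabolic_at (S.curvature (fst A) (snd A)) s)"
    unfolding generic_parabolic_def curv_curvature[symmetric]
    using generic_imp_unit_generator parabolic_imp_parabolic_at by blast
next
  assume "A \<in> connections X n U z \<and>
     (\<exists>s. S.unit_generator (fst A) s \<and> S.parabolic_at (S.curvature (fst A) (snd A)) s)"
  then obtain s where A: "A \<in> connections X n U z" and s: "S.unit_generator (fst A) s"
    and par: "S.parabolic_at (curv A) s"
    by (auto simp: curv_curvature)
  have unit: "s \<in> line_sections X n U" "\<And>p. p \<in> U \<Longrightarrow> vol X p (\<lambda>k. (fst A ^^ k) s p) = 1"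
    using s unit_section_iff[OF covariant_leibniz(1)[OF A]] by (auto simp: unit_section_def)
  have "s p \<noteq> 0" if p: "p \<in> U" for p
  proof
    assume "s p = 0"
    interpret F: restricted_module UNIV "fibre X p" "smul X" 1 by (rule restricted_module_fibre)
    let ?v = "\<lambda>k. (fst A ^^ k) s p"
    have "vol X p (?v(0 := 0)) = 0"
      using n_pos p sections_fibre S.lei_iter[OF covariant_leibniz(1)[OF A] S.unit_generator_M[OF s]]
      by (intro F.alt_0[OF vol_alternating]) blast+
    moreover have "?v(0 := 0) = ?v" using \<open>s p = 0\<close> by auto
    ultimately show False using unit(2)[OF p] by simp
  qed
  then have "generic X n U A" using unit unfolding generic_def by (intro bexI[of _ s]) auto
  moreover have "parabolic X n U A"
    unfolding parabolic_def
  proof (intro exI conjI ballI)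
    show "adapted_frame X n U e" by (rule ad)
    obtain q where q: "q \<in> smooth_funs X U" "e 0 = smult_sec X q s"
      using S.line_of_unit_generator[OF s] .
    obtain f where f: "f \<in> smooth_funs X U" "s = smult_sec X f (e 0)"
      using s by (auto simp: S.unit_generator_def)
    have "curv A (smult_sec X q s) = 0"
      using q(1) par S.unit_generator_M[OF s] by (simp add: S.lei_sm[OF curvature_leibniz[OF A]] S.parabolic_at_def)
    then show "curv A (e 0) p = 0" for p using q(2) by simp
    show "\<exists>\<xi>\<in>smooth_funs X U. \<forall>p\<in>U. curv A (e j) p = smul X (\<xi> p) (e 0 p)" if j: "j \<in> {1..<n}" for j
    proof -
      obtain \<xi> where \<xi>: "\<xi> \<in> smooth_funs X U" "curv A (e j) = smult_sec X \<xi> s"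
        using par e_sections[of j] j by (auto simp: S.parabolic_at_def)
      have "smult_sec X \<xi> s = smult_sec X (\<xi> * f) (e 0)" using f(2) by (simp add: S.mult_sm)
      then show ?thesis using \<xi> f(1) by (intro bexI[of _ "\<xi> * f"]) (auto simp: smult_sec_def)
    qed
  qed
  ultimately show "A \<in> generic_parabolic X n U z" using A by (simp add: generic_parabolic_def)
qed

lemma generic_parabolic_hat_coefficients:
  assumes "A \<in> generic_parabolic X n U z"
  obtains s t \<mu> where "A \<in> connections X n U z" "S.unit_generator (fst A) s"
    "S.parabolic_at (S.curvature (fst A) (snd A)) s" "S.hat_coefficients (fst A) (snd A) s t \<mu>"
    "hat_params X n U A = (restrict \<mu> {2..n}, restrict t {2..n})"
proof -
  obtain s where A: "A \<in> connections X n U z" and s: "S.unit_generator (fst A) s"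
    and par: "S.parabolic_at (S.curvature (fst A) (snd A)) s"
    using assms generic_parabolic_iff by blast
  obtain t \<mu> where o: "S.hat_coefficients (fst A) (snd A) s t \<mu>"
    using S.hat_coefficients_exist[OF _ der(1) _ s] A covariant_leibniz(2)[OF A] S.unit_generator_M[OF s]
    unfolding connections_iff by (meson S.lei_M)
  show thesis using that[OF A s par o hat_params_eq[OF A s o]] .
qed

lemma line_unit_generator:
  assumes s: "S.unit_generator D s" and p: "p \<in> U"
  shows "line X p = range (\<lambda>a. smul X a (s p))"
proof -
  obtain q where q: "e 0 = smult_sec X q s" using S.line_of_unit_generator[OF s] by blast
  obtain f where f: "s = smult_sec X f (e 0)" using s by (auto simp: S.unit_generator_def)
  have es: "smul X a (e 0 p) = smul X (a * q p) (s p)" for a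
    by (simp add: q smult_sec_def)
  have se: "smul X a (s p) = smul X (a * f p) (e 0 p)" for a
    by (subst f) (simp add: smult_sec_def)
  show ?thesis
    unfolding e_line[OF p]
  proof (intro equalityI image_subsetI)
    show "smul X a (e 0 p) \<in> range (\<lambda>a. smul X a (s p))" for a by (subst es) (rule rangeI)
    show "smul X a (s p) \<in> range (\<lambda>a. smul X a (e 0 p))" for a by (subst se) (rule rangeI)
  qed
qed

lemma gauge_invariant:
  assumes "(A, B) \<in> gauge_rel X n U z"
  shows "hat_params X n U A = hat_params X n U B"
proof -
  from assms obtain g where A: "A \<in> generic_parabolic X n U z" and B: "B \<in> generic_parabolic X n U z"
    and g: "g \<in> line_gauge_group X n U"
    and intertwine: "\<And>\<sigma>. \<sigma> \<in> sections X n U \<Longrightarrow> fst B (gauge_act U g \<sigma>) = gauge_act U g (fst A \<sigma>)"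
      "\<And>\<sigma>. \<sigma> \<in> sections X n U \<Longrightarrow> snd B (gauge_act U g \<sigma>) = gauge_act U g (snd A \<sigma>)"
    unfolding gauge_rel_def by blast
  let ?G = "gauge_act U g"
  have gp: "\<forall>x\<in>fibre X p. \<forall>y\<in>fibre X p. \<forall>a. g p (smul X a x + y) = smul X a (g p x) + g p y"
    "\<forall>v. (\<forall>i<n. v i \<in> fibre X p) \<longrightarrow> vol X p (\<lambda>i. g p (v i)) = vol X p v"
    "g p ` line X p = line X p" if "p \<in> U" for p
    using g that unfolding line_gauge_group_def by blast+
  have GM: "?G \<sigma> \<in> sections X n U" if "\<sigma> \<in> sections X n U" for \<sigma>
    using g that unfolding line_gauge_group_def by blast
  have add: "g p (x + y) = g p x + g p y" if "p \<in> U" "x \<in> fibre X p" "y \<in> fibre X p" for p x y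
    using gp(1)[OF that(1), rule_format, OF that(2,3), of 1] by simp
  have scale: "g p (smul X a x) = smul X a (g p x)" if "p \<in> U" "x \<in> fibre X p" for p x a
  proof -
    interpret F: restricted_module UNIV "fibre X p" "smul X" 1 by (rule restricted_module_fibre)
    have "g p 0 = 0" using add[OF that(1) F.M_0 F.M_0] by simp
    then show ?thesis
      using gp(1)[OF that(1), rule_format, OF that(2) F.M_0, of a] by simp
  qed
  have lei: "S.leibniz (\<lambda>_. 0) ?G"
    unfolding S.leibniz_def
  proof (intro conjI ballI)
    show "?G x \<in> sections X n U" if "x \<in> sections X n U" for x using GM that .
    show "?G (x + y) = ?G x + ?G y" if "x \<in> sections X n U" "y \<in> sections X n U" for x y
      using add sections_fibre that by (auto simp: fun_eq_iff gauge_act_def)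
    show "?G (smult_sec X a x) = smult_sec X 0 x + smult_sec X a (?G x)" if "x \<in> sections X n U" for a x
      using scale sections_fibre that by (auto simp: fun_eq_iff gauge_act_def smult_sec_def)
  qed
  have vol: "section_vol U (\<lambda>i. ?G (v i)) = section_vol U v" if v: "\<And>i. i < n \<Longrightarrow> v i \<in> sections X n U" for v
  proof
    fix p
    have "vol X p (\<lambda>i. g p (v i p)) = vol X p (\<lambda>i. v i p)" if "p \<in> U"
      using gp(2)[OF that, rule_format, of "\<lambda>i. v i p"] sections_fibre[OF v that] by blast
    then show "section_vol U (\<lambda>i. ?G (v i)) p = section_vol U v p" by (simp add: section_vol_def gauge_act_def)
  qed
  have "?G (e 0) \<in> line_sections X n U"
  proof -
    have "?G (e 0) p \<in> line X p" if p: "p \<in> U" for p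
    proof -
      have "e 0 p \<in> line X p" unfolding e_line[OF p] by (metis V.scale_one rangeI)
      then show ?thesis using gp(3)[OF p] p by (auto simp: gauge_act_def)
    qed
    then show ?thesis using GM e_sections n_pos by (auto simp: line_sections_def)
  qed
  then obtain q where q: "q \<in> smooth_funs X U" "?G (e 0) = smult_sec X q (e 0)"
    using line_sections_iff by blast
  obtain s t \<mu> where s: "A \<in> connections X n U z" "S.unit_generator (fst A) s"
    "S.hat_coefficients (fst A) (snd A) s t \<mu>" "hat_params X n U A = (restrict \<mu> {2..n}, restrict t {2..n})"
    using generic_parabolic_hat_coefficients[OF A] by metis
  have "S.unit_generator (fst B) (?G s) \<and> S.hat_coefficients (fst B) (snd B) (?G s) t \<mu>"
    by (rule S.hat_coefficients_gauge[OF covariant_leibniz[OF s(1)] lei vol q intertwine s(2,3)])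
  moreover have "B \<in> connections X n U z" using B by (simp add: generic_parabolic_def)
  ultimately show ?thesis using hat_params_eq s(4) by metis
qed

lemma frame_fibre_frame:
  assumes "S.frame b" "p \<in> U"
  shows "volume_module.frame (fibre X p) 1 n (vol X p) (\<lambda>i. b i p)"
proof -
  interpret F: volume_module UNIV "fibre X p" "smul X" 1 n "vol X p" "\<lambda>i. e i p"
    by (rule fibre_module[OF assms(2)])
  show ?thesis using assms sections_fibre by (auto simp: F.frame_def S.frame_def section_vol_eq_ind)
qed

text \<open>The fibrewise version of \<open>transport\<close>.\<close>

definition frame_change :: "(nat \<Rightarrow> 's \<Rightarrow> 'v) \<Rightarrow> (nat \<Rightarrow> 's \<Rightarrow> 'v) \<Rightarrow> 's \<Rightarrow> 'v \<Rightarrow> 'v" where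
  "frame_change b c p x = (\<Sum>k<n. smul X (vol X p ((\<lambda>i. b i p)(k := x))) (c k p))"

lemma gauge_act_frame_change:
  assumes b: "S.frame b" and c: "S.frame c" and \<sigma>: "\<sigma> \<in> sections X n U"
  shows "gauge_act U (frame_change b c) \<sigma> = S.transport b c \<sigma>"
proof
  fix p
  show "gauge_act U (frame_change b c) \<sigma> p = S.transport b c \<sigma> p"
  proof (cases "p \<in> U")
    case True
    then show ?thesis
      unfolding S.transport_def S.coord_def sum_apply smult_sec_def section_vol_def upd_apply gauge_act_def frame_change_def
      by simp
  next
    case False
    then show ?thesis
      using sections_outside[OF S.transport_M[OF b c \<sigma>]] by (simp add: gauge_act_def)
  qed
qed

lemma frame_change_gauge:
  assumes b: "S.frame b" and c: "S.frame c"
    and line: "\<And>p. p \<in> U \<Longrightarrow> line X p = range (\<lambda>a. smul X a (b 0 p))"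
      "\<And>p. p \<in> U \<Longrightarrow> line X p = range (\<lambda>a. smul X a (c 0 p))"
  shows "frame_change b c \<in> line_gauge_group X n U"
proof -
  let ?g = "frame_change b c"
  have fib: "bij_betw (?g p) (fibre X p) (fibre X p) \<and>
        (\<forall>x\<in>fibre X p. \<forall>y\<in>fibre X p. \<forall>a. ?g p (smul X a x + y) = smul X a (?g p x) + ?g p y) \<and>
        (\<forall>v. (\<forall>i<n. v i \<in> fibre X p) \<longrightarrow> vol X p (\<lambda>i. ?g p (v i)) = vol X p v) \<and>
        ?g p ` line X p = line X p" if p: "p \<in> U" for p
  proof -
    interpret F: volume_module UNIV "fibre X p" "smul X" 1 n "vol X p" "\<lambda>i. e i p"
      by (rule fibre_module[OF p])
    have fb: "F.frame (\<lambda>i. b i p)" and fc: "F.frame (\<lambda>i. c i p)"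
      using frame_fibre_frame b c p by blast+
    have g: "?g p = F.transport (\<lambda>i. b i p) (\<lambda>i. c i p)"
      by (simp add: fun_eq_iff frame_change_def F.transport_def F.coord_def)
    have "bij_betw (?g p) (fibre X p) (fibre X p)"
      unfolding g
      by (rule bij_betw_byWitness[of _ "F.transport (\<lambda>i. c i p) (\<lambda>i. b i p)"])
        (use F.transport_inverse[OF fb fc] F.transport_inverse[OF fc fb] F.transport_M[OF fb fc]
          F.transport_M[OF fc fb] in auto)
    moreover have "?g p (smul X a x + y) = smul X a (?g p x) + ?g p y"
      if "x \<in> fibre X p" "y \<in> fibre X p" for x y a
      unfolding g using that by (simp add: F.transport_add[OF fb fc] F.transport_sm[OF fb fc] F.M_sm)
    moreover have "vol X p (\<lambda>i. ?g p (v i)) = vol X p v" if "\<forall>i<n. v i \<in> fibre X p" for v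
      unfolding g using that by (intro F.transport_vol[OF fb fc]) auto
    moreover have "?g p ` line X p = line X p"
    proof -
      have "?g p (smul X a (b 0 p)) = smul X a (c 0 p)" for a
        unfolding g using F.frame_M[OF fb n_pos] F.transport_frame[OF fb fc n_pos]
        by (simp add: F.transport_sm[OF fb fc])
      then have "?g p ` range (\<lambda>a. smul X a (b 0 p)) = range (\<lambda>a. smul X a (c 0 p))"
        by (simp add: image_image)
      then show ?thesis using line[OF p] by simp
    qed
    ultimately show ?thesis by blast
  qed
  have "gauge_act U ?g ` sections X n U = S.transport b c ` sections X n U"
    by (rule image_cong) (use gauge_act_frame_change[OF b c] in auto)
  also have "\<dots> = sections X n U"
  proof (intro equalityI subsetI)
    fix x assume "x \<in> sections X n U"
    then show "x \<in> S.transport b c ` sections X n U"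
      using S.transport_inverse[OF c b, of x] S.transport_M[OF c b, of x] by (metis imageI)
  qed (use S.transport_M[OF b c] in auto)
  finally show ?thesis using fib by (simp add: line_gauge_group_def)
qed

lemma gauge_rel_iff:
  "(A, B) \<in> gauge_rel X n U z \<longleftrightarrow> A \<in> generic_parabolic X n U z \<and> B \<in> generic_parabolic X n U z \<and>
     hat_params X n U A = hat_params X n U B"
proof
  assume "(A, B) \<in> gauge_rel X n U z"
  then show "A \<in> generic_parabolic X n U z \<and> B \<in> generic_parabolic X n U z \<and>
     hat_params X n U A = hat_params X n U B"
    using gauge_invariant by (auto simp: gauge_rel_def)
next
  assume "A \<in> generic_parabolic X n U z \<and> B \<in> generic_parabolic X n U z \<and>
     hat_params X n U A = hat_params X n U B"
  then have A: "A \<in> generic_parabolic X n U z" and B: "B \<in> generic_parabolic X n U z"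
    and eq: "hat_params X n U A = hat_params X n U B" by auto
  obtain s t \<mu> where s: "A \<in> connections X n U z" "S.unit_generator (fst A) s"
    "S.parabolic_at (S.curvature (fst A) (snd A)) s" "S.hat_coefficients (fst A) (snd A) s t \<mu>"
    "hat_params X n U A = (restrict \<mu> {2..n}, restrict t {2..n})"
    by (rule generic_parabolic_hat_coefficients[OF A])
  obtain r t' \<mu>' where r: "B \<in> connections X n U z" "S.unit_generator (fst B) r"
    "S.parabolic_at (S.curvature (fst B) (snd B)) r" "S.hat_coefficients (fst B) (snd B) r t' \<mu>'"
    "hat_params X n U B = (restrict \<mu>' {2..n}, restrict t' {2..n})"
    by (rule generic_parabolic_hat_coefficients[OF B])
  have "restrict \<mu> {2..n} k = restrict \<mu>' {2..n} k" "restrict t {2..n} k = restrict t' {2..n} k" for k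
    using eq s(5) r(5) by auto
  then have t: "t k = t' k" and \<mu>: "\<mu> k = \<mu>' k" if "k \<in> {2..n}" for k
    using that by (metis restrict_apply')+
  let ?b = "\<lambda>k. (fst A ^^ k) s" and ?c = "\<lambda>k. (fst B ^^ k) r"
  have b: "S.frame ?b" and c: "S.frame ?c" using s(2) r(2) by (auto simp: S.unit_generator_def)
  obtain h where h: "h \<in> smooth_funs X U" "of_nat n * h = ind U" by (rule n_inverse)
  have cov: "S.covariant (dz U z) (fst A)" "S.covariant (dz_bar U z) (snd A)"
    "S.covariant (dz U z) (fst B)" "S.covariant (dz_bar U z) (snd B)"
    using s(1) r(1) by (auto simp: connections_iff)
  let ?g = "frame_change ?b ?c"
  have g: "?g \<in> line_gauge_group X n U"
    using line_unit_generator[OF s(2)] line_unit_generator[OF r(2)] by (intro frame_change_gauge[OF b c]) auto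
  have "fst B (gauge_act U ?g \<sigma>) = gauge_act U ?g (fst A \<sigma>) \<and>
        snd B (gauge_act U ?g \<sigma>) = gauge_act U ?g (snd A \<sigma>)" if \<sigma>: "\<sigma> \<in> sections X n U" for \<sigma>
  proof -
    have M: "fst A \<sigma> \<in> sections X n U" "snd A \<sigma> \<in> sections X n U"
      using S.lei_M[OF covariant_leibniz(1)[OF s(1)] \<sigma>] S.lei_M[OF covariant_leibniz(2)[OF s(1)] \<sigma>] .
    note det = S.hat_coefficients_determine_connection[OF der h cov(1,2) s(2,4,3) cov(3,4) r(2,4,3) _ _ \<sigma>]
    show ?thesis
      unfolding gauge_act_frame_change[OF b c \<sigma>] gauge_act_frame_change[OF b c M(1)]
        gauge_act_frame_change[OF b c M(2)]
      using det t \<mu> by blast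
  qed
  with A B g show "(A, B) \<in> gauge_rel X n U z" unfolding gauge_rel_def by blast
qed

lemma hat_params_range:
  "hat_params X n U ` generic_parabolic X n U z =
     ({2..n} \<rightarrow>\<^sub>E smooth_funs X U) \<times> ({2..n} \<rightarrow>\<^sub>E smooth_funs X U)"
proof (intro equalityI subsetI)
  fix x assume "x \<in> hat_params X n U ` generic_parabolic X n U z"
  then obtain A where A: "A \<in> generic_parabolic X n U z" "x = hat_params X n U A" by blast
  obtain s t \<mu> where "S.hat_coefficients (fst A) (snd A) s t \<mu>"
    "hat_params X n U A = (restrict \<mu> {2..n}, restrict t {2..n})"
    by (rule generic_parabolic_hat_coefficients[OF A(1)])
  then show "x \<in> ({2..n} \<rightarrow>\<^sub>E smooth_funs X U) \<times> ({2..n} \<rightarrow>\<^sub>E smooth_funs X U)"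
    using A(2) by (auto simp: S.hat_coefficients_def)
next
  fix x assume "x \<in> ({2..n} \<rightarrow>\<^sub>E smooth_funs X U) \<times> ({2..n} \<rightarrow>\<^sub>E smooth_funs X U)"
  then obtain \<mu> t where x: "x = (\<mu>, t)" "\<mu> \<in> {2..n} \<rightarrow>\<^sub>E smooth_funs X U" "t \<in> {2..n} \<rightarrow>\<^sub>E smooth_funs X U"
    by blast
  obtain h where h: "h \<in> smooth_funs X U" "of_nat n * h = ind U" by (rule n_inverse)
  have R: "\<And>k. k \<in> {2..n} \<Longrightarrow> t k \<in> smooth_funs X U" "\<And>k. k \<in> {2..n} \<Longrightarrow> \<mu> k \<in> smooth_funs X U"
    using x by (auto dest: PiE_mem)
  have "\<exists>D D' \<mu>'. S.covariant (dz U z) D \<and> S.covariant (dz_bar U z) D' \<and> S.unit_generator D (e 0) \<and>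
      S.hat_coefficients D D' (e 0) t \<mu>' \<and> (\<forall>k\<in>{2..n}. \<mu>' k = \<mu> k) \<and> S.parabolic_at (S.curvature D D') (e 0)"
    by (rule S.hat_coefficients_realized[OF der h dz_commute]) (use R in auto)
  then obtain D D' \<mu>' where D: "S.covariant (dz U z) D" "S.covariant (dz_bar U z) D'" "S.unit_generator D (e 0)"
      "S.hat_coefficients D D' (e 0) t \<mu>'" "\<forall>k\<in>{2..n}. \<mu>' k = \<mu> k" "S.parabolic_at (S.curvature D D') (e 0)"
    by blast
  have conn: "(D, D') \<in> connections X n U z" using D by (simp add: connections_iff)
  then have "(D, D') \<in> generic_parabolic X n U z" using D generic_parabolic_iff by auto
  moreover have "hat_params X n U (D, D') = x"
  proof -
    have "restrict \<mu>' {2..n} = restrict \<mu> {2..n}" using D(5) by (intro restrict_ext) blast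
    then have "restrict \<mu>' {2..n} = \<mu>" "restrict t {2..n} = t"
      using PiE_restrict[OF x(2)] PiE_restrict[OF x(3)] by (simp_all only:)
    then show ?thesis using hat_params_eq[OF conn, of "e 0" t \<mu>'] D x(1) by simp
  qed
  ultimately show "x \<in> hat_params X n U ` generic_parabolic X n U z" by blast
qed

end

lemma quotient_of_map_bij:
  assumes r: "\<And>a b. (a, b) \<in> r \<longleftrightarrow> a \<in> S \<and> b \<in> S \<and> f a = f b"
  shows "bij_betw (\<lambda>C. the_elem (f ` C)) (S // r) (f ` S)"
proof -
  have class_val: "the_elem (f ` (r `` {a})) = f a" if "a \<in> S" for a
  proof -
    have "f ` (r `` {a}) = {f a}" using that r by auto
    then show ?thesis by simp
  qed
  show ?thesis
  proof (rule bij_betwI')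
    fix C C' assume "C \<in> S // r" "C' \<in> S // r"
    then obtain a b where ab: "a \<in> S" "b \<in> S" "C = r `` {a}" "C' = r `` {b}" by (auto elim!: quotientE)
    then have "C = C'" if "f a = f b" using that r by auto
    then show "(the_elem (f ` C) = the_elem (f ` C')) = (C = C')"
      using ab class_val[of a] class_val[of b] by auto
  next
    fix C assume "C \<in> S // r"
    then show "the_elem (f ` C) \<in> f ` S" using class_val by (auto elim!: quotientE)
  next
    fix y assume "y \<in> f ` S"
    then obtain a where "a \<in> S" "y = f a" by blast
    then show "\<exists>C\<in>S // r. y = the_elem (f ` C)"
      using class_val by (intro bexI[of _ "r `` {a}"]) (auto intro: quotientI)
  qed
qed

text \<open>A bundle of rank zero contains no line.\<close>

lemma line_subbundle_rank_pos:
  assumes "vector_bundle n X" "line_subbundle n X"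
  shows "0 < n"
proof (rule ccontr)
  assume "\<not> 0 < n"
  then have n: "n = 0" by simp
  obtain W \<sigma> where \<sigma>: "undefined \<in> W" "\<sigma> \<in> sections X n W" "generates_line X W \<sigma>"
    using assms(2) unfolding line_subbundle_def by blast
  let ?p = "undefined :: 'a"
  have "(\<Union>(W, e)\<in>frames X. W) = UNIV" and fr: "\<forall>(W, e)\<in>frames X. open W \<and> (\<forall>p\<in>W. basis_at X n p (\<lambda>i. e i p))"
    using assms(1) by (simp_all add: vector_bundle_def)
  then have "?p \<in> (\<Union>(W, e)\<in>frames X. W)" by (simp only: UNIV_I)
  then obtain W' e where We: "(W', e) \<in> frames X" "?p \<in> W'" by auto
  then have "basis_at X n ?p (\<lambda>i. e i ?p)" using bspec[OF fr We(1)] by auto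
  then have "fibre X ?p \<subseteq> {0}" using n by (auto simp: basis_at_def bij_betw_def)
  moreover have "\<sigma> ?p \<in> fibre X ?p" "\<sigma> ?p \<noteq> 0"
    using \<sigma> by (auto simp: sections_def generates_line_def)
  ultimately show False by blast
qed

theorem proposition3p7:
  fixes X :: "('s::{t2_space, second_countable_topology}, 'v::ab_group_add) vbundle"
    and n :: nat and U :: "'s set" and z :: "'s \<Rightarrow> complex"
  assumes "complex_structure X"
    and "vector_bundle n X"
    and "volume_form n X"
    and "line_subbundle n X"
    and "(U, z) \<in> charts X"
    and "simply_connected (z ` U)"
    and "\<exists>e. adapted_frame X n U e"
  shows "hat_params X n U respects gauge_rel X n U z \<and>
    bij_betw (\<lambda>C. the_elem (hat_params X n U ` C)) (moduli X n U z)
      (({2..n} \<rightarrow>\<^sub>E smooth_funs X U) \<times> ({2..n} \<rightarrow>\<^sub>E smooth_funs X U))"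
proof -
  obtain e where e: "adapted_frame X n U e" using assms(7) by blast
  have "0 < n" using line_subbundle_rank_pos assms(2,4) by blast
  interpret adapted_chart X n U z e
    by unfold_locales (fact assms e \<open>0 < n\<close>)+
  have "hat_params X n U respects gauge_rel X n U z"
    by (auto simp: congruent_def gauge_rel_iff)
  moreover have "bij_betw (\<lambda>C. the_elem (hat_params X n U ` C)) (moduli X n U z)
      (hat_params X n U ` generic_parabolic X n U z)"
    unfolding moduli_def using gauge_rel_iff by (rule quotient_of_map_bij)
  ultimately show ?thesis by (simp only: hat_params_range simp_thms)
qed

end
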